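(* In the two-tier cache-enabled network model described in the context, the successful access delivery probability $C_{Lp,2}$, i.e. the probability that a tagged user requesting a content of the second (less popular) group connects to the helpers tier and has access rate $R_{Lp,2}\ge R_0$, is $$C_{Lp,2}=\int_0^\infty\sum_{l_2=0}^\infty2\pi p_{Lp}\lambda_2z\,\exp\!\left(-z^\alpha P_2^{-1}\delta_2\sigma^2\right)\exp\!\left(-\pi p_{Lp}\lambda_2z^2\big(\xi_2G(\delta_2,\alpha)+\varsigma_2H(\delta_2,\alpha)+\zeta_2\big)\right)P_{L_2}(l_2+1)\,dz,$$ where $\delta_2=2^{(l_2+1)R_0/W}-1$ and the coefficients are given, for tier $k\in\{1,2\}$ with $\lambda_1'=\lambda_1$, $\lambda_2'=p_{Lp}\lambda_2$, by $$\xi_k=\frac{\lambda_1P_1+p_ap_{Lp}\lambda_2P_2}{\lambda_k'P_k},\quad \varsigma_k=\frac{p_a(1-p_{Lp})\lambda_2P_2}{\lambda_k'P_k},\quad \zeta_k=\frac{\lambda_1P_1+p_{Lp}\lambda_2P_2}{\lambda_k'P_k}.$$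
   Context: Parameters: path loss exponent $\alpha\in(2,4]$; $\lambda_1,\lambda_2,\lambda_u,P_1,P_2,W,R_0>0$; noise power $\sigma^2\ge 0$; integers $N,N_1,N_2\ge1$ with $N_1<N$ and $N_2\le N-N_1$; $\gamma\ge0$. Contents: content $n\in\{1,\dots,N\}$ is requested with probability $q_n=n^{-\gamma}/\sum_{k=1}^N k^{-\gamma}$. The first group is $\{1,\dots,N_1\}$, stored by every macro base station (MBS); the second group is $\{N_1+1,\dots,N\}$, each content of which is stored by each helper independently with probability $p_{Lp}=N_2/(N-N_1)$. Put $Q_{Mp}=\sum_{n\le N_1}q_n$, $Q_{Lp}=1-Q_{Mp}$. Network: MBSs (tier 1) and helpers (tier 2) form independent homogeneous Poisson point processes $\Phi_1,\Phi_2$ in $\mathbb R^2$ of intensities $\lambda_1,\lambda_2$, with transmit powers $P_1,P_2$; users have density $\lambda_u$. A tagged user is at the origin; the base station $x_{i,j}$ at distance $z_{i,j}$ from the origin has received power $P_ih_{i,j}z_{i,j}^{-\alpha}$, with $h_{i,j}$ i.i.d. exponential of mean 1, independent of the locations. Association constants: $A_{Lp,1}=\frac{\lambda_1P_1^{2/\alpha}}{\lambda_1P_1^{2/\alpha}+p_{Lp}\lambda_2P_2^{2/\alpha}}$, $A_{Lp,2}=1-A_{Lp,1}$, $A_1=Q_{Mp}+Q_{Lp}A_{Lp,1}$, $A_2=Q_{Lp}A_{Lp,2}$. Load: the number $L_k$ of users served by the serving base station of tier $k$ (tagged user included) is taken to be independent of locations and fading, with law, for $l\ge 0$, $$P_{L_k}(l+1)=\mathbb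 P(L_k=l+1)=\frac{3.5^{3.5}}{l!}\frac{\Gamma(l+4.5)}{\Gamma(3.5)}\Big(\frac{A_k\lambda_u}{\lambda_k}\Big)^{l}\Big(3.5+\frac{A_k\lambda_u}{\lambda_k}\Big)^{-(l+4.5)}.$$ Active helpers: only active helpers transmit; the serving helper is active and non-serving helpers are active independently with probability $p_a=1-\big(1+\frac{A_2\lambda_u}{3.5\lambda_2}\big)^{-3.5}$. Second-group request for content $f_n$: let $\Phi_{n^+,2}$ and $\Phi_{n^-,2}$ be the helpers storing, respectively not storing, $f_n$ (independent Poisson processes of intensities $p_{Lp}\lambda_2$ and $(1-p_{Lp})\lambda_2$). The user is served by the base station $x_0$ maximizing $P_iz_{i,j}^{-\alpha}$ over $\Phi_1\cup\Phi_{n^+,2}$. If $x_0$ is in tier $k$, at distance $z$ with fading $h$, then $\mathrm{SINR}=\frac{P_khz^{-\alpha}}{I+\sigma^2}$, where $I$ is the sum of the received powers from all MBSs and all active helpers (storing or not storing $f_n$) other than $x_0$. When $k=2$, the rate is $R_{Lp,2}=\frac{W}{L_2}\log_2(1+\mathrm{SINR})$. Functions: $G(x,\alpha)=\frac{2x}{\alpha-2}\,{}_2F_1\big(1,1-\tfrac2\alpha;2-\tfrac2\alpha;-x\big)$ and $H(x,\alpha)=\frac2\alpha x^{2/\alpha}B\big(\tfrac2\alpha,1-\tfrac2\alpha\big)$, with ${}_2F_1$ the Gauss hypergeometric function and $B$ the Beta function.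
   Formalization: In the coefficients ξ, ς and ζ each transmit power P_i is replaced by P_i^{2/α}, as in the association constants; the formula as printed with bare P_i is false whenever P_1 ≠ P_2 and agrees with the corrected one when P_1 = P_2. *)

theory Defs
  imports "HOL-Probability.Probability" "HOL-Complex_Analysis.Complex_Analysis"
begin

datatype tier = Macro | Helper

record params =
  alpha :: real                \<comment> \<open>path loss exponent\<close>
  lam   :: "tier \<Rightarrow> real"      \<comment> \<open>base station densities\<close>
  pow   :: "tier \<Rightarrow> real"      \<comment> \<open>transmit powers\<close>
  lam_u :: real                \<comment> \<open>user density\<close>
  bandw :: real                \<comment> \<open>bandwidth \<open>W\<close>\<close>
  rate0 :: real                \<comment> \<open>rate threshold \<open>R\<^sub>0\<close>\<close>
  noise :: real                \<comment> \<open>noise power \<open>\<sigma>\<^sup>2\<close> (not its square root)\<close>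
  N_tot :: nat                 \<comment> \<open>number of contents\<close>
  N_mac :: nat                 \<comment> \<open>size \<open>N\<^sub>1\<close> of the first group\<close>
  N_hlp :: nat                 \<comment> \<open>helper cache size \<open>N\<^sub>2\<close>\<close>
  zipf  :: real                \<comment> \<open>popularity exponent \<open>\<gamma>\<close>\<close>

definition valid_params :: "params \<Rightarrow> bool" where
  "valid_params S \<longleftrightarrow>
     2 < alpha S \<and> alpha S \<le> 4 \<and>
     (\<forall>k. 0 < lam S k) \<and> (\<forall>k. 0 < pow S k) \<and>
     0 < lam_u S \<and> 0 < bandw S \<and> 0 < rate0 S \<and> 0 \<le> noise S \<and>
     1 \<le> N_mac S \<and> N_mac S < N_tot S \<and>
     1 \<le> N_hlp S \<and> N_hlp S \<le> N_tot S - N_mac S \<and>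
     0 \<le> zipf S"

definition second_group :: "params \<Rightarrow> nat set" where
  "second_group S = {N_mac S <.. N_tot S}"

definition popularity :: "params \<Rightarrow> nat \<Rightarrow> real" where
  "popularity S n = real n powr (- zipf S) / (\<Sum>k = 1..N_tot S. real k powr (- zipf S))"

definition Q_Mp :: "params \<Rightarrow> real" where
  "Q_Mp S = (\<Sum>n = 1..N_mac S. popularity S n)"

definition Q_Lp :: "params \<Rightarrow> real" where
  "Q_Lp S = 1 - Q_Mp S"

definition p_Lp :: "params \<Rightarrow> real" where
  "p_Lp S = real (N_hlp S) / real (N_tot S - N_mac S)"

definition A_Lp1 :: "params \<Rightarrow> real" where
  "A_Lp1 S =
     lam S Macro * pow S Macro powr (2 / alpha S) /
       (lam S Macro * pow S Macro powr (2 / alpha S)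
        + p_Lp S * lam S Helper * pow S Helper powr (2 / alpha S))"

fun A_Lp :: "params \<Rightarrow> tier \<Rightarrow> real" where
  "A_Lp S Macro = A_Lp1 S"
| "A_Lp S Helper = 1 - A_Lp1 S"

fun A_tier :: "params \<Rightarrow> tier \<Rightarrow> real" where
  "A_tier S Macro = Q_Mp S + Q_Lp S * A_Lp S Macro"
| "A_tier S Helper = Q_Lp S * A_Lp S Helper"

text \<open>\<open>P_load S k l\<close> is the probability that the load of the serving tier-\<open>k\<close> station
  equals \<open>l + 1\<close>.\<close>

definition P_load :: "params \<Rightarrow> tier \<Rightarrow> nat \<Rightarrow> real" where
  "P_load S k l =
     3.5 powr 3.5 / fact l * (Gamma (real l + 4.5) / Gamma 3.5)
     * (A_tier S k * lam_u S / lam S k) ^ l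
     * (3.5 + A_tier S k * lam_u S / lam S k) powr (- (real l + 4.5))"

definition p_act :: "params \<Rightarrow> real" where
  "p_act S = 1 - (1 + A_tier S Helper * lam_u S / (3.5 * lam S Helper)) powr (- 3.5)"

text \<open>A point process is given by an enumeration \<open>X 0, X 1, \<dots>\<close> of its points; this loses nothing
  because a homogeneous Poisson process of positive intensity on the plane almost surely has
  infinitely many points. Since \<^const>\<open>card\<close> is 0 on infinite sets, local finiteness is required
  separately.\<close>

definition point_count :: "(nat \<Rightarrow> 'w \<Rightarrow> real^2) \<Rightarrow> (real^2) set \<Rightarrow> 'w \<Rightarrow> nat" where
  "point_count X A \<omega> = card {j. X j \<omega> \<in> A}"

definition homogeneous_ppp :: "'w measure \<Rightarrow> real \<Rightarrow> (nat \<Rightarrow> 'w \<Rightarrow> real^2) \<Rightarrow> bool" where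
  "homogeneous_ppp M r X \<longleftrightarrow>
     (\<forall>j. X j \<in> borel_measurable M) \<and>
     (\<forall>A. A \<in> sets borel \<longrightarrow> bounded A \<longrightarrow>
        (AE \<omega> in M. finite {j. X j \<omega> \<in> A}) \<and>
        (\<forall>m. measure M {\<omega> \<in> space M. point_count X A \<omega> = m}
              = (r * measure lborel A) ^ m / fact m * exp (- (r * measure lborel A)))) \<and>
     (\<forall>m (F :: nat \<Rightarrow> (real^2) set).
        (\<forall>i<m. F i \<in> sets borel \<and> bounded (F i)) \<longrightarrow> disjoint_family_on F {..<m} \<longrightarrow>
        prob_space.indep_vars M (\<lambda>_. count_space UNIV) (\<lambda>i. point_count X (F i)) {..<m})"

text \<open>Base stations are pairs of a tier and an index. \<open>stores V n j\<close> is the event that helper \<open>j\<close>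
  stores content \<open>n\<close>, and \<open>active V j\<close> the event that helper \<open>j\<close> transmits when it is not the
  serving station; the serving helper always transmits.\<close>

record 'w network =
  loc    :: "tier \<Rightarrow> nat \<Rightarrow> 'w \<Rightarrow> real^2"
  fading :: "tier \<Rightarrow> nat \<Rightarrow> 'w \<Rightarrow> real"
  stores :: "nat \<Rightarrow> nat \<Rightarrow> 'w \<Rightarrow> bool"
  active :: "nat \<Rightarrow> 'w \<Rightarrow> bool"
  load   :: "tier \<Rightarrow> 'w \<Rightarrow> nat"

datatype source = Locations tier | Fading tier nat | Storage nat | Activity nat | Load

primrec source_events ::
  "'w measure \<Rightarrow> 'w network \<Rightarrow> nat \<Rightarrow> tier \<Rightarrow> source \<Rightarrow> 'w set set" where
  "source_events M V n k (Locations i) =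
     sets (vimage_algebra (space M) (\<lambda>\<omega> j. loc V i j \<omega>) (PiM UNIV (\<lambda>_. borel)))"
| "source_events M V n k (Fading i j) = sets (vimage_algebra (space M) (fading V i j) borel)"
| "source_events M V n k (Storage j) =
     sets (vimage_algebra (space M) (stores V n j) (count_space UNIV))"
| "source_events M V n k (Activity j) =
     sets (vimage_algebra (space M) (active V j) (count_space UNIV))"
| "source_events M V n k Load = sets (vimage_algebra (space M) (load V k) (count_space UNIV))"

text \<open>Independence is required for each second-group content and each load separately: neither the
  caching of different contents nor the loads of the two tiers need be independent of each other.\<close>

definition cache_network :: "'w measure \<Rightarrow> params \<Rightarrow> 'w network \<Rightarrow> bool" where
  "cache_network M S V \<longleftrightarrow>
     prob_space M \<and>
     (\<forall>i. homogeneous_ppp M (lam S i) (loc V i)) \<and>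
     (\<forall>i j. distributed M lborel (fading V i j) (exponential_density 1)) \<and>
     (\<forall>n\<in>second_group S. \<forall>j. stores V n j \<in> M \<rightarrow>\<^sub>M count_space UNIV \<and>
        measure M {\<omega> \<in> space M. stores V n j \<omega>} = p_Lp S) \<and>
     (\<forall>j. active V j \<in> M \<rightarrow>\<^sub>M count_space UNIV \<and>
        measure M {\<omega> \<in> space M. active V j \<omega>} = p_act S) \<and>
     (\<forall>k. load V k \<in> M \<rightarrow>\<^sub>M count_space UNIV \<and>
        (\<forall>l. measure M {\<omega> \<in> space M. load V k \<omega> = l + 1} = P_load S k l)) \<and>
     (\<forall>n\<in>second_group S. \<forall>k. prob_space.indep_sets M (source_events M V n k) UNIV)"

definition mean_power :: "params \<Rightarrow> 'w network \<Rightarrow> 'w \<Rightarrow> tier \<times> nat \<Rightarrow> real" where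
  "mean_power S V \<omega> = (\<lambda>(i, j). pow S i * norm (loc V i j \<omega>) powr (- alpha S))"

definition received_power :: "params \<Rightarrow> 'w network \<Rightarrow> 'w \<Rightarrow> tier \<times> nat \<Rightarrow> real" where
  "received_power S V \<omega> =
     (\<lambda>(i, j). pow S i * fading V i j \<omega> * norm (loc V i j \<omega>) powr (- alpha S))"

definition candidates :: "'w network \<Rightarrow> nat \<Rightarrow> 'w \<Rightarrow> (tier \<times> nat) set" where
  "candidates V n \<omega> = {(Macro, j) | j. True} \<union> {(Helper, j) | j. stores V n j \<omega>}"

definition serving :: "params \<Rightarrow> 'w network \<Rightarrow> nat \<Rightarrow> 'w \<Rightarrow> tier \<times> nat \<Rightarrow> bool" where
  "serving S V n \<omega> b \<longleftrightarrow> is_arg_max (mean_power S V \<omega>) (\<lambda>c. c \<in> candidates V n \<omega>) b"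

text \<open>The two series have nonnegative terms almost surely and converge almost surely because
  \<open>\<alpha> > 2\<close>.\<close>

definition interference :: "params \<Rightarrow> 'w network \<Rightarrow> 'w \<Rightarrow> tier \<times> nat \<Rightarrow> real" where
  "interference S V \<omega> b =
     (\<Sum>j. if (Macro, j) \<noteq> b then received_power S V \<omega> (Macro, j) else 0) +
     (\<Sum>j. if (Helper, j) \<noteq> b \<and> active V j \<omega> then received_power S V \<omega> (Helper, j) else 0)"

definition sinr :: "params \<Rightarrow> 'w network \<Rightarrow> 'w \<Rightarrow> tier \<times> nat \<Rightarrow> real" where
  "sinr S V \<omega> b = received_power S V \<omega> b / (interference S V \<omega> b + noise S)"

definition access_rate :: "params \<Rightarrow> 'w network \<Rightarrow> 'w \<Rightarrow> tier \<times> nat \<Rightarrow> real" where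
  "access_rate S V \<omega> b = bandw S / real (load V (fst b) \<omega>) * log 2 (1 + sinr S V \<omega> b)"

definition C_Lp2 :: "'w measure \<Rightarrow> params \<Rightarrow> 'w network \<Rightarrow> nat \<Rightarrow> real" where
  "C_Lp2 M S V n =
     measure M {\<omega> \<in> space M.
       \<exists>j. serving S V n \<omega> (Helper, j) \<and> access_rate S V \<omega> (Helper, j) \<ge> rate0 S}"

text \<open>The principal branch of the Gauss hypergeometric function: the analytic continuation of the
  hypergeometric series to the plane cut along \<open>[1, \<infinity>)\<close>.\<close>

definition hyp2F1 :: "complex \<Rightarrow> complex \<Rightarrow> complex \<Rightarrow> complex \<Rightarrow> complex" where
  "hyp2F1 a b c z =
     (THE w. \<exists>f. f holomorphic_on (- complex_of_real ` {1..}) \<and>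
                 f has_fps_expansion fps_hypergeo [a, b] [c] 1 \<and> f z = w)"

definition G_fun :: "real \<Rightarrow> real \<Rightarrow> real" where
  "G_fun x a = 2 * x / (a - 2) *
     Re (hyp2F1 1 (of_real (1 - 2 / a)) (of_real (2 - 2 / a)) (of_real (- x)))"

definition H_fun :: "real \<Rightarrow> real \<Rightarrow> real" where
  "H_fun x a = 2 / a * x powr (2 / a) * Beta (2 / a) (1 - 2 / a)"

definition delta :: "params \<Rightarrow> nat \<Rightarrow> real" where
  "delta S l = 2 powr ((real l + 1) * rate0 S / bandw S) - 1"

fun lam_store :: "params \<Rightarrow> tier \<Rightarrow> real" where
  "lam_store S Macro = lam S Macro"
| "lam_store S Helper = p_Lp S * lam S Helper"

text \<open>The powers enter the coefficients with exponent \<open>2/\<alpha>\<close>, as in \<^const>\<open>A_Lp1\<close>: a tier-\<open>i\<close>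
  station at distance \<open>r\<close> and a tier-\<open>k\<close> station at distance \<open>z\<close> have the same mean received
  power iff \<open>r\<^sup>2 = z\<^sup>2 (P\<^sub>i / P\<^sub>k) powr (2/\<alpha>)\<close>. The source prints the coefficients with bare powers
  \<open>P\<^sub>i\<close>; with these the formula for the delivery probability would fail whenever the two powers
  differ (for instance, \<open>1 / \<zeta>\<^sub>2\<close> would not be the association probability \<open>A_Lp S Helper\<close>).\<close>

definition xi :: "params \<Rightarrow> tier \<Rightarrow> real" where
  "xi S k =
     (lam S Macro * pow S Macro powr (2 / alpha S)
      + p_act S * p_Lp S * lam S Helper * pow S Helper powr (2 / alpha S))
     / (lam_store S k * pow S k powr (2 / alpha S))"

definition varsigma :: "params \<Rightarrow> tier \<Rightarrow> real" where
  "varsigma S k =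
     p_act S * (1 - p_Lp S) * lam S Helper * pow S Helper powr (2 / alpha S)
     / (lam_store S k * pow S k powr (2 / alpha S))"

definition zeta :: "params \<Rightarrow> tier \<Rightarrow> real" where
  "zeta S k =
     (lam S Macro * pow S Macro powr (2 / alpha S)
      + p_Lp S * lam S Helper * pow S Helper powr (2 / alpha S))
     / (lam_store S k * pow S k powr (2 / alpha S))"

definition C_integrand :: "params \<Rightarrow> real \<Rightarrow> nat \<Rightarrow> real" where
  "C_integrand S z l =
     2 * pi * p_Lp S * lam S Helper * z
     * exp (- (z powr alpha S * inverse (pow S Helper) * delta S l * noise S))
     * exp (- (pi * p_Lp S * lam S Helper * z\<^sup>2
               * (xi S Helper * G_fun (delta S l) (alpha S)
                  + varsigma S Helper * H_fun (delta S l) (alpha S)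
                  + zeta S Helper)))
     * P_load S Helper l"

end

theory Submission
  imports Defs "HOL-Real_Asymp.Real_Asymp"
begin

text \<open>Condition on the load, which is independent of everything else, so that the rate condition becomes
  \<open>SINR \<ge> \<delta>\<close>. For fixed locations the marks are independent: the fading of helper \<open>j\<close> is exponential,
  hence \<open>SINR \<ge> \<delta>\<close> has conditional probability \<open>exp (- \<theta> (I + \<sigma>\<^sup>2))\<close> for some \<open>\<theta>\<close> depending on the
  distance \<open>z\<close> of helper \<open>j\<close>, and together with the association constraint its average over the
  remaining marks is a product over the other stations of factors depending only on their
  distances and on \<open>z\<close>. The expectation of the macro product is a Poisson Laplace functional; the sum
  over \<open>j\<close> of the helper products is evaluated by a Mecke formula. All factors decrease in \<open>z\<close>, so
  this formula follows from independence of the counts alone, by a Riemann sum sandwich over annuli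
  of equal area. The exponents are plane integrals, which become \<open>G\<close> and \<open>H\<close> via Euler's
  integral for the hypergeometric function and the Beta integral.\<close>

subsection \<open>Infinite products of numbers in the unit interval\<close>

text \<open>A Poisson process is given here by an enumeration whose indices carry no law of their
  own: the distribution of a single \<open>X j\<close> is unknown, and only totals over all
  \<open>j\<close> can be expressed through counts in bounded sets. This is why only the sum over
  the helpers is evaluated, and why the Mecke formula has to be rebuilt from counts. In the
  exponents, a macro station beats a helper at distance z exactly if it is closer than
  \<open>rad_ratio * z\<close>. The disc that must be empty and the interference from outside it
  give \<open>pi * (rad_ratio * z)\<^sup>2\<close> times 1 and times G;
  \<open>rad_ratio\<^sup>2\<close> is the origin of the powers with exponent 2/\<alpha>. With p the
  storage and p_a the activity probability, storing helpers give p (empty disc of radius z) and p *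
  p_a * G (outside), non-storing ones (1 - p) * p_a * H, over the whole plane since they may be
  closer than the serving station.\<close>

text \<open>\<^const>\<open>prodinf\<close> is not suitable here: it treats products converging to 0 as divergent.\<close>

definition pprod :: "(nat \<Rightarrow> real) \<Rightarrow> ennreal" where
  "pprod f = (INF n. ennreal (\<Prod>i<n. f i))"

lemma pprod_decseq:
  assumes "\<And>i. 0 \<le> f i" "\<And>i. f i \<le> 1"
  shows "decseq (\<lambda>n. ennreal (\<Prod>i<n. f i))"
  using assms by (intro decseq_SucI ennreal_leI) (simp add: mult_left_le prod_nonneg)

lemma pprod_LIMSEQ:
  assumes "\<And>i. 0 \<le> f i" "\<And>i. f i \<le> 1"
  shows "(\<lambda>n. ennreal (\<Prod>i<n. f i)) \<longlonglongrightarrow> pprod f"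
  unfolding pprod_def by (intro LIMSEQ_INF pprod_decseq assms)

lemma pprod_le_1: "pprod f \<le> 1"
  unfolding pprod_def by (rule INF_lower2[of 0]) auto

lemma pprod_mono:
  assumes "\<And>i. 0 \<le> f i" "\<And>i. f i \<le> g i"
  shows "pprod f \<le> pprod g"
  unfolding pprod_def by (rule INF_mono') (auto intro!: ennreal_leI prod_mono assms)

lemma pprod_mult:
  assumes "\<And>i. 0 \<le> f i" "\<And>i. f i \<le> 1" "\<And>i. 0 \<le> g i" "\<And>i. g i \<le> 1"
  shows "pprod (\<lambda>i. f i * g i) = pprod f * pprod g"
proof (rule LIMSEQ_unique)
  show "(\<lambda>n. ennreal (\<Prod>i<n. f i * g i)) \<longlonglongrightarrow> pprod (\<lambda>i. f i * g i)"
    using assms by (intro pprod_LIMSEQ) (auto intro: mult_le_one)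
  have "pprod f < top" "pprod g < top"
    by (rule le_less_trans[OF pprod_le_1 ennreal_one_less_top])+
  then have "(\<lambda>n. ennreal (\<Prod>i<n. f i) * ennreal (\<Prod>i<n. g i)) \<longlonglongrightarrow> pprod f * pprod g"
    by (intro tendsto_mult_ennreal pprod_LIMSEQ assms) auto
  then show "(\<lambda>n. ennreal (\<Prod>i<n. f i * g i)) \<longlonglongrightarrow> pprod f * pprod g"
    using assms by (simp add: prod.distrib ennreal_mult prod_nonneg)
qed

lemma pprod_measurable [measurable]:
  assumes [measurable]: "\<And>i. f i \<in> borel_measurable M"
  shows "(\<lambda>\<omega>. pprod (\<lambda>i. f i \<omega>)) \<in> borel_measurable M"
  unfolding pprod_def by measurable

lemma pprod_finite:
  assumes "\<And>i. 0 \<le> f i" "\<And>i. f i \<le> 1" and 1: "\<And>i. i \<ge> m \<Longrightarrow> f i = 1"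
  shows "pprod f = ennreal (\<Prod>i<m. f i)"
proof (rule LIMSEQ_unique[OF pprod_LIMSEQ[OF assms(1,2)]])
  have *: "(\<Prod>i<n. f i) = (\<Prod>i<m. f i)" if "n \<ge> m" for n
    by (rule prod.mono_neutral_right) (use that in \<open>auto intro: 1\<close>)
  show "(\<lambda>n. ennreal (\<Prod>i<n. f i)) \<longlonglongrightarrow> ennreal (\<Prod>i<m. f i)"
    by (intro tendsto_eventually eventually_sequentiallyI[of m] arg_cong[of _ _ ennreal] *)
qed

text \<open>Each partial product passes to the limit by continuity, and two infima commute.\<close>

lemma pprod_INF:
  assumes "\<And>k i. 0 \<le> f k i" "\<And>i. decseq (\<lambda>k. f k i)" "\<And>i. (\<lambda>k. f k i) \<longlonglongrightarrow> g i"
  shows "pprod g = (INF k. pprod (f k))"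
proof -
  have "(INF k. ennreal (\<Prod>i<n. f k i)) = ennreal (\<Prod>i<n. g i)" for n
  proof (rule LIMSEQ_unique)
    show "(\<lambda>k. ennreal (\<Prod>i<n. f k i)) \<longlonglongrightarrow> (INF k. ennreal (\<Prod>i<n. f k i))"
      using assms by (intro LIMSEQ_INF decseq_SucI ennreal_leI prod_mono) (auto simp: decseq_Suc_iff)
    show "(\<lambda>k. ennreal (\<Prod>i<n. f k i)) \<longlonglongrightarrow> ennreal (\<Prod>i<n. g i)"
      using assms by (intro tendsto_ennrealI tendsto_prod)
  qed
  then show ?thesis
    unfolding pprod_def by (subst INF_commute) simp
qed

text \<open>Turns the exponential of an interference series into a product over stations.
  Summability matters: \<open>suminf\<close> of a divergent series says nothing about its partial
  sums.\<close>

lemma pprod_exp: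
  assumes "summable t" "\<And>i. 0 \<le> t i"
  shows "pprod (\<lambda>i. exp (- t i)) = ennreal (exp (- suminf t))"
proof (rule LIMSEQ_unique[OF pprod_LIMSEQ])
  have "(\<lambda>n. exp (- (\<Sum>i<n. t i))) \<longlonglongrightarrow> exp (- suminf t)"
    by (intro tendsto_intros summable_LIMSEQ assms)
  then show "(\<lambda>n. ennreal (\<Prod>i<n. exp (- t i))) \<longlonglongrightarrow> ennreal (exp (- suminf t))"
    by (intro tendsto_ennrealI) (simp add: exp_sum[symmetric] sum_negf)
qed (use assms in auto)

text \<open>Lets a condition on all stations join the Laplace factors in one product over the
  stations.\<close>

lemma pprod_of_bool: "pprod (\<lambda>i. of_bool (P i)) = of_bool (\<forall>i. P i)"
proof (cases "\<forall>i. P i")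
  case False
  then obtain i where "\<not> P i" by blast
  then have "(\<Prod>k<Suc i. of_bool (P k) :: real) = 0" by simp
  then have "pprod (\<lambda>i. of_bool (P i)) \<le> 0"
    unfolding pprod_def by (intro INF_lower2[of "Suc i"]) (simp_all only: UNIV_I ennreal_0 order.refl)
  with False show ?thesis by auto
qed (simp add: pprod_def)

subsection \<open>Laplace functional of a Poisson process\<close>

lemma ppp_measurable [measurable_dest]:
  "homogeneous_ppp M r X \<Longrightarrow> X j \<in> borel_measurable M"
  by (auto simp: homogeneous_ppp_def)

lemma ppp_AE_finite:
  "homogeneous_ppp M r X \<Longrightarrow> A \<in> sets borel \<Longrightarrow> bounded A \<Longrightarrow> AE \<omega> in M. finite {j. X j \<omega> \<in> A}"
  unfolding homogeneous_ppp_def by blast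

lemma ppp_measure_count:
  "homogeneous_ppp M r X \<Longrightarrow> A \<in> sets borel \<Longrightarrow> bounded A \<Longrightarrow>
    measure M {\<omega> \<in> space M. point_count X A \<omega> = m}
     = (r * measure lborel A) ^ m / fact m * exp (- (r * measure lborel A))"
  unfolding homogeneous_ppp_def by blast

lemma ppp_indep_counts:
  fixes F :: "nat \<Rightarrow> (real^2) set"
  assumes X: "homogeneous_ppp M r X" and F: "\<And>i. i < m \<Longrightarrow> F i \<in> sets borel \<and> bounded (F i)"
    and disj: "disjoint_family_on F {..<m}"
  shows "prob_space.indep_vars M (\<lambda>_. count_space UNIV) (\<lambda>i. point_count X (F i)) {..<m}"
proof -
  from X have "\<forall>m (F :: nat \<Rightarrow> (real^2) set).
        (\<forall>i<m. F i \<in> sets borel \<and> bounded (F i)) \<longrightarrow> disjoint_family_on F {..<m} \<longrightarrow>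
        prob_space.indep_vars M (\<lambda>_. count_space UNIV) (\<lambda>i. point_count X (F i)) {..<m}"
    unfolding homogeneous_ppp_def by (elim conjE)
  from this[rule_format, of m F] F disj show ?thesis by simp
qed

text \<open>Measurability of a count is contained in \<open>indep_vars\<close> for a family with one
  member.\<close>

lemma (in prob_space) ppp_count_measurable:
  assumes "homogeneous_ppp M r X" "A \<in> sets borel" "bounded A"
  shows "point_count X A \<in> M \<rightarrow>\<^sub>M count_space UNIV"
proof -
  have "indep_vars (\<lambda>_. count_space UNIV) (\<lambda>i. point_count X A) {..<1::nat}"
    using assms by (intro ppp_indep_counts[of M r X 1 "\<lambda>_. A"]) (auto simp: disjoint_family_on_def)
  then show ?thesis
    by (auto simp: indep_vars_def2)
qed

lemma (in prob_space) nn_integral_ppp_count: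
  assumes X: "homogeneous_ppp M r X" and A: "A \<in> sets borel" "bounded A"
  shows "(\<integral>\<^sup>+\<omega>. g (point_count X A \<omega>) \<partial>M) =
    (\<Sum>m. g m * ennreal ((r * measure lborel A) ^ m / fact m * exp (- (r * measure lborel A))))"
proof -
  note [measurable] = ppp_count_measurable[OF assms]
  have "(\<integral>\<^sup>+\<omega>. g (point_count X A \<omega>) \<partial>M) =
      (\<integral>\<^sup>+\<omega>. (\<Sum>m. g m * indicator {\<omega> \<in> space M. point_count X A \<omega> = m} \<omega>) \<partial>M)"
  proof (intro nn_integral_cong)
    fix \<omega> assume "\<omega> \<in> space M"
    have "(\<Sum>m. g m * indicator {\<omega> \<in> space M. point_count X A \<omega> = m} \<omega>) =
        (\<Sum>m\<in>{point_count X A \<omega>}. g m * indicator {\<omega> \<in> space M. point_count X A \<omega> = m} \<omega>)"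
      by (intro suminf_finite) auto
    then show "g (point_count X A \<omega>) = (\<Sum>m. g m * indicator {\<omega> \<in> space M. point_count X A \<omega> = m} \<omega>)"
      using \<open>\<omega> \<in> space M\<close> by simp
  qed
  also have "\<dots> = (\<Sum>m. g m * ennreal (measure M {\<omega> \<in> space M. point_count X A \<omega> = m}))"
    by (subst nn_integral_suminf) (auto simp: nn_integral_cmult emeasure_eq_measure)
  finally show ?thesis
    by (simp add: ppp_measure_count[OF assms])
qed

text \<open>The probability generating function of the Poisson law.\<close>

lemma (in prob_space) nn_integral_ppp_power_count:
  assumes X: "homogeneous_ppp M r X" and A: "A \<in> sets borel" "bounded A" and "0 \<le> r" "0 \<le> c"
  shows "(\<integral>\<^sup>+\<omega>. ennreal (c ^ point_count X A \<omega>) \<partial>M) = ennreal (exp (- (r * measure lborel A * (1 - c))))"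
proof -
  define a where "a = r * measure lborel A"
  have "a \<ge> 0" using assms by (simp add: a_def)
  have "(\<lambda>m. exp (-a) * ((c * a) ^ m /\<^sub>R fact m)) sums (exp (-a) * exp (c * a))"
    by (intro sums_mult exp_converges)
  also have "(\<lambda>m. exp (-a) * ((c * a) ^ m /\<^sub>R fact m)) = (\<lambda>m. c ^ m * (a ^ m / fact m * exp (- a)))"
    by (simp add: field_simps power_mult_distrib fun_eq_iff)
  finally have s: "(\<lambda>m. c ^ m * (a ^ m / fact m * exp (- a))) sums exp (- (a * (1 - c)))"
    by (simp add: exp_add[symmetric] algebra_simps)
  have "(\<Sum>m. ennreal (c ^ m) * ennreal (a ^ m / fact m * exp (- a))) =
      (\<Sum>m. ennreal (c ^ m * (a ^ m / fact m * exp (- a))))"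
    using assms \<open>a \<ge> 0\<close> by (intro suminf_cong) (simp add: ennreal_mult[symmetric])
  also have "\<dots> = ennreal (exp (- (a * (1 - c))))"
    using s assms \<open>a \<ge> 0\<close> by (intro suminf_ennreal_eq) auto
  finally show ?thesis
    unfolding nn_integral_ppp_count[OF X A, of "\<lambda>m. ennreal (c ^ m)"] a_def .
qed

lemma (in prob_space) nn_integral_ppp_count_id:
  assumes X: "homogeneous_ppp M r X" and A: "A \<in> sets borel" "bounded A" and "0 \<le> r"
  shows "(\<integral>\<^sup>+\<omega>. of_nat (point_count X A \<omega>) \<partial>M) = ennreal (r * measure lborel A)"
proof -
  define a where "a = r * measure lborel A"
  have "a \<ge> 0" using assms by (simp add: a_def)
  \<comment> \<open>The factor m cancels against the factorial, which shifts the exponential series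
    by one index; the term at 0 vanishes.\<close>
  have "(\<lambda>m. (a * exp (-a)) * (a ^ m /\<^sub>R fact m)) sums ((a * exp (-a)) * exp a)"
    by (intro sums_mult exp_converges)
  also have "(\<lambda>m. (a * exp (-a)) * (a ^ m /\<^sub>R fact m)) = (\<lambda>m. real (Suc m) * (a ^ Suc m / fact (Suc m) * exp (- a)))"
    by (simp add: field_simps fun_eq_iff del: of_nat_Suc)
  also have "a * exp (-a) * exp a = a"
    by (simp add: exp_add[symmetric])
  finally have s: "(\<lambda>m. real m * (a ^ m / fact m * exp (- a))) sums a"
    by (subst (asm) sums_Suc_iff) simp
  have "(\<Sum>m. of_nat m * ennreal (a ^ m / fact m * exp (- a))) =
      (\<Sum>m. ennreal (real m * (a ^ m / fact m * exp (- a))))"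
    using assms \<open>a \<ge> 0\<close> by (intro suminf_cong) (simp add: ennreal_mult[symmetric] ennreal_of_nat_eq_real_of_nat)
  also have "\<dots> = ennreal a"
    using s assms \<open>a \<ge> 0\<close> by (intro suminf_ennreal_eq) auto
  finally show ?thesis
    unfolding nn_integral_ppp_count[OF X A, of of_nat] a_def .
qed

text \<open>Grouping the points by cells turns the product into powers of \<open>c k\<close>, and
  counts in disjoint cells are independent. The additional cell \<open>C\<close> with an arbitrary
  weight of its count prepares the Mecke formula, where \<open>C\<close> is an annulus and the
  weight is the number of its points or the indicator of exactly one point.\<close>

lemma (in prob_space) ppp_laplace_cells:
  fixes F :: "nat \<Rightarrow> (real^2) set"
  assumes X: "homogeneous_ppp M r X" and r: "0 \<le> r"
    and C: "C \<in> sets borel" "bounded C"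
    and F: "\<And>k. k < m \<Longrightarrow> F k \<in> sets borel" "\<And>k. k < m \<Longrightarrow> bounded (F k)"
    and disj: "disjoint_family_on F {..<m}" "\<And>k. k < m \<Longrightarrow> F k \<inter> C = {}"
    and c: "\<And>k. 0 \<le> c k" "\<And>k. c k \<le> 1"
  shows "(\<integral>\<^sup>+\<omega>. \<phi> (point_count X C \<omega>) * pprod (\<lambda>i. \<Prod>k<m. if X i \<omega> \<in> F k then c k else 1) \<partial>M)
     = (\<integral>\<^sup>+\<omega>. \<phi> (point_count X C \<omega>) \<partial>M) * ennreal (exp (- (r * (\<Sum>k<m. measure lborel (F k) * (1 - c k)))))"
proof -
  \<comment> \<open>\<open>C\<close> becomes cell 0, so that one independence statement covers it
    together with the cells \<open>F k\<close>.\<close>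
  define F' where "F' k = (case k of 0 \<Rightarrow> C | Suc k \<Rightarrow> F k)" for k
  define g where "g k = (case k of 0 \<Rightarrow> \<phi> | Suc k \<Rightarrow> (\<lambda>N. ennreal (c k ^ N)))" for k
  have F': "F' k \<in> sets borel \<and> bounded (F' k)" if "k < Suc m" for k
    using that F C by (auto simp: F'_def split: nat.splits)
  have "disjoint_family_on F' {..<Suc m}"
    using disj by (fastforce simp: disjoint_family_on_def F'_def split: nat.splits)
  then have "indep_vars (\<lambda>_. count_space UNIV) (\<lambda>i. point_count X (F' i)) {..<Suc m}"
    using F' by (intro ppp_indep_counts[OF X]) auto
  then have ind: "indep_vars (\<lambda>_. borel) (\<lambda>i \<omega>. g i (point_count X (F' i) \<omega>)) {..<Suc m}"
    by (rule indep_vars_compose2) simp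
  have "AE \<omega> in M. \<forall>k\<in>{..<m}. finite {j. X j \<omega> \<in> F k}"
    using F by (intro AE_finite_allI ppp_AE_finite[OF X]) auto
  then have "(\<integral>\<^sup>+\<omega>. \<phi> (point_count X C \<omega>) * pprod (\<lambda>i. \<Prod>k<m. if X i \<omega> \<in> F k then c k else 1) \<partial>M)
      = (\<integral>\<^sup>+\<omega>. (\<Prod>i<Suc m. g i (point_count X (F' i) \<omega>)) \<partial>M)"
  proof (intro nn_integral_cong_AE, eventually_elim)
    fix \<omega> assume fin: "\<forall>k\<in>{..<m}. finite {j. X j \<omega> \<in> F k}"
    then have "finite (\<Union>k<m. {j. X j \<omega> \<in> F k})" by auto
    \<comment> \<open>Almost surely only finitely many points hit the cells; all later factors are
      1.\<close>
    then obtain n where n: "\<And>j k. k < m \<Longrightarrow> X j \<omega> \<in> F k \<Longrightarrow> j < n"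
      using finite_nat_set_iff_bounded by (metis (mono_tags, lifting) UN_I lessThan_iff mem_Collect_eq)
    have "pprod (\<lambda>i. \<Prod>k<m. if X i \<omega> \<in> F k then c k else 1) =
        ennreal (\<Prod>i<n. \<Prod>k<m. if X i \<omega> \<in> F k then c k else 1)"
    proof (rule pprod_finite)
      show "(\<Prod>k<m. if X i \<omega> \<in> F k then c k else 1) = 1" if "i \<ge> n" for i
        using that n by (intro prod.neutral) (fastforce dest: n)
    qed (auto intro!: prod_nonneg prod_le_1 c)
    also have "(\<Prod>i<n. \<Prod>k<m. if X i \<omega> \<in> F k then c k else 1) = (\<Prod>k<m. c k ^ point_count X (F k) \<omega>)"
    proof (subst prod.swap, intro prod.cong refl)
      fix k assume "k \<in> {..<m}"
      then have "{i \<in> {..<n}. X i \<omega> \<in> F k} = {j. X j \<omega> \<in> F k}"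
        using n by auto
      then show "(\<Prod>i<n. if X i \<omega> \<in> F k then c k else 1) = c k ^ point_count X (F k) \<omega>"
        by (simp add: prod.If_cases point_count_def Int_def)
    qed
    finally show "\<phi> (point_count X C \<omega>) * pprod (\<lambda>i. \<Prod>k<m. if X i \<omega> \<in> F k then c k else 1) =
        (\<Prod>i<Suc m. g i (point_count X (F' i) \<omega>))"
      using c by (simp add: prod.lessThan_Suc_shift g_def F'_def prod_ennreal del: prod.lessThan_Suc)
  qed
  also have "\<dots> = (\<Prod>i<Suc m. \<integral>\<^sup>+\<omega>. g i (point_count X (F' i) \<omega>) \<partial>M)"
    using ind by (intro indep_vars_nn_integral) auto
  also have "\<dots> = (\<integral>\<^sup>+\<omega>. \<phi> (point_count X C \<omega>) \<partial>M) *
      (\<Prod>k<m. ennreal (exp (- (r * measure lborel (F k) * (1 - c k)))))"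
    using nn_integral_ppp_power_count[OF X F] r c
    by (simp add: prod.lessThan_Suc_shift g_def F'_def del: prod.lessThan_Suc)
  also have "(\<Prod>k<m. ennreal (exp (- (r * measure lborel (F k) * (1 - c k))))) =
      ennreal (exp (- (r * (\<Sum>k<m. measure lborel (F k) * (1 - c k)))))"
    by (simp add: prod_ennreal exp_sum[symmetric] sum_negf sum_distrib_left mult.assoc)
  finally show ?thesis .
qed

text \<open>Stated for the deviation v from 1 because v vanishes outside a bounded set: the level
  sets of its nonzero values are finitely many bounded cells.\<close>

lemma (in prob_space) ppp_laplace_simple:
  fixes v :: "real^2 \<Rightarrow> real"
  assumes X: "homogeneous_ppp M r X" and r: "0 \<le> r"
    and C: "C \<in> sets borel" "bounded C"
    and v: "simple_function borel v" "\<And>x. 0 \<le> v x" "\<And>x. v x \<le> 1" "\<And>x. x \<in> C \<Longrightarrow> v x = 0"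
    and B: "bounded B" "\<And>x. x \<notin> B \<Longrightarrow> v x = 0"
  shows "(\<integral>\<^sup>+\<omega>. \<phi> (point_count X C \<omega>) * pprod (\<lambda>i. 1 - v (X i \<omega>)) \<partial>M)
     = (\<integral>\<^sup>+\<omega>. \<phi> (point_count X C \<omega>) \<partial>M) * ennreal (exp (- (r * enn2real (\<integral>\<^sup>+x. ennreal (v x) \<partial>lborel))))"
proof -
  have "finite (range v - {0})"
    using simple_functionD(1)[OF v(1)] by simp
  then obtain e and m :: nat where e: "bij_betw e {..<m} (range v - {0})"
    using ex_bij_betw_nat_finite by (metis atLeast0LessThan)
  have e0: "e k \<noteq> 0" "0 \<le> e k" "e k \<le> 1" if "k < m" for k
  proof -
    have "e k \<in> range v - {0}" using bij_betwE[OF e] that by blast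
    then show "e k \<noteq> 0" "0 \<le> e k" "e k \<le> 1" using v(2,3) by auto
  qed
  define F where "F k = v -` {e k}" for k
  \<comment> \<open>The default 1 beyond m provides the bounds on \<open>c\<close> for all indices,
    as the cell lemma demands.\<close>
  define c where "c k = (if k < m then 1 - e k else 1)" for k
  have F: "F k \<in> sets borel" "bounded (F k)" "F k \<inter> C = {}" if "k < m" for k
  proof -
    show "F k \<in> sets borel"
      using simple_functionD(2)[OF v(1), of "{e k}"] by (simp add: F_def)
    have "F k \<subseteq> B" using B e0[OF that] by (force simp: F_def)
    then show "bounded (F k)" by (rule bounded_subset[OF B(1)])
    show "F k \<inter> C = {}" using v(4) e0[OF that] by (force simp: F_def)
  qed
  have inj: "e k = e l \<longleftrightarrow> k = l" if "k < m" "l < m" for k l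
    using e that by (auto simp: bij_betw_def inj_on_def)
  have disj: "disjoint_family_on F {..<m}"
    unfolding disjoint_family_on_def F_def using inj by auto
  have *: "(\<exists>k0<m. v x = e k0) \<or> v x = 0" for x
  proof -
    have "v x \<in> e ` {..<m}" if "v x \<noteq> 0"
      using that bij_betw_imp_surj_on[OF e] by auto
    then show ?thesis by auto
  qed
  have prod: "(\<Prod>k<m. if x \<in> F k then c k else 1) = 1 - v x" for x
    using *[of x]
  proof
    assume "\<exists>k0<m. v x = e k0"
    then obtain k0 where k0: "k0 < m" "v x = e k0" by auto
    have "(\<Prod>k<m. if x \<in> F k then c k else 1) = (\<Prod>k<m. if k = k0 then c k else 1)"
      using k0 inj by (intro prod.cong) (auto simp: F_def)
    then show ?thesis using k0 by (simp add: c_def)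
  next
    assume "v x = 0"
    then show ?thesis using e0 by (intro trans[OF prod.neutral]) (auto simp: F_def)
  qed
  have sum: "ennreal (v x) = (\<Sum>k<m. ennreal (e k) * indicator (F k) x)" for x
    using *[of x]
  proof
    assume "\<exists>k0<m. v x = e k0"
    then obtain k0 where k0: "k0 < m" "v x = e k0" by auto
    have "(\<Sum>k<m. ennreal (e k) * indicator (F k) x) = (\<Sum>k<m. if k = k0 then ennreal (e k) else 0)"
      using k0 inj by (intro sum.cong) (auto simp: F_def indicator_def)
    then show ?thesis using k0 by simp
  next
    assume "v x = 0"
    then show ?thesis using e0 by (intro sym[OF trans[OF sum.neutral]]) (auto simp: F_def indicator_def)
  qed
  have meas: "emeasure lborel (F k) = ennreal (measure lborel (F k))" if "k < m" for k
    using emeasure_bounded_finite[OF F(2)[OF that]] by (intro emeasure_eq_ennreal_measure) auto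
  have "(\<integral>\<^sup>+x. ennreal (v x) \<partial>lborel) = (\<Sum>k<m. ennreal (e k) * emeasure lborel (F k))"
    unfolding sum using F by (subst nn_integral_sum) (auto simp: nn_integral_cmult_indicator)
  also have "\<dots> = (\<Sum>k<m. ennreal (measure lborel (F k) * (1 - c k)))"
    using e0 by (intro sum.cong) (auto simp: meas c_def ennreal_mult[symmetric] mult.commute)
  also have "\<dots> = ennreal (\<Sum>k<m. measure lborel (F k) * (1 - c k))"
    using e0 by (intro sum_ennreal) (auto simp: c_def)
  finally have int: "(\<integral>\<^sup>+x. ennreal (v x) \<partial>lborel) = ennreal (\<Sum>k<m. measure lborel (F k) * (1 - c k))" .
  have "0 \<le> (\<Sum>k<m. measure lborel (F k) * (1 - c k))"
    using e0 by (intro sum_nonneg) (auto simp: c_def)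
  with int show ?thesis
    using ppp_laplace_cells[OF X r C F(1,2) disj F(3), of c \<phi>] e0 by (simp add: prod c_def)
qed

text \<open>Monotone limit of the simple case: 1 - f is exhausted from below by simple functions cut
  off outside growing balls. The products then decrease to the one for f, dominated by the weight of
  the count.\<close>

lemma (in prob_space) ppp_laplace:
  fixes f :: "real^2 \<Rightarrow> real"
  assumes X: "homogeneous_ppp M r X" and r: "0 \<le> r"
    and C: "C \<in> sets borel" "bounded C"
    and f [measurable]: "f \<in> borel_measurable borel" and f01: "\<And>x. 0 \<le> f x" "\<And>x. f x \<le> 1"
    and fC: "\<And>x. x \<in> C \<Longrightarrow> f x = 1"
    and fin: "(\<integral>\<^sup>+\<omega>. \<phi> (point_count X C \<omega>) \<partial>M) < \<infinity>"
    and B: "(\<integral>\<^sup>+x. ennreal (1 - f x) \<partial>lborel) = ennreal B" "0 \<le> B"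
  shows "(\<integral>\<^sup>+\<omega>. \<phi> (point_count X C \<omega>) * pprod (\<lambda>i. f (X i \<omega>)) \<partial>M)
     = (\<integral>\<^sup>+\<omega>. \<phi> (point_count X C \<omega>) \<partial>M) * ennreal (exp (- (r * B)))"
proof -
  note [measurable] = ppp_measurable[OF X] ppp_count_measurable[OF X C]
  have "(\<lambda>x. 1 - f x) \<in> borel_measurable borel" by measurable
  from borel_measurable_implies_simple_function_sequence_real[OF this]
  have "\<exists>u. incseq u \<and> (\<forall>i. simple_function borel (u i)) \<and> (\<forall>x. bdd_above (range (\<lambda>i. u i x))) \<and>
      (\<forall>i x. 0 \<le> u i x) \<and> (\<lambda>x. 1 - f x) = (SUP i. u i)"
    using f01 by simp
  then obtain u where "incseq u \<and> (\<forall>i. simple_function borel (u i)) \<and> (\<forall>x. bdd_above (range (\<lambda>i. u i x))) \<and>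
      (\<forall>i x. 0 \<le> u i x) \<and> (\<lambda>x. 1 - f x) = (SUP i. u i)" ..
  then have u: "incseq u" "\<And>i. simple_function borel (u i)" "\<And>x. bdd_above (range (\<lambda>i. u i x))"
      "\<And>i x. 0 \<le> u i x" and u5: "(\<lambda>x. 1 - f x) = (SUP i. u i)"
    by simp_all
  have u5: "(SUP i. u i x) = 1 - f x" for x
    using fun_cong[OF u5, of x] by (simp only: SUP_apply)
  define v where "v k x = u k x * indicator (ball 0 (real k)) x" for k x
  have u_le: "u k x \<le> 1 - f x" for k x
    unfolding u5[symmetric] using u(3) by (intro cSUP_upper) auto
  have v_le: "v k x \<le> 1 - f x" "0 \<le> v k x" for k x
    using u_le[of k x] u(4)[of k x] f01[of x] by (auto simp: v_def indicator_def)
  have v_inc: "incseq (\<lambda>k. v k x)" for x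
  proof (rule incseq_SucI)
    fix k show "v k x \<le> v (Suc k) x"
      using u(1,4) by (auto simp: v_def indicator_def incseq_Suc_iff le_fun_def)
  qed
  have v_lim: "(\<lambda>k. v k x) \<longlonglongrightarrow> 1 - f x" for x
  proof -
    have "(\<lambda>k. u k x) \<longlonglongrightarrow> 1 - f x"
      unfolding u5[symmetric] using u(1,3) by (intro LIMSEQ_incseq_SUP) (auto simp: incseq_def le_fun_def)
    moreover obtain n where "norm x < real n" using reals_Archimedean2 by blast
    then have "\<forall>\<^sub>F k in sequentially. u k x = v k x"
      by (intro eventually_sequentiallyI[of n]) (auto simp: v_def indicator_def)
    ultimately show ?thesis by (rule Lim_transform_eventually)
  qed
  have v_simple: "simple_function borel (v k)" for k
    unfolding v_def using u(2) by (intro simple_function_mult simple_function_indicator) auto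
  note [measurable] = borel_measurable_simple_function[OF v_simple]
  define J where "J k = enn2real (\<integral>\<^sup>+x. ennreal (v k x) \<partial>lborel)" for k
  have "(\<integral>\<^sup>+x. ennreal (v k x) \<partial>lborel) \<le> (\<integral>\<^sup>+x. ennreal (1 - f x) \<partial>lborel)" for k
    by (intro nn_integral_mono ennreal_leI v_le)
  then have Jfin: "(\<integral>\<^sup>+x. ennreal (v k x) \<partial>lborel) = ennreal (J k)" for k
    unfolding J_def B(1) by (intro ennreal_enn2real[symmetric]) (meson ennreal_less_top le_less_trans)
  have J0: "0 \<le> J k" for k by (simp add: J_def)
  have "(\<lambda>k. \<integral>\<^sup>+x. ennreal (v k x) \<partial>lborel) \<longlonglongrightarrow> (\<integral>\<^sup>+x. ennreal (1 - f x) \<partial>lborel)"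
    using v_inc v_lim by (intro nn_integral_LIMSEQ) (auto simp: incseq_def le_fun_def intro!: ennreal_leI tendsto_ennrealI)
  then have Jlim: "J \<longlonglongrightarrow> B"
    unfolding Jfin B(1) using B(2) J0 by (subst (asm) tendsto_ennreal_iff) auto
  have step: "(\<integral>\<^sup>+\<omega>. \<phi> (point_count X C \<omega>) * pprod (\<lambda>i. 1 - v k (X i \<omega>)) \<partial>M)
     = (\<integral>\<^sup>+\<omega>. \<phi> (point_count X C \<omega>) \<partial>M) * ennreal (exp (- (r * J k)))" for k
    unfolding J_def
  proof (rule ppp_laplace_simple[OF X r C v_simple])
    show "v k x \<le> 1" for x using v_le[of k x] f01[of x] by simp
    show "v k x = 0" if "x \<in> C" for x using v_le[of k x] fC[OF that] by simp
    show "v k x = 0" if "x \<notin> ball 0 (real k)" for x using that by (simp add: v_def)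
  qed (use v_le in auto)
  have lhs: "(\<lambda>k. \<integral>\<^sup>+\<omega>. \<phi> (point_count X C \<omega>) * pprod (\<lambda>i. 1 - v k (X i \<omega>)) \<partial>M)
     \<longlonglongrightarrow> (\<integral>\<^sup>+\<omega>. \<phi> (point_count X C \<omega>) * pprod (\<lambda>i. f (X i \<omega>)) \<partial>M)"
  proof (rule nn_integral_dominated_convergence)
    show "(\<integral>\<^sup>+\<omega>. \<phi> (point_count X C \<omega>) \<partial>M) < \<infinity>" by fact
    show "AE \<omega> in M. \<phi> (point_count X C \<omega>) * pprod (\<lambda>i. 1 - v k (X i \<omega>)) \<le> \<phi> (point_count X C \<omega>)" for k
      using mult_left_mono[OF pprod_le_1] by (intro AE_I2) fastforce
    \<comment> \<open>An infinite weight could break continuity of the product in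
      \<open>ennreal\<close>; the finite integral excludes it almost surely.\<close>
    have "AE \<omega> in M. \<phi> (point_count X C \<omega>) \<noteq> \<infinity>"
      using fin by (intro nn_integral_noteq_infinite) auto
    then show "AE \<omega> in M. (\<lambda>k. \<phi> (point_count X C \<omega>) * pprod (\<lambda>i. 1 - v k (X i \<omega>)))
        \<longlonglongrightarrow> \<phi> (point_count X C \<omega>) * pprod (\<lambda>i. f (X i \<omega>))"
    proof eventually_elim
      fix \<omega> assume \<phi>: "\<phi> (point_count X C \<omega>) \<noteq> \<infinity>"
      have dec: "decseq (\<lambda>k. 1 - v k x)" for x
        using v_inc[of x] by (auto simp: incseq_def decseq_def)
      have v1: "0 \<le> 1 - v k x" for k x using v_le[of k x] f01[of x] by simp
      have "(\<lambda>k. 1 - v k x) \<longlonglongrightarrow> 1 - (1 - f x)" for x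
        by (intro tendsto_intros v_lim)
      then have eq: "pprod (\<lambda>i. f (X i \<omega>)) = (INF k. pprod (\<lambda>i. 1 - v k (X i \<omega>)))"
        using dec v1 by (intro pprod_INF) auto
      have "(\<lambda>k. pprod (\<lambda>i. 1 - v k (X i \<omega>))) \<longlonglongrightarrow> pprod (\<lambda>i. f (X i \<omega>))"
        unfolding eq using dec v1 by (intro LIMSEQ_INF) (auto simp: decseq_def intro!: pprod_mono)
      then show "(\<lambda>k. \<phi> (point_count X C \<omega>) * pprod (\<lambda>i. 1 - v k (X i \<omega>)))
        \<longlonglongrightarrow> \<phi> (point_count X C \<omega>) * pprod (\<lambda>i. f (X i \<omega>))"
        using \<phi> le_less_trans[OF pprod_le_1 ennreal_one_less_top, of "\<lambda>i. f (X i \<omega>)"]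
        by (intro tendsto_mult_ennreal tendsto_const) auto
    qed
  qed auto
  have rhs: "(\<lambda>k. (\<integral>\<^sup>+\<omega>. \<phi> (point_count X C \<omega>) \<partial>M) * ennreal (exp (- (r * J k))))
     \<longlonglongrightarrow> (\<integral>\<^sup>+\<omega>. \<phi> (point_count X C \<omega>) \<partial>M) * ennreal (exp (- (r * B)))"
    using fin by (intro ennreal_tendsto_cmult tendsto_ennrealI tendsto_intros Jlim) auto
  from lhs rhs show ?thesis unfolding step by (rule LIMSEQ_unique)
qed

subsection \<open>Mecke formula for radial products\<close>

abbreviation plane :: "(real^2) measure" where "plane \<equiv> lborel"

lemma emeasure_ball_plane: "0 \<le> a \<Longrightarrow> emeasure lborel (ball (0::real^2) a) = ennreal (pi * a\<^sup>2)"
  by (subst emeasure_ball) (simp_all add: unit_ball_vol_2)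

text \<open>Polar coordinates from disc areas alone: the image of Lebesgue measure under the norm
  and the measure with density 2 pi t on t >= 0 agree on the half-lines \<open>{..<a}\<close>, an
  intersection-stable generator.\<close>

lemma nn_integral_radial:
  assumes [measurable]: "g \<in> borel_measurable borel"
  shows "(\<integral>\<^sup>+x. g (norm (x::real^2)) \<partial>lborel) = (\<integral>\<^sup>+t\<in>{0..}. ennreal (2 * pi * t) * g t \<partial>lborel)"
proof -
  define D where "D = density lborel (\<lambda>t::real. ennreal (2 * pi * t) * indicator {0..} t)"
  have eq: "emeasure (distr plane borel norm) {..<a} = ennreal (pi * (max 0 a)\<^sup>2)" for a
  proof -
    have "norm -` {..<a} = ball (0::real^2) (max 0 a)" by (auto simp: less_max_iff_disj intro: le_less_trans[OF norm_ge_zero])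
    then show ?thesis by (simp add: emeasure_distr emeasure_ball_plane)
  qed
  have eq2: "emeasure D {..<a} = ennreal (pi * (max 0 a)\<^sup>2)" for a
  proof -
    have "emeasure D {..<a} = (\<integral>\<^sup>+t. ennreal (2 * pi * t) * indicator {0..} t * indicator {..<a} t \<partial>lborel)"
      unfolding D_def by (rule emeasure_density) auto
    \<comment> \<open>Closing the right end changes a null set only; \<open>max 0 a\<close> covers
      negative a.\<close>
    also have "\<dots> = (\<integral>\<^sup>+t. ennreal (2 * pi * t) * indicator {0..max 0 a} t \<partial>lborel)"
      by (rule nn_integral_cong_AE, use AE_lborel_singleton[of a] in eventually_elim)
         (auto simp: indicator_def max_def)
    also have "\<dots> = ennreal (pi * (max 0 a)\<^sup>2 - pi * 0\<^sup>2)"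
      by (rule nn_integral_FTC_Icc) (auto intro!: derivative_eq_intros)
    finally show ?thesis by simp
  qed
  have borel: "sets (borel :: real measure) = sigma_sets UNIV (range lessThan)"
    unfolding borel_Iio by (rule sets_measure_of) auto
  have "distr plane borel norm = D"
  proof (rule measure_eqI_generator_eq)
    show "Int_stable (range (\<lambda>a::real. {..<a}))"
    proof -
      have "{..<a} \<inter> {..<b} = {..<min a b}" for a b :: real by auto
      then show ?thesis by (auto simp: Int_stable_def)
    qed
    show "sets (distr plane borel norm) = sigma_sets UNIV (range (\<lambda>a::real. {..<a}))"
      "sets D = sigma_sets UNIV (range (\<lambda>a::real. {..<a}))"
      by (simp_all only: D_def sets_distr sets_density sets_lborel borel)
    show "(\<Union>i. {..<real i}) = UNIV"
      by (auto intro: reals_Archimedean2)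
  qed (auto simp: eq eq2)
  then have "(\<integral>\<^sup>+t. g t \<partial>distr plane borel norm) = (\<integral>\<^sup>+t. g t \<partial>D)"
    by simp
  then show ?thesis
    by (simp add: nn_integral_distr D_def nn_integral_density mult_ac)
qed

text \<open>Tonelli with counting measure as one of the two factors.\<close>

lemma suminf_swap_ennreal:
  fixes a :: "nat \<Rightarrow> nat \<Rightarrow> ennreal"
  shows "(\<Sum>i. \<Sum>j. a i j) = (\<Sum>j. \<Sum>i. a i j)"
  using nn_integral_suminf[of "\<lambda>j i. a i j" "count_space UNIV"]
  by (simp add: nn_integral_count_space_nat)

lemma suminf_indicator_card:
  fixes c :: ennreal
  assumes "finite {j. P j}"
  shows "(\<Sum>j. of_bool (P j) * c) = of_nat (card {j::nat. P j}) * c"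
proof -
  have "(\<Sum>j. of_bool (P j) * c) = (\<Sum>j\<in>{j. P j}. of_bool (P j) * c)"
    using assms by (intro suminf_finite) auto
  also have "\<dots> = (\<Sum>j\<in>{j. P j}. c)" by (intro sum.cong) auto
  finally show ?thesis by simp
qed

text \<open>In an annulus of area \<open>1/m\<close>, the second argument of \<open>b\<close> and the argument of \<open>h\<close> are replaced
  by the inner radius for the upper bound; for the lower bound only the event of a single point in
  the annulus is kept and the outer radius is used. The two Riemann sums differ by one term, of
  order \<open>1/m\<close>, because the integrand is decreasing.\<close>

theorem (in prob_space) ppp_mecke_radial:
  fixes b :: "real^2 \<Rightarrow> real \<Rightarrow> real" and h \<beta> :: "real \<Rightarrow> real"
  assumes X: "homogeneous_ppp M r X" and r: "0 < r"
    and b [measurable]: "(\<lambda>(y, z). b y z) \<in> borel_measurable (borel \<Otimes>\<^sub>M borel)"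
    and b01: "\<And>y z. 0 \<le> b y z" "\<And>y z. b y z \<le> 1"
    and b_anti: "\<And>y z z'. 0 \<le> z \<Longrightarrow> z \<le> z' \<Longrightarrow> b y z' \<le> b y z"
    and h [measurable]: "h \<in> borel_measurable borel"
    and h01: "\<And>z. 0 \<le> h z" "\<And>z. h z \<le> 1"
    and h_anti: "\<And>z z'. 0 \<le> z \<Longrightarrow> z \<le> z' \<Longrightarrow> h z' \<le> h z"
    and \<beta>: "\<And>z. 0 \<le> z \<Longrightarrow> (\<integral>\<^sup>+y. ennreal (1 - b y z) \<partial>lborel) = ennreal (\<beta> z)" "\<And>z. 0 \<le> z \<Longrightarrow> 0 \<le> \<beta> z"
    and \<beta>_meas [measurable]: "\<beta> \<in> borel_measurable borel"
  shows "(\<integral>\<^sup>+\<omega>. (\<Sum>j. ennreal (h (norm (X j \<omega>))) * pprod (\<lambda>i. if i = j then 1 else b (X i \<omega>) (norm (X j \<omega>)))) \<partial>M)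
    = ennreal r * (\<integral>\<^sup>+x. ennreal (h (norm x) * exp (- (r * \<beta> (norm x)))) \<partial>plane)"
    (is "(\<integral>\<^sup>+\<omega>. (\<Sum>j. ?T j \<omega>) \<partial>M) = ennreal r * ?I")
proof -
  define E where "E = (\<integral>\<^sup>+\<omega>. (\<Sum>j. ?T j \<omega>) \<partial>M)"
  define \<Psi> where "\<Psi> z = h z * exp (- (r * \<beta> z))" for z
  note [measurable] = ppp_measurable[OF X]
  have [measurable]: "(\<lambda>\<omega>. b (X i \<omega>) (norm (X j \<omega>))) \<in> borel_measurable M" for i j
    using measurable_compose[OF _ b, of "\<lambda>\<omega>. (X i \<omega>, norm (X j \<omega>))" M] by simp
  have [measurable]: "(\<lambda>y. b y z) \<in> borel_measurable borel" for z
    using measurable_compose[OF _ b, of "\<lambda>y. (y, z)" borel] by simp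
  have [measurable]: "(\<lambda>\<omega>. b (X i \<omega>) z) \<in> borel_measurable M" for i z
    using measurable_compose[OF _ b, of "\<lambda>\<omega>. (X i \<omega>, z)" M] by simp
  have T_meas [measurable]: "?T j \<in> borel_measurable M" for j
    by measurable
  have \<beta>_mono: "\<beta> z \<le> \<beta> z'" if "0 \<le> z" "z \<le> z'" for z z'
  proof -
    have "ennreal (\<beta> z) \<le> ennreal (\<beta> z')"
      using that by (subst (1 2) \<beta>(1)[symmetric]) (auto intro!: nn_integral_mono ennreal_leI b_anti)
    then show ?thesis using \<beta>(2)[of z'] that by (subst (asm) ennreal_le_iff) auto
  qed
  have \<Psi>_anti: "\<Psi> z' \<le> \<Psi> z" if "0 \<le> z" "z \<le> z'" for z z'
    unfolding \<Psi>_def using that r h01 h_anti[OF that] \<beta>_mono[OF that] by (intro mult_mono) auto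
  have \<Psi>01: "0 \<le> \<Psi> z" for z using h01 by (simp add: \<Psi>_def)
  have \<Psi>1: "\<Psi> z \<le> 1" if "0 \<le> z" for z
    unfolding \<Psi>_def using r that h01 \<beta>(2)[OF that] by (intro mult_le_one) auto
  \<comment> \<open>The factor exp (r/m) comes from ignoring points inside the annulus, exp (-(r/m))
    from the probability of exactly one point there, and the terms with 1/m from the one annulus
    that the index shift leaves over.\<close>
  have bounds: "E \<le> ennreal (r * exp (r / m)) * (?I + ennreal (1 / m))"
      "ennreal (r * exp (- (r / m))) * ?I \<le> ennreal (r * exp (- (r / m)) * (1 / m)) + E"
    if m: "m = real n" "n \<ge> 1" for m n
  proof -
    have m0: "m > 0" using m by simp
    \<comment> \<open>The area of the disc through x, measured in units of 1/m, lies between k and k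
      + 1. Hence the inner radius \<open>z k\<close> is the square root of k / (m pi).\<close>
    define A where "A k = {x::real^2. real k \<le> m * pi * (norm x)\<^sup>2 \<and> m * pi * (norm x)\<^sup>2 < real k + 1}" for k
    define z where "z k = sqrt (real k / (m * pi))" for k
    have z0: "0 \<le> z k" for k using m0 by (simp add: z_def)
    have z_le: "z k \<le> norm x" "norm x < z (Suc k)" if "x \<in> A k" for x k
    proof -
      have "real k / (m * pi) \<le> (norm x)\<^sup>2" "(norm x)\<^sup>2 < real (Suc k) / (m * pi)"
        using that m0 by (auto simp: A_def field_simps)
      then show "z k \<le> norm x" "norm x < z (Suc k)"
        unfolding z_def by (auto intro!: real_le_lsqrt real_less_rsqrt)
    qed
    have A_eq: "A k = ball 0 (z (Suc k)) - ball 0 (z k)" for k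
    proof -
      have "x \<in> A k \<longleftrightarrow> z k \<le> norm x \<and> norm x < z (Suc k)" for x
      proof
        assume *: "z k \<le> norm x \<and> norm x < z (Suc k)"
        then have "(z k)\<^sup>2 \<le> (norm x)\<^sup>2" "(norm x)\<^sup>2 < (z (Suc k))\<^sup>2"
          using z0[of k] by (auto intro!: power_mono power_strict_mono)
        then show "x \<in> A k"
          using m0 by (auto simp: A_def z_def field_simps)
      qed (blast intro: z_le)
      then show ?thesis by (intro set_eqI) (simp only: Diff_iff mem_ball_0 not_less conj_commute)
    qed
    have A_meas [measurable]: "A k \<in> sets borel" and A_bdd: "bounded (A k)" for k
      unfolding A_eq by (auto intro: bounded_subset[OF bounded_ball])
    have emA: "emeasure lborel (A k) = ennreal (1 / m)" for k
    proof -
      have "z k \<le> z (Suc k)" using m0 by (simp add: z_def divide_right_mono)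
      then have "emeasure lborel (A k) = ennreal (pi * (z (Suc k))\<^sup>2) - ennreal (pi * (z k)\<^sup>2)"
        unfolding A_eq using z0 by (subst emeasure_Diff) (auto simp: emeasure_ball_plane subset_ball)
      also have "\<dots> = ennreal (pi * (z (Suc k))\<^sup>2 - pi * (z k)\<^sup>2)"
        by (rule ennreal_minus) simp
      also have "pi * (z (Suc k))\<^sup>2 - pi * (z k)\<^sup>2 = 1 / m"
        using m0 by (simp add: z_def field_simps)
      finally show ?thesis .
    qed
    have mA: "measure lborel (A k) = 1 / m" for k
      using emA m0 by (simp add: measure_def)
    \<comment> \<open>The annuli partition the plane; the index for x is the floor of m pi times the
      squared norm.\<close>
    have cover: "(\<Sum>k. of_bool (x \<in> A k) * c) = c" for x and c :: ennreal
    proof -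
      let ?k = "nat \<lfloor>m * pi * (norm x)\<^sup>2\<rfloor>"
      have "x \<in> A k \<longleftrightarrow> k = ?k" for k
        using m0 unfolding A_def by (auto simp: nat_eq_iff floor_eq_iff eq_commute[of k])
      then have "(\<Sum>k. of_bool (x \<in> A k) * c) = (\<Sum>k\<in>{?k}. of_bool (x \<in> A k) * c)"
        by (intro suminf_finite) auto
      with \<open>\<And>k. x \<in> A k \<longleftrightarrow> k = ?k\<close> show ?thesis by simp
    qed
    define Ek where "Ek k = (\<integral>\<^sup>+\<omega>. (\<Sum>j. of_bool (X j \<omega> \<in> A k) * ?T j \<omega>) \<partial>M)" for k
    have E_sum: "E = (\<Sum>k. Ek k)"
    proof -
      have "E = (\<integral>\<^sup>+\<omega>. (\<Sum>j. \<Sum>k. of_bool (X j \<omega> \<in> A k) * ?T j \<omega>) \<partial>M)"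
        unfolding E_def cover ..
      also have "\<dots> = (\<integral>\<^sup>+\<omega>. (\<Sum>k. \<Sum>j. of_bool (X j \<omega> \<in> A k) * ?T j \<omega>) \<partial>M)"
        by (subst suminf_swap_ennreal) rule
      finally show ?thesis unfolding Ek_def by (subst (asm) nn_integral_suminf) auto
    qed
    define Ik where "Ik k = (\<integral>\<^sup>+x. of_bool (x \<in> A k) * ennreal (\<Psi> (norm x)) \<partial>lborel)" for k
    have I_sum: "?I = (\<Sum>k. Ik k)"
    proof -
      have "?I = (\<integral>\<^sup>+x. (\<Sum>k. of_bool (x \<in> A k) * ennreal (\<Psi> (norm x))) \<partial>lborel)"
        unfolding cover \<Psi>_def ..
      also have "\<dots> = (\<Sum>k. Ik k)"
        unfolding Ik_def \<Psi>_def by (subst nn_integral_suminf) auto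
      finally show ?thesis .
    qed
    have int_A: "(\<integral>\<^sup>+x. of_bool (x \<in> A k) * ennreal c \<partial>lborel) = ennreal (c / m)" if "0 \<le> c" for k c
    proof -
      have "(\<integral>\<^sup>+x. of_bool (x \<in> A k) * ennreal c \<partial>lborel) = (\<integral>\<^sup>+x. ennreal c * indicator (A k) x \<partial>lborel)"
        by (intro nn_integral_cong) (simp add: indicator_def)
      also have "\<dots> = ennreal (c / m)"
        using that m0 by (simp add: nn_integral_cmult_indicator emA ennreal_mult[symmetric])
      finally show ?thesis .
    qed
    have Ik_le: "Ik k \<le> ennreal (\<Psi> (z k) / m)" for k
      unfolding Ik_def int_A[of _ k, OF \<Psi>01, symmetric]
    proof (intro nn_integral_mono)
      fix x show "of_bool (x \<in> A k) * ennreal (\<Psi> (norm x)) \<le> of_bool (x \<in> A k) * ennreal (\<Psi> (z k))"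
        by (cases "x \<in> A k") (auto intro!: ennreal_leI \<Psi>_anti z0 z_le)
    qed
    have Ik_ge: "ennreal (\<Psi> (z (Suc k)) / m) \<le> Ik k" for k
      unfolding Ik_def int_A[of _ k, OF \<Psi>01, symmetric]
    proof (intro nn_integral_mono)
      fix x show "of_bool (x \<in> A k) * ennreal (\<Psi> (z (Suc k))) \<le> of_bool (x \<in> A k) * ennreal (\<Psi> (norm x))"
        by (cases "x \<in> A k") (auto intro!: ennreal_leI \<Psi>_anti less_imp_le[OF z_le(2)])
    qed
    \<comment> \<open>Setting the factor to 1 on the annulus makes the product independent of the
      count there. Since the factors lie in the unit interval, the exponent loses at most the area
      1/m.\<close>
    have cell: "\<exists>B. (\<integral>\<^sup>+y. ennreal (1 - (if y \<in> A k then 1 else b y s)) \<partial>lborel) = ennreal B \<and>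
        0 \<le> B \<and> B \<le> \<beta> s \<and> \<beta> s \<le> B + 1 / m" if "0 \<le> s" for k s
    proof -
      let ?f = "\<lambda>y. ennreal (1 - (if y \<in> A k then 1 else b y s))"
      define B where "B = enn2real (integral\<^sup>N lborel ?f)"
      have le: "integral\<^sup>N lborel ?f \<le> ennreal (\<beta> s)"
        unfolding \<beta>(1)[OF that, symmetric] using b01 by (intro nn_integral_mono ennreal_leI) auto
      then have B: "integral\<^sup>N lborel ?f = ennreal B"
        unfolding B_def by (intro ennreal_enn2real[symmetric]) (meson ennreal_less_top le_less_trans)
      have B0: "0 \<le> B" by (simp add: B_def)
      have "ennreal (\<beta> s) \<le> (\<integral>\<^sup>+y. ?f y + of_bool (y \<in> A k) * ennreal 1 \<partial>lborel)"
        unfolding \<beta>(1)[OF that, symmetric] using b01 by (intro nn_integral_mono) (auto simp: ennreal_le_1)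
      also have "\<dots> = integral\<^sup>N lborel ?f + (\<integral>\<^sup>+y. of_bool (y \<in> A k) * ennreal 1 \<partial>lborel)"
        by (rule nn_integral_add) measurable
      also have "\<dots> = ennreal (B + 1 / m)"
        unfolding int_A[OF zero_le_one] B using B0 m0 by simp
      finally have "\<beta> s \<le> B + 1 / m" using B0 m0 by (subst (asm) ennreal_le_iff) auto
      moreover have "B \<le> \<beta> s" using le \<beta>(2)[OF that] unfolding B by (subst (asm) ennreal_le_iff) auto
      ultimately show ?thesis using B B0 by blast
    qed
    have laplace: "(\<integral>\<^sup>+\<omega>. \<phi> (point_count X (A k) \<omega>) * pprod (\<lambda>i. if X i \<omega> \<in> A k then 1 else b (X i \<omega>) s) \<partial>M)
        = (\<integral>\<^sup>+\<omega>. \<phi> (point_count X (A k) \<omega>) \<partial>M) * ennreal (exp (- (r * B)))"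
      if "(\<integral>\<^sup>+y. ennreal (1 - (if y \<in> A k then 1 else b y s)) \<partial>lborel) = ennreal B" "0 \<le> B"
        "(\<integral>\<^sup>+\<omega>. \<phi> (point_count X (A k) \<omega>) \<partial>M) < \<infinity>" for \<phi> k s B
      using that r b01 by (intro ppp_laplace[OF X _ A_meas A_bdd]) auto
    \<comment> \<open>All points of the annulus, among them \<open>X j\<close> itself, are given the
      factor 1. The resulting product no longer depends on j, so summing over j yields the count
      times one product.\<close>
    have Ek_le: "Ek k \<le> ennreal (r * exp (r / m) * (\<Psi> (z k) / m))" for k
    proof -
      obtain B where B: "(\<integral>\<^sup>+y. ennreal (1 - (if y \<in> A k then 1 else b y (z k))) \<partial>lborel) = ennreal B"
        "0 \<le> B" "\<beta> (z k) \<le> B + 1 / m"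
        using cell[OF z0] by blast
      let ?P = "\<lambda>\<omega>. pprod (\<lambda>i. if X i \<omega> \<in> A k then 1 else b (X i \<omega>) (z k))"
      note [measurable] = ppp_count_measurable[OF X A_meas A_bdd, of k]
      have "Ek k \<le> (\<integral>\<^sup>+\<omega>. ennreal (h (z k)) * (of_nat (point_count X (A k) \<omega>) * ?P \<omega>) \<partial>M)"
        unfolding Ek_def
      proof (intro nn_integral_mono_AE, use ppp_AE_finite[OF X A_meas A_bdd, of k] in eventually_elim)
        fix \<omega> assume fin: "finite {j. X j \<omega> \<in> A k}"
        have "(\<Sum>j. of_bool (X j \<omega> \<in> A k) * ?T j \<omega>) \<le> (\<Sum>j. of_bool (X j \<omega> \<in> A k) * (ennreal (h (z k)) * ?P \<omega>))"
        proof (intro suminf_le summableI)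
          fix j
          show "of_bool (X j \<omega> \<in> A k) * ?T j \<omega> \<le> of_bool (X j \<omega> \<in> A k) * (ennreal (h (z k)) * ?P \<omega>)"
          proof (cases "X j \<omega> \<in> A k")
            case True
            then have "?T j \<omega> \<le> ennreal (h (z k)) * ?P \<omega>"
              using z_le[OF True] z0 b01
              by (intro mult_mono ennreal_leI pprod_mono h_anti) (auto intro!: b_anti)
            then show ?thesis using True by simp
          qed simp
        qed
        also have "\<dots> = of_nat (point_count X (A k) \<omega>) * (ennreal (h (z k)) * ?P \<omega>)"
          using suminf_indicator_card[OF fin] by (simp add: point_count_def)
        finally show "(\<Sum>j. of_bool (X j \<omega> \<in> A k) * ?T j \<omega>)
            \<le> ennreal (h (z k)) * (of_nat (point_count X (A k) \<omega>) * ?P \<omega>)"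
          by (simp add: mult_ac)
      qed
      also have "\<dots> = ennreal (h (z k)) * (\<integral>\<^sup>+\<omega>. of_nat (point_count X (A k) \<omega>) * ?P \<omega> \<partial>M)"
        by (intro nn_integral_cmult) measurable
      also have "(\<integral>\<^sup>+\<omega>. of_nat (point_count X (A k) \<omega>) * ?P \<omega> \<partial>M) = ennreal (r * (1 / m)) * ennreal (exp (- (r * B)))"
        using r by (subst laplace[OF B(1,2)]) (simp_all add: nn_integral_ppp_count_id[OF X A_meas A_bdd] mA)
      also have "ennreal (h (z k)) * (ennreal (r * (1 / m)) * ennreal (exp (- (r * B)))) =
          ennreal (r * h (z k) / m * exp (- (r * B)))"
        using r m0 h01 by (simp add: ennreal_mult[symmetric] mult_ac)
      also have "\<dots> \<le> ennreal (r * h (z k) / m * (exp (r / m) * exp (- (r * \<beta> (z k)))))"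
      proof (intro ennreal_leI mult_left_mono)
        have "r * \<beta> (z k) \<le> r * (B + 1 / m)" using B r by (intro mult_left_mono) auto
        then show "exp (- (r * B)) \<le> exp (r / m) * exp (- (r * \<beta> (z k)))"
          by (simp add: exp_add[symmetric] algebra_simps)
      qed (use r m0 h01 in auto)
      finally show ?thesis by (simp add: \<Psi>_def mult_ac)
    qed
    have Ek_ge: "ennreal (r * exp (- (r / m)) * (\<Psi> (z (Suc k)) / m)) \<le> Ek k" for k
    proof -
      obtain B where B: "(\<integral>\<^sup>+y. ennreal (1 - (if y \<in> A k then 1 else b y (z (Suc k)))) \<partial>lborel) = ennreal B"
        "0 \<le> B" "B \<le> \<beta> (z (Suc k))"
        using cell[OF z0] by blast
      let ?P = "\<lambda>\<omega>. pprod (\<lambda>i. if X i \<omega> \<in> A k then 1 else b (X i \<omega>) (z (Suc k)))"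
      let ?\<phi> = "\<lambda>N. of_bool (N = (1::nat)) :: ennreal"
      note [measurable] = ppp_count_measurable[OF X A_meas A_bdd, of k]
      have "(\<integral>\<^sup>+\<omega>. ?\<phi> (point_count X (A k) \<omega>) \<partial>M) = (\<integral>\<^sup>+\<omega>. indicator {\<omega>\<in>space M. point_count X (A k) \<omega> = 1} \<omega> \<partial>M)"
        by (intro nn_integral_cong) (simp add: indicator_def)
      also have "\<dots> = ennreal (r / m * exp (- (r / m)))"
        by (simp add: emeasure_eq_measure ppp_measure_count[OF X A_meas A_bdd] mA)
      finally have P1: "(\<integral>\<^sup>+\<omega>. ?\<phi> (point_count X (A k) \<omega>) \<partial>M) = ennreal (r / m * exp (- (r / m)))" .
      have "r * h (z (Suc k)) / m * exp (- (r / m)) * exp (- (r * \<beta> (z (Suc k)))) \<le>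
          r * h (z (Suc k)) / m * exp (- (r / m)) * exp (- (r * B))"
        using B r m0 h01 by (intro mult_left_mono) auto
      then have "ennreal (r * exp (- (r / m)) * (\<Psi> (z (Suc k)) / m)) \<le>
          ennreal (r * h (z (Suc k)) / m * exp (- (r / m)) * exp (- (r * B)))"
        by (intro ennreal_leI) (simp add: \<Psi>_def mult_ac)
      also have "\<dots> = ennreal (h (z (Suc k))) * (ennreal (r / m * exp (- (r / m))) * ennreal (exp (- (r * B))))"
        using r m0 h01 by (simp add: ennreal_mult[symmetric] mult_ac)
      also have "\<dots> = ennreal (h (z (Suc k))) * (\<integral>\<^sup>+\<omega>. ?\<phi> (point_count X (A k) \<omega>) * ?P \<omega> \<partial>M)"
        by (subst laplace[OF B(1,2)]) (simp_all add: P1[unfolded One_nat_def])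
      also have "\<dots> = (\<integral>\<^sup>+\<omega>. ennreal (h (z (Suc k))) * (?\<phi> (point_count X (A k) \<omega>) * ?P \<omega>) \<partial>M)"
        by (rule nn_integral_cmult[symmetric]) measurable
      also have "\<dots> \<le> Ek k"
        unfolding Ek_def
      proof (intro nn_integral_mono)
        fix \<omega>
        show "ennreal (h (z (Suc k))) * (?\<phi> (point_count X (A k) \<omega>) * ?P \<omega>) \<le> (\<Sum>j. of_bool (X j \<omega> \<in> A k) * ?T j \<omega>)"
        proof (cases "point_count X (A k) \<omega> = 1")
          case True
          then obtain j where j: "{j. X j \<omega> \<in> A k} = {j}"
            by (auto simp: point_count_def card_1_singleton_iff)
          \<comment> \<open>With a single point in the annulus, omitting the factor of index j is
            the same as setting the factor to 1 on the annulus.\<close>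
          then have j': "X i \<omega> \<in> A k \<longleftrightarrow> i = j" for i by blast
          have "ennreal (h (z (Suc k))) * ?P \<omega> \<le> ?T j \<omega>"
            using z_le[of "X j \<omega>" k] z0 b01
            by (intro mult_mono ennreal_leI pprod_mono h_anti) (auto simp: j' intro!: b_anti)
          also have "?T j \<omega> = (\<Sum>j\<in>{j}. of_bool (X j \<omega> \<in> A k) * ?T j \<omega>)"
            using j'[of j] by (simp only: sum.insert sum.empty finite.emptyI empty_iff not_False_eq_True simp_thms of_bool_eq mult_1_left add_0_right)
          also have "\<dots> \<le> (\<Sum>j. of_bool (X j \<omega> \<in> A k) * ?T j \<omega>)"
            by (rule sum_le_suminf) auto
          finally show ?thesis using True by simp
        qed simp
      qed
      finally show ?thesis .
    qed
    have sumSuc: "(\<Sum>k. f k) = f 0 + (\<Sum>k. f (Suc k))" for f :: "nat \<Rightarrow> ennreal"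
      by (subst suminf_offset[of _ 1]) auto
    \<comment> \<open>Cell k + 1 of E is compared with cell k of the integral, because \<Psi> at
      \<open>z (Suc k)\<close> controls the former from above and the latter from below. Cell 0 has
      no partner and is bounded through \<Psi> <= 1.\<close>
    have "E \<le> ennreal (r * exp (r / m) * (1 / m)) + (\<Sum>k. ennreal (r * exp (r / m)) * Ik k)"
      unfolding E_sum sumSuc[of Ek]
    proof (intro add_mono suminf_le summableI)
      show "Ek 0 \<le> ennreal (r * exp (r / m) * (1 / m))"
        using r m0 \<Psi>1[OF z0] by (intro order.trans[OF Ek_le] ennreal_leI mult_left_mono divide_right_mono) auto
      show "Ek (Suc k) \<le> ennreal (r * exp (r / m)) * Ik k" for k
      proof -
        have "Ek (Suc k) \<le> ennreal (r * exp (r / m)) * ennreal (\<Psi> (z (Suc k)) / m)"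
          using Ek_le[of "Suc k"] r m0 \<Psi>01 by (simp add: ennreal_mult[symmetric])
        also have "\<dots> \<le> ennreal (r * exp (r / m)) * Ik k"
          by (intro mult_left_mono Ik_ge) auto
        finally show ?thesis .
      qed
    qed
    also have "\<dots> = ennreal (r * exp (r / m)) * (?I + ennreal (1 / m))"
    proof -
      have "ennreal (r * exp (r / m) * (1 / m)) = ennreal (r * exp (r / m)) * ennreal (1 / m)"
        using r m0 by (intro ennreal_mult) auto
      then show ?thesis
        by (simp only: I_sum distrib_left ennreal_suminf_cmult add.commute)
    qed
    finally show "E \<le> ennreal (r * exp (r / m)) * (?I + ennreal (1 / m))" .
    let ?e = "ennreal (r * exp (- (r / m)))"
    have "?e * ?I = ?e * Ik 0 + (\<Sum>k. ?e * Ik (Suc k))"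
      unfolding I_sum sumSuc[of Ik] by (simp add: distrib_left)
    \<comment> \<open>The same shift with the roles exchanged: cell k + 1 of the integral against
      cell k of E.\<close>
    also have "\<dots> \<le> ennreal (r * exp (- (r / m)) * (1 / m)) + (\<Sum>k. Ek k)"
    proof (intro add_mono suminf_le summableI)
      have "Ik 0 \<le> ennreal (1 / m)"
        using m0 \<Psi>1[OF z0] by (intro order.trans[OF Ik_le] ennreal_leI divide_right_mono) auto
      then have "?e * Ik 0 \<le> ?e * ennreal (1 / m)" by (rule mult_left_mono) simp
      then show "?e * Ik 0 \<le> ennreal (r * exp (- (r / m)) * (1 / m))"
        using r m0 by (simp add: ennreal_mult[symmetric])
      show "?e * Ik (Suc k) \<le> Ek k" for k
      proof -
        have "?e * Ik (Suc k) \<le> ?e * ennreal (\<Psi> (z (Suc k)) / m)"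
          by (intro mult_left_mono Ik_le) auto
        also have "\<dots> \<le> Ek k"
          using Ek_ge[of k] r m0 \<Psi>01 by (simp add: ennreal_mult[symmetric])
        finally show ?thesis .
      qed
    qed
    finally show "?e * ?I \<le> ennreal (r * exp (- (r / m)) * (1 / m)) + E"
      unfolding E_sum .
  qed
  have lim1: "(\<lambda>n. r * exp (r / real n)) \<longlonglongrightarrow> r * exp 0" "(\<lambda>n. r * exp (- (r / real n))) \<longlonglongrightarrow> r * exp 0"
    "(\<lambda>n. 1 / real n) \<longlonglongrightarrow> 0"
    by real_asymp+
  \<comment> \<open>\<open>?I\<close> may be infinite; the limits hold nevertheless because the
    factors in front tend to r > 0.\<close>
  show ?thesis
    unfolding E_def[symmetric]
  proof (rule antisym)
    show "E \<le> ennreal r * ?I"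
    proof (rule tendsto_lowerbound)
      have "(\<lambda>n. ennreal (r * exp (r / real n)) * (?I + ennreal (1 / real n))) \<longlonglongrightarrow> ennreal (r * exp 0) * (?I + ennreal 0)"
        using r lim1 by (intro tendsto_mult_ennreal tendsto_add tendsto_const tendsto_ennrealI) auto
      then show "(\<lambda>n. ennreal (r * exp (r / real n)) * (?I + ennreal (1 / real n))) \<longlonglongrightarrow> ennreal r * ?I"
        by simp
      show "\<forall>\<^sub>F n in sequentially. E \<le> ennreal (r * exp (r / real n)) * (?I + ennreal (1 / real n))"
        using bounds(1) by (intro eventually_sequentiallyI[of 1]) auto
    qed simp
    show "ennreal r * ?I \<le> E"
    proof (rule tendsto_le)
      have "(\<lambda>n. ennreal (r * exp (- (r / real n))) * ?I) \<longlonglongrightarrow> ennreal (r * exp 0) * ?I"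
        using r lim1 by (intro tendsto_mult_ennreal tendsto_const tendsto_ennrealI) auto
      then show "(\<lambda>n. ennreal (r * exp (- (r / real n))) * ?I) \<longlonglongrightarrow> ennreal r * ?I"
        by simp
      have "(\<lambda>n. ennreal (r * exp (- (r / real n)) * (1 / real n)) + E) \<longlonglongrightarrow> ennreal (r * exp 0 * 0) + E"
        by (intro tendsto_add tendsto_const tendsto_ennrealI tendsto_mult[OF lim1(2,3)])
      then show "(\<lambda>n. ennreal (r * exp (- (r / real n)) * (1 / real n)) + E) \<longlonglongrightarrow> E"
        by simp
      show "\<forall>\<^sub>F n in sequentially. ennreal (r * exp (- (r / real n))) * ?I \<le>
          ennreal (r * exp (- (r / real n)) * (1 / real n)) + E"
        using bounds(2) by (intro eventually_sequentiallyI[of 1]) auto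
    qed simp
  qed
qed

subsection \<open>The functions \<open>G\<close> and \<open>H\<close> as plane integrals\<close>

lemma connected_cut_plane: "connected (- complex_of_real ` {1..})"
proof (rule starlike_imp_connected)
  show "starlike (- complex_of_real ` {1..})"
    unfolding starlike_def
  proof (intro bexI[of _ 0] ballI subsetI)
    fix x z assume x: "x \<in> - complex_of_real ` {1..}" and "z \<in> closed_segment 0 x"
    then obtain t where t: "0 \<le> t" "t \<le> 1" and z: "z = of_real t * x"
      by (auto simp: in_segment scaleR_conv_of_real)
    show "z \<in> - complex_of_real ` {1..}"
    proof
      assume "z \<in> complex_of_real ` {1..}"
      then obtain r where r: "r \<ge> 1" "z = of_real r" by auto
      then have "t \<noteq> 0" using z by auto
      then have "x = of_real (r / t)" using r z by (simp add: field_simps)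
      moreover have "r / t \<ge> 1" using r t \<open>t \<noteq> 0\<close> by (simp add: field_simps)
      ultimately have "x \<in> complex_of_real ` {1..}" by (intro image_eqI[of _ _ "r / t"]) auto
      then show False using x by simp
    qed
  qed auto
qed

lemma open_cut_plane: "open (- complex_of_real ` {1..})"
proof -
  have "closed (complex_of_real ` {1..})"
    by (intro closed_injective_linear_image) (auto intro: linear_of_real simp: inj_on_def)
  then show ?thesis by (simp add: open_Compl)
qed

text \<open>This is Euler's integral of b t^(b-1) / (1 - z t) over the unit interval after the
  substitution w = t^b, with k = 1/b. It removes the singularity of t^(b-1) at 0 for b < 1, so that
  the integrand is continuous and the Leibniz rule applies on a compact interval. The denominator
  vanishes only for z = 1/s with 0 < s <= 1, that is, on the cut.\<close>

lemma hyp2F1_integral_holomorphic: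
  assumes "0 < k"
  shows "(\<lambda>z. integral {0..1} (\<lambda>w::real. 1 / (1 - z * complex_of_real (w powr k)))) holomorphic_on (- complex_of_real ` {1..})"
proof -
  let ?U = "- complex_of_real ` {1..}"
  have nz: "1 - z * complex_of_real (w powr k) \<noteq> 0" if "z \<in> ?U" "w \<in> {0..1}" for z w
  proof
    assume *: "1 - z * complex_of_real (w powr k) = 0"
    define s where "s = w powr k"
    have "s \<noteq> 0" using * by (auto simp: s_def)
    moreover have "s \<le> 1" "0 \<le> s" using that assms by (auto simp: s_def intro!: powr_le1)
    ultimately have "1 / s \<ge> 1" "z = of_real (1 / s)"
      using * by (auto simp: s_def[symmetric] field_simps)
    then have "z \<in> complex_of_real ` {1..}" by (intro image_eqI[of _ _ "1 / s"]) auto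
    then show False using that by simp
  qed
  have "(\<lambda>z. integral {0..1} (\<lambda>w::real. 1 / (1 - z * complex_of_real (w powr k)))) field_differentiable at z0"
    if "z0 \<in> ?U" for z0
  proof -
    obtain e where e: "e > 0" "ball z0 e \<subseteq> ?U"
      by (rule openE[OF open_cut_plane \<open>z0 \<in> ?U\<close>])
    have "(\<lambda>z. integral (cbox 0 1) (\<lambda>w::real. 1 / (1 - z * complex_of_real (w powr k)))) holomorphic_on ball z0 e"
    proof (rule leibniz_rule_holomorphic)
      fix z t assume z: "z \<in> ball z0 e" and t: "t \<in> cbox 0 (1::real)"
      have "1 - z * complex_of_real (t powr k) \<noteq> 0" using nz[of z t] z t e by auto
      then show "((\<lambda>z. 1 / (1 - z * complex_of_real (t powr k))) has_field_derivative
          complex_of_real (t powr k) / (1 - z * complex_of_real (t powr k))\<^sup>2) (at z within ball z0 e)"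
        by (auto intro!: derivative_eq_intros simp: power2_eq_square)
    next
      fix z assume z: "z \<in> ball z0 e"
      show "(\<lambda>w::real. 1 / (1 - z * complex_of_real (w powr k))) integrable_on cbox 0 1"
        using nz[of z] z e assms
        by (intro integrable_continuous continuous_intros continuous_on_powr') auto
    next
      show "continuous_on (ball z0 e \<times> cbox 0 1) (\<lambda>(z, t). complex_of_real (t powr k) / (1 - z * complex_of_real (t powr k))\<^sup>2)"
        unfolding case_prod_beta using nz e assms
        by (intro continuous_intros continuous_on_powr') auto
    qed auto
    then show ?thesis
      using e by (auto intro: holomorphic_on_imp_differentiable_at[of _ "ball z0 e"])
  qed
  then show ?thesis
    by (auto simp: holomorphic_on_def intro: field_differentiable_at_within)
qed

text \<open>Geometric series under the integral, dominated uniformly in w by the powers of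
  \<open>norm z\<close>; w^(k n) integrates to 1 / (1 + k n).\<close>

lemma hyp2F1_integral_sums:
  assumes k: "0 < k" and z: "norm z < 1"
  shows "(\<lambda>n. z ^ n / of_real (1 + real n * k)) sums
     integral {0..1} (\<lambda>w::real. 1 / (1 - z * complex_of_real (w powr k)))"
proof -
  let ?f = "\<lambda>n w. (z * complex_of_real (w powr k)) ^ n"
  have le: "norm (z * complex_of_real (w powr k)) \<le> norm z" if "w \<in> cbox 0 1" for w
    using that k by (simp add: norm_mult mult_left_le powr_le1)
  have "uniform_limit (cbox 0 1) (\<lambda>N w. \<Sum>n<N. ?f n w) (\<lambda>w. suminf (\<lambda>n. ?f n w)) sequentially"
    using z le by (intro Weierstrass_m_test[where M = "\<lambda>n. norm z ^ n"])
      (auto simp: norm_power intro!: power_mono summable_geometric)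
  moreover have "continuous_on (cbox 0 1) (\<lambda>w. \<Sum>n<N. ?f n w)" for N
    using k by (intro continuous_intros continuous_on_powr') auto
  ultimately obtain I J where IJ: "\<And>N. ((\<lambda>w. \<Sum>n<N. ?f n w) has_integral I N) (cbox 0 1)"
    "((\<lambda>w. suminf (\<lambda>n. ?f n w)) has_integral J) (cbox 0 1)" "I \<longlonglongrightarrow> J"
    by (rule uniform_limit_integral_cbox) ((rule sequentially_bot | blast)+)
  have terms: "(?f n has_integral z ^ n / of_real (1 + real n * k)) {0..1}" for n
  proof -
    have "((\<lambda>w. w powr (k * real n)) has_integral 1 powr (k * real n + 1) / (k * real n + 1)) {0..1}"
    proof (rule has_integral_powr_from_0)
      have "0 \<le> k * real n" using k by simp
      then show "- 1 < k * real n" by linarith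
    qed simp
    then have "((\<lambda>w. complex_of_real (w powr (k * real n))) has_integral complex_of_real (1 / (k * real n + 1))) {0..1}"
      by (intro has_integral_of_real) simp
    then have "((\<lambda>w. z ^ n * complex_of_real (w powr (k * real n))) has_integral z ^ n * complex_of_real (1 / (k * real n + 1))) {0..1}"
      by (rule has_integral_mult_right)
    \<comment> \<open>The integrands may differ at w = 0: for n = 0, \<open>0 powr 0\<close> is 0
      whereas the zeroth power is 1.\<close>
    then have "(?f n has_integral z ^ n * complex_of_real (1 / (k * real n + 1))) {0..1}"
    proof (rule has_integral_spike_finite[rotated 2])
      fix w :: real assume "w \<in> {0..1} - {0}"
      then have "(w powr k) ^ n = w powr (k * real n)"
        by (simp add: powr_powr[symmetric] powr_realpow)
      then show "?f n w = z ^ n * complex_of_real (w powr (k * real n))"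
        by (simp add: power_mult_distrib flip: of_real_power)
    qed simp
    then show ?thesis by (simp add: add.commute mult.commute divide_inverse)
  qed
  have "((\<lambda>w. \<Sum>n<N. ?f n w) has_integral (\<Sum>n<N. z ^ n / of_real (1 + real n * k))) (cbox 0 1)" for N
    using terms by (intro has_integral_sum) auto
  then have "I = (\<lambda>N. \<Sum>n<N. z ^ n / of_real (1 + real n * k))"
    using IJ(1) by (auto intro: has_integral_unique)
  then have s: "(\<lambda>n. z ^ n / of_real (1 + real n * k)) sums J"
    using IJ(3) by (simp add: sums_def)
  have "suminf (\<lambda>n. ?f n w) = 1 / (1 - z * complex_of_real (w powr k))" if "w \<in> {0..1}" for w
    using le[of w] that z by (intro suminf_geometric) auto
  then have "((\<lambda>w. 1 / (1 - z * complex_of_real (w powr k))) has_integral J) {0..1}"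
    using IJ(2) by (subst has_integral_cong[symmetric]) auto
  with s show ?thesis by (simp add: integral_unique)
qed

text \<open>The Pochhammer symbol of 1 cancels the factorial, and the quotient of those of b and b +
  1 telescopes to b / (b + n).\<close>

lemma fps_hypergeo_1_b:
  assumes b: "0 < (b::real)"
  shows "fps_nth (fps_hypergeo [1, complex_of_real b] [complex_of_real (b + 1)] 1) n = 1 / of_real (1 + real n * (1 / b))"
proof -
  let ?b = "complex_of_real b"
  have nz: "pochhammer (?b + 1) n \<noteq> 0"
  proof
    assume "pochhammer (?b + 1) n = 0"
    then obtain k where "?b + 1 = - of_nat k" by (auto simp: pochhammer_eq_0_iff)
    then have "b + 1 = - real k" using complex_eq_iff[of "?b + 1"] by simp
    with b show False by simp
  qed
  have "pochhammer ?b n * (?b + of_nat n) = ?b * pochhammer (?b + 1) n"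
    using pochhammer_rec[of ?b n] pochhammer_rec'[of ?b n] by (simp add: mult.commute)
  moreover have "?b + of_nat n \<noteq> 0" "?b \<noteq> 0" using b by (auto simp: complex_eq_iff)
  ultimately have "pochhammer ?b n / pochhammer (?b + 1) n = ?b / (?b + of_nat n)"
    using nz by (simp add: field_simps)
  then show ?thesis
    using b by (simp add: pochhammer_fact[symmetric] field_simps)
qed

text \<open>Euler's integral meets the description in \<open>hyp2F1\<close>, and it is the only
  candidate: two continuations agree near 0 through their common expansion, hence on the whole cut
  plane by the identity theorem.\<close>

lemma hyp2F1_eq_integral:
  assumes b: "0 < b" and z: "z \<notin> complex_of_real ` {1..}"
  shows "hyp2F1 1 (of_real b) (of_real (b + 1)) z =
    integral {0..1} (\<lambda>w::real. 1 / (1 - z * complex_of_real (w powr (1 / b))))"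
proof -
  define F where "F = (\<lambda>z. integral {0..1} (\<lambda>w::real. 1 / (1 - z * complex_of_real (w powr (1 / b)))))"
  let ?U = "- complex_of_real ` {1..}"
  let ?c = "fps_hypergeo [1, complex_of_real b] [complex_of_real (b + 1)] 1"
  have hol: "F holomorphic_on ?U"
    unfolding F_def using b by (intro hyp2F1_integral_holomorphic) auto
  have sums: "(\<lambda>n. fps_nth ?c n * z ^ n) sums F z" if "norm z < 1" for z
    using hyp2F1_integral_sums[of "1 / b" z] b that unfolding fps_hypergeo_1_b[OF b] F_def by simp
  have exp: "F has_fps_expansion ?c"
    unfolding has_fps_expansion_def
  proof
    \<comment> \<open>Convergence at the single point 1/2 already gives a positive radius.\<close>
    have "fps_conv_radius ?c \<ge> ereal (1 / 2)"
      unfolding fps_conv_radius_def using sums[of "1 / 2"]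
      by (intro conv_radius_geI[where z = "1 / 2"] order.trans[OF _ conv_radius_geI[where z = "1 / 2"]])
         (auto dest: sums_summable)
    then show "0 < fps_conv_radius ?c" by (rule less_le_trans[rotated]) simp
    have "\<forall>\<^sub>F z in nhds 0. z \<in> ball 0 (1::real)"
      by (intro eventually_nhds_in_open) auto
    then show "\<forall>\<^sub>F z in nhds 0. eval_fps ?c z = F z"
      by eventually_elim (auto simp: eval_fps_def dest!: sums sums_unique)
  qed
  show ?thesis
    unfolding hyp2F1_def F_def[symmetric]
  proof (rule the_equality)
    show "\<exists>f. f holomorphic_on ?U \<and> f has_fps_expansion ?c \<and> f z = integral {0..1} (\<lambda>w::real. 1 / (1 - z * complex_of_real (w powr (1 / b))))"
      using hol exp by (intro exI[of _ F]) (simp add: F_def)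
  next
    fix w assume "\<exists>f. f holomorphic_on ?U \<and> f has_fps_expansion ?c \<and> f z = w"
    then obtain f where f: "f holomorphic_on ?U" "f has_fps_expansion ?c" "f z = w" by blast
    have "\<forall>\<^sub>F z in nhds 0. f z = F z"
      using f(2) exp unfolding has_fps_expansion_def by (auto elim: eventually_elim2)
    then obtain T where T: "open T" "0 \<in> T" "\<And>z. z \<in> T \<Longrightarrow> f z = F z"
      by (auto simp: eventually_nhds)
    have "f z = F z"
    proof (rule analytic_continuation_open[where s = "T \<inter> ?U" and s' = ?U and f = f and g = F])
      show "T \<inter> ?U \<noteq> {}" using T by auto
    qed (use T f hol z open_cut_plane connected_cut_plane in auto)
    then show "w = integral {0..1} (\<lambda>w::real. 1 / (1 - z * complex_of_real (w powr (1 / b))))"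
      using f by (simp add: F_def)
  qed
qed

text \<open>The parameters in \<open>G_fun\<close> are 1, b and b + 1 with b = 1 - 2/a, so 1/b =
  a/(a - 2); the argument -x lies off the cut as x >= 0.\<close>

lemma G_fun_eq_integral:
  assumes a: "2 < a" and x: "0 \<le> x"
  shows "((\<lambda>w. 2 * x / (a - 2) * (1 / (1 + x * w powr (a / (a - 2))))) has_integral G_fun x a) {0..1}"
proof -
  define b where "b = 1 - 2 / a"
  have b: "0 < b" "1 / b = a / (a - 2)" "2 - 2 / a = b + 1"
    using a by (auto simp: b_def field_simps)
  have "complex_of_real (- x) \<notin> complex_of_real ` {1..}"
    using x by (auto simp del: of_real_minus)
  then have "hyp2F1 1 (of_real b) (of_real (b + 1)) (of_real (- x)) =
      integral {0..1} (\<lambda>w::real. 1 / (1 - of_real (- x) * complex_of_real (w powr (a / (a - 2)))))"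
    using hyp2F1_eq_integral[OF b(1)] unfolding b(2) by blast
  also have "\<dots> = integral {0..1} (\<lambda>w::real. complex_of_real (1 / (1 + x * w powr (a / (a - 2)))))"
    by simp
  finally have eq: "hyp2F1 1 (of_real b) (of_real (b + 1)) (of_real (- x)) = \<dots>" .
  have pos: "1 + x * w powr (a / (a - 2)) \<noteq> 0" for w
    using x by (smt (verit) mult_nonneg_nonneg powr_ge_zero)
  have "continuous_on {0..1} (\<lambda>w. 1 / (1 + x * w powr (a / (a - 2))))"
    using a pos by (intro continuous_intros continuous_on_powr') auto
  then have i: "((\<lambda>w. 1 / (1 + x * w powr (a / (a - 2)))) has_integral
      integral {0..1} (\<lambda>w. 1 / (1 + x * w powr (a / (a - 2))))) {0..1}"
    by (intro integrable_integral integrable_continuous_real)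
  have "G_fun x a = 2 * x / (a - 2) * integral {0..1} (\<lambda>w. 1 / (1 + x * w powr (a / (a - 2))))"
    unfolding G_fun_def b(3) b_def[symmetric] eq
    by (subst integral_unique[OF has_integral_of_real[OF i]]) simp
  with has_integral_mult_right[OF i, of "2 * x / (a - 2)"] show ?thesis by (simp only:)
qed

section \<open>Plane integrals of the interference loss\<close>

lemma has_integral_change_of_variables_nonneg:
  fixes f g g' :: "real \<Rightarrow> real"
  assumes "S \<in> sets lebesgue"
    and "\<And>x. x \<in> S \<Longrightarrow> (g has_field_derivative g' x) (at x within S)" "inj_on g S"
    and f: "\<And>x. 0 \<le> f x" and int: "((\<lambda>x. \<bar>g' x\<bar> * f (g x)) has_integral b) S"
  shows "(f has_integral b) (g ` S)"
proof -
  \<comment> \<open>For a nonnegative function, integrability is absolute integrability.\<close>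
  have "(\<lambda>x. \<bar>g' x\<bar> * f (g x)) absolutely_integrable_on S"
    using f int by (intro nonnegative_absolutely_integrable_1) (auto simp: integrable_on_def)
  with integral_unique[OF int] have "f absolutely_integrable_on (g ` S) \<and> integral (g ` S) f = b"
    using has_absolute_integral_change_of_variables_1'[OF assms(1-3), of f b] by blast
  then show ?thesis
    using has_integral_integral set_lebesgue_integral_eq_integral(1) by blast
qed

text \<open>One minus this is 1 / (1 + x (k/t)^a), the Laplace transform of unit-mean exponential
  fading: the mean factor due to an active interferer at distance t, where k is the distance at
  which it would match the mean power of the serving station. At t = 0, division by zero makes the
  value 0.\<close>

definition damping :: "real \<Rightarrow> real \<Rightarrow> real \<Rightarrow> real \<Rightarrow> real" where
  "damping a x k t = x * (k / t) powr a / (1 + x * (k / t) powr a)"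

lemma damping_bounds: "0 \<le> x \<Longrightarrow> 0 \<le> damping a x k t" "0 \<le> x \<Longrightarrow> damping a x k t \<le> 1"
  by (auto simp: damping_def divide_le_eq_1 add_pos_nonneg)

lemma damping_measurable [measurable]: "damping a x k \<in> borel_measurable borel"
  unfolding damping_def[abs_def] by measurable

lemma G_fun_nonneg:
  assumes "2 < a" "0 \<le> x"
  shows "0 \<le> G_fun x a"
  using has_integral_nonneg[OF G_fun_eq_integral[OF assms]] assms by (simp add: add_nonneg_nonneg)

lemma H_fun_nonneg: "2 < a \<Longrightarrow> 0 \<le> x \<Longrightarrow> 0 \<le> H_fun x a"
  unfolding H_fun_def by (intro mult_nonneg_nonneg) (auto simp: Beta_def intro!: divide_nonneg_nonneg mult_nonneg_nonneg less_imp_le[OF Gamma_real_pos])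

text \<open>The substitution t = k w^(-1/(a-2)) maps (0, 1] onto the radii from k on. Its exponent
  is chosen so that the powers of w from the Jacobian, from the area element and from the numerator
  of \<open>damping\<close> cancel, which leaves Euler's integrand for G.\<close>

lemma nn_integral_damping_outside:
  assumes a: "2 < a" and x: "0 \<le> x" and k: "0 \<le> k"
  shows "(\<integral>\<^sup>+y. ennreal (of_bool (k \<le> norm y) * damping a x k (norm y)) \<partial>plane)
    = ennreal (pi * k\<^sup>2 * G_fun x a)"
proof (cases "k = 0")
  case True
  then show ?thesis by (simp add: damping_def)
next
  case False
  with k have k: "0 < k" by simp
  \<comment> \<open>The absolute value makes f nonnegative on the whole line, as the change of
    variables requires.\<close>
  define f where "f t = 2 * pi * \<bar>t\<bar> * damping a x k t" for t
  define g where "g w = k * w powr (- 1 / (a - 2))" for w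
  define g' where "g' w = k * (- 1 / (a - 2)) * w powr (- 1 / (a - 2) - 1)" for w
  have "(f has_integral pi * k\<^sup>2 * G_fun x a) (g ` {0<..1})"
  proof (rule has_integral_change_of_variables_nonneg)
    show "(g has_field_derivative g' w) (at w within {0<..1})" if "w \<in> {0<..1}" for w
      unfolding g_def g'_def using that by (auto intro!: derivative_eq_intros simp: mult_ac)
    show "inj_on g {0<..1}"
    proof (rule inj_onI)
      fix v w assume "v \<in> {0<..1}" "w \<in> {0<..1}" "g v = g w"
      then have "ln (v powr (- 1 / (a - 2))) = ln (w powr (- 1 / (a - 2)))" using k by (simp add: g_def)
      then have "ln v = ln w" using a \<open>v \<in> _\<close> \<open>w \<in> _\<close> by (simp add: ln_powr)
      then show "v = w" using \<open>v \<in> _\<close> \<open>w \<in> _\<close> by simp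
    qed
    have "((\<lambda>w. pi * k\<^sup>2 * (2 * x / (a - 2) * (1 / (1 + x * w powr (a / (a - 2)))))) has_integral pi * k\<^sup>2 * G_fun x a) {0..1}"
      by (intro has_integral_mult_right G_fun_eq_integral a x)
    then have "((\<lambda>w. pi * k\<^sup>2 * (2 * x / (a - 2) * (1 / (1 + x * w powr (a / (a - 2)))))) has_integral pi * k\<^sup>2 * G_fun x a) {0<..1}"
      by (rule has_integral_spike_set_eq[THEN iffD1, rotated 2]) (auto intro: negligible_subset[of "{0}"])
    then show "((\<lambda>w. \<bar>g' w\<bar> * f (g w)) has_integral pi * k\<^sup>2 * G_fun x a) {0<..1}"
    proof (rule has_integral_eq[rotated])
      fix w :: real assume "w \<in> {0<..1}"
      then have w: "0 < w" by simp
      have "k / g w = w powr (1 / (a - 2))"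
        using k w by (simp add: g_def powr_minus field_simps)
      then have "(k / g w) powr a = w powr (a / (a - 2))"
        by (simp add: powr_powr)
      then have fg: "f (g w) = 2 * pi * (k * w powr (- 1 / (a - 2))) * (x * w powr (a / (a - 2)) / (1 + x * w powr (a / (a - 2))))"
        using k by (simp add: f_def damping_def g_def abs_mult)
      have "w powr (- 1 / (a - 2) - 1) * w powr (- 1 / (a - 2)) * w powr (a / (a - 2)) = w powr 0"
      proof -
        have "a / (a - 2) = 1 + 2 * (1 / (a - 2))" "- 1 / (a - 2) = - (1 / (a - 2))"
          using a by (auto simp: field_simps)
        then have "- 1 / (a - 2) - 1 + - 1 / (a - 2) + a / (a - 2) = 0" by linarith
        then show ?thesis by (simp only: powr_add[symmetric])
      qed
      then have p: "w powr (- 1 / (a - 2) - 1) * w powr (- 1 / (a - 2)) * w powr (a / (a - 2)) = 1"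
        using w by simp
      have "\<bar>g' w\<bar> * f (g w) = 2 * pi * k\<^sup>2 * x / (a - 2) / (1 + x * w powr (a / (a - 2))) *
          (w powr (- 1 / (a - 2) - 1) * w powr (- 1 / (a - 2)) * w powr (a / (a - 2)))"
        unfolding fg g'_def using a k by (simp add: abs_mult power2_eq_square)
      then show "pi * k\<^sup>2 * (2 * x / (a - 2) * (1 / (1 + x * w powr (a / (a - 2))))) = \<bar>g' w\<bar> * f (g w)"
        unfolding p by simp
    qed
  qed (use x in \<open>auto simp: f_def intro!: mult_nonneg_nonneg damping_bounds\<close>)
  also have "g ` {0<..1} = {k..}"
  proof (intro equalityI subsetI)
    fix t assume "t \<in> g ` {0<..1}"
    then obtain w where w: "0 < w" "w \<le> 1" "t = g w" by auto
    have "1 \<le> inverse (w powr (1 / (a - 2)))"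
      using w a by (intro one_le_inverse powr_le1) auto
    then show "t \<in> {k..}" using k w by (simp add: g_def powr_minus)
  next
    fix t assume "t \<in> {k..}"
    then have t: "k \<le> t" by simp
    let ?w = "(k / t) powr (a - 2)"
    have "?w powr (- 1 / (a - 2)) = (k / t) powr (- 1)"
      unfolding powr_powr using a by simp
    then have "g ?w = t" using k t by (simp add: g_def powr_minus)
    moreover have "?w \<in> {0<..1}" using k t a by (auto intro!: powr_le1)
    ultimately show "t \<in> g ` {0<..1}" by (metis imageI)
  qed
  finally have int: "(f has_integral pi * k\<^sup>2 * G_fun x a) {k..}" .
  have "(\<integral>\<^sup>+y. ennreal (of_bool (k \<le> norm y) * damping a x k (norm y)) \<partial>plane)
      = (\<integral>\<^sup>+t\<in>{0..}. ennreal (2 * pi * t) * ennreal (of_bool (k \<le> t) * damping a x k t) \<partial>lborel)"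
    by (rule nn_integral_radial) measurable
  also have "\<dots> = (\<integral>\<^sup>+t. ennreal (indicator {k..} t * f t) \<partial>lborel)"
    using k x by (intro nn_integral_cong) (auto simp: f_def indicator_def ennreal_mult[symmetric] damping_bounds)
  also have "\<dots> = ennreal (pi * k\<^sup>2 * G_fun x a)"
    using x by (intro nn_integral_has_integral_lebesgue int)
       (simp add: f_def mult_nonneg_nonneg damping_bounds)
  finally show ?thesis .
qed

text \<open>The new variable u is the value of \<open>damping\<close> itself, u = s / (1 + s) with s
  = x (k/t)^a; \<open>g\<close> is the inverse map. The radial integral becomes the Beta integral
  with parameters 1 - 2/a and 2/a.\<close>

lemma nn_integral_damping:
  assumes a: "2 < a" and x: "0 < x" and k: "0 \<le> k"
  shows "(\<integral>\<^sup>+y. ennreal (damping a x k (norm y)) \<partial>plane)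
    = ennreal (pi * k\<^sup>2 * H_fun x a)"
proof (cases "k = 0")
  case True
  then show ?thesis by (simp add: damping_def)
next
  case False
  with k have k: "0 < k" by simp
  define f where "f t = 2 * pi * \<bar>t\<bar> * damping a x k t" for t
  define g where "g u = k * x powr (1 / a) * (1 / u - 1) powr (1 / a)" for u
  define g' where "g' u = k * x powr (1 / a) * ((1 / a) * (1 / u - 1) powr (1 / a - 1) * (- 1 / u\<^sup>2))" for u
  have inv: "x * (k / g u) powr a = u / (1 - u)" if "0 < u" "u < 1" for u
  proof -
    have "g u powr a = k powr a * x * (1 / u - 1)"
      using a k x that by (simp add: g_def powr_mult powr_powr)
    moreover have "(k / g u) powr a = k powr a / g u powr a"
      by (rule powr_divide)
    ultimately have "x * (k / g u) powr a = x * (k powr a / (k powr a * x * (1 / u - 1)))"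
      by (simp only:)
    also have "\<dots> = 1 / (1 / u - 1)"
      using k x by simp
    also have "\<dots> = u / (1 - u)"
      using that by (simp add: field_simps)
    finally show ?thesis .
  qed
  have "(f has_integral pi * k\<^sup>2 * H_fun x a) (g ` {0<..<1})"
  proof (rule has_integral_change_of_variables_nonneg)
    show "(g has_field_derivative g' u) (at u within {0<..<1})" if "u \<in> {0<..<1}" for u
    proof -
      have "1 / u - 1 > 0" using that by simp
      then show ?thesis
        unfolding g_def g'_def using that
        by (auto intro!: derivative_eq_intros simp: power2_eq_square)
    qed
    show "inj_on g {0<..<1}"
    proof (rule inj_onI)
      fix u v assume u: "u \<in> {0<..<1}" and v: "v \<in> {0<..<1}" and "g u = g v"
      then have "u / (1 - u) = v / (1 - v)" using inv[of u] inv[of v] by simp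
      then show "u = v" using u v by (simp add: field_simps)
    qed
    have "((\<lambda>u. u powr ((1 - 2 / a) - 1) * (1 - u) powr (2 / a - 1)) has_integral Beta (1 - 2 / a) (2 / a)) {0..1}"
      using a by (intro has_integral_Beta_real) auto
    then have "((\<lambda>u. 2 * pi / a * k\<^sup>2 * x powr (2 / a) * (u powr ((1 - 2 / a) - 1) * (1 - u) powr (2 / a - 1))) has_integral
        2 * pi / a * k\<^sup>2 * x powr (2 / a) * Beta (1 - 2 / a) (2 / a)) {0..1}"
      by (rule has_integral_mult_right)
    then have "((\<lambda>u. 2 * pi / a * k\<^sup>2 * x powr (2 / a) * (u powr ((1 - 2 / a) - 1) * (1 - u) powr (2 / a - 1))) has_integral
        2 * pi / a * k\<^sup>2 * x powr (2 / a) * Beta (1 - 2 / a) (2 / a)) {0<..<1}"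
      by (simp only: has_integral_Icc_iff_Ioo)
    also have "2 * pi / a * k\<^sup>2 * x powr (2 / a) * Beta (1 - 2 / a) (2 / a) = pi * k\<^sup>2 * H_fun x a"
      by (simp add: H_fun_def Beta_commute)
    finally show "((\<lambda>u. \<bar>g' u\<bar> * f (g u)) has_integral pi * k\<^sup>2 * H_fun x a) {0<..<1}"
    proof (rule has_integral_eq[rotated])
      fix u :: real assume "u \<in> {0<..<1}"
      then have u: "0 < u" "u < 1" by auto
      have d: "damping a x k (g u) = u"
        unfolding damping_def inv[OF u] using u by (simp add: field_simps)
      have gpos: "g u \<ge> 0" using k by (simp add: g_def)
      have "\<bar>g' u\<bar> * f (g u) = (k * x powr (1 / a) * ((1 / a) * (1 / u - 1) powr (1 / a - 1) * (1 / u\<^sup>2))) *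
          (2 * pi * (k * x powr (1 / a) * (1 / u - 1) powr (1 / a)) * u)"
        using gpos d a k by (simp add: f_def g'_def abs_mult) (simp add: g_def)
      also have "\<dots> = 2 * pi / a * k\<^sup>2 * (x powr (1 / a) * x powr (1 / a)) * ((1 / u - 1) powr (1 / a - 1) * (1 / u - 1) powr (1 / a)) * (u / u\<^sup>2)"
        by (simp add: power2_eq_square mult_ac)
      also have "x powr (1 / a) * x powr (1 / a) = x powr (2 / a)"
        by (simp add: powr_add[symmetric])
      also have "(1 / u - 1) powr (1 / a - 1) * (1 / u - 1) powr (1 / a) = (1 / u - 1) powr (2 / a - 1)"
        by (simp add: powr_add[symmetric] algebra_simps)
      also have "1 / u - 1 = (1 - u) / u" using u by (simp add: field_simps)
      also have "((1 - u) / u) powr (2 / a - 1) = (1 - u) powr (2 / a - 1) * u powr (1 - 2 / a)"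
        using u by (simp add: powr_divide powr_minus_divide[symmetric] divide_powr_uminus)
      also have "u / u\<^sup>2 = u powr (- 1)"
        using u by (simp add: powr_minus power2_eq_square field_simps)
      finally have fin: "\<bar>g' u\<bar> * f (g u) = 2 * pi / a * k\<^sup>2 * x powr (2 / a) *
          ((1 - u) powr (2 / a - 1) * u powr (1 - 2 / a)) * u powr (- 1)" .
      have "u powr ((1 - 2 / a) - 1) = u powr (1 - 2 / a) * u powr (- 1)"
        by (simp only: powr_add[symmetric] add_uminus_conv_diff)
      then show "2 * pi / a * k\<^sup>2 * x powr (2 / a) * (u powr ((1 - 2 / a) - 1) * (1 - u) powr (2 / a - 1)) = \<bar>g' u\<bar> * f (g u)"
        using fin by (simp only: mult_ac)
    qed
  qed (use x in \<open>auto simp: f_def intro!: mult_nonneg_nonneg damping_bounds\<close>)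
  also have "g ` {0<..<1} = {0<..}"
  proof (intro equalityI subsetI)
    fix t assume "t \<in> g ` {0<..<1}"
    then show "t \<in> {0<..}" using k x by (auto simp: g_def)
  next
    fix t :: real assume "t \<in> {0<..}"
    then have t: "0 < t" by simp
    define s where "s = x * (k / t) powr a"
    have s: "0 < s" using x k t by (simp add: s_def)
    have "1 / (s / (1 + s)) - 1 = 1 / s" using s by (simp add: field_simps)
    then have "g (s / (1 + s)) = k * x powr (1 / a) * (1 / s) powr (1 / a)"
      by (simp only: g_def)
    also have "\<dots> = t"
      using x k t a by (simp add: s_def powr_mult powr_divide powr_powr)
    finally have "g (s / (1 + s)) = t" .
    moreover have "s / (1 + s) \<in> {0<..<1}" using s by simp
    ultimately show "t \<in> g ` {0<..<1}" by (metis imageI)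
  qed
  finally have int: "(f has_integral pi * k\<^sup>2 * H_fun x a) {0<..}" .
  have "(\<integral>\<^sup>+y. ennreal (damping a x k (norm y)) \<partial>plane)
      = (\<integral>\<^sup>+t\<in>{0..}. ennreal (2 * pi * t) * ennreal (damping a x k t) \<partial>lborel)"
    by (rule nn_integral_radial) measurable
  also have "\<dots> = (\<integral>\<^sup>+t. ennreal (indicator {0<..} t * f t) \<partial>lborel)"
    using x by (intro nn_integral_cong) (auto simp: f_def indicator_def ennreal_mult[symmetric] damping_bounds)
  also have "\<dots> = ennreal (pi * k\<^sup>2 * H_fun x a)"
    using x by (intro nn_integral_has_integral_lebesgue int)
       (simp add: f_def mult_nonneg_nonneg damping_bounds)
  finally show ?thesis .
qed

subsection \<open>Decoupling of independent sources\<close>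

text \<open>Fubini in place of conditional expectations: independence says that the image of
  \<open>M\<close> under the diagonal map is the product of its restrictions to F and G. One
  argument of f may then be averaged with the other frozen.\<close>

lemma (in prob_space) nn_integral_decouple:
  assumes F: "subalgebra M F" and G: "subalgebra M G"
    and ind: "\<And>a b. a \<in> sets F \<Longrightarrow> b \<in> sets G \<Longrightarrow> prob (a \<inter> b) = prob a * prob b"
    and f: "case_prod f \<in> borel_measurable (F \<Otimes>\<^sub>M G)"
  shows "(\<integral>\<^sup>+\<omega>. f \<omega> \<omega> \<partial>M) = (\<integral>\<^sup>+\<omega>. (\<integral>\<^sup>+\<omega>'. f \<omega> \<omega>' \<partial>M) \<partial>M)"
proof -
  let ?F = "restr_to_subalg M F" and ?G = "restr_to_subalg M G"
  interpret F: prob_space ?F by (rule prob_space_restr_to_subalg[OF F prob_space_axioms])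
  interpret G: prob_space ?G by (rule prob_space_restr_to_subalg[OF G prob_space_axioms])
  have spF: "space F = space M" and spG: "space G = space M"
    using F G by (auto simp: subalgebra_def)
  note setsF = sets_restr_to_subalg[OF F] and setsG = sets_restr_to_subalg[OF G]
  have sets_eq: "sets (?F \<Otimes>\<^sub>M ?G) = sets (F \<Otimes>\<^sub>M G)"
    by (intro sets_pair_measure_cong setsF setsG)
  have idF: "(\<lambda>\<omega>. \<omega>) \<in> M \<rightarrow>\<^sub>M F" and idG: "(\<lambda>\<omega>. \<omega>) \<in> M \<rightarrow>\<^sub>M G"
    by (rule measurable_from_subalg[OF F], simp) (rule measurable_from_subalg[OF G], simp)
  then have diag: "(\<lambda>\<omega>. (\<omega>, \<omega>)) \<in> M \<rightarrow>\<^sub>M F \<Otimes>\<^sub>M G" by (rule measurable_Pair)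
  have eq: "?F \<Otimes>\<^sub>M ?G = distr M (F \<Otimes>\<^sub>M G) (\<lambda>\<omega>. (\<omega>, \<omega>))"
  proof (rule pair_measure_eqI)
    show "sigma_finite_measure ?F" "sigma_finite_measure ?G" by unfold_locales
    show "sets (?F \<Otimes>\<^sub>M ?G) = sets (distr M (F \<Otimes>\<^sub>M G) (\<lambda>\<omega>. (\<omega>, \<omega>)))"
      by (simp add: sets_eq)
    fix A B assume "A \<in> sets ?F" "B \<in> sets ?G"
    then have A: "A \<in> sets F" and B: "B \<in> sets G" by (simp_all add: setsF setsG)
    have AB: "(\<lambda>\<omega>. (\<omega>, \<omega>)) -` (A \<times> B) \<inter> space M = A \<inter> B"
      using sets.sets_into_space[OF A] by (auto simp: spF)
    have "emeasure (distr M (F \<Otimes>\<^sub>M G) (\<lambda>\<omega>. (\<omega>, \<omega>))) (A \<times> B) = emeasure M (A \<inter> B)"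
      using A B by (subst emeasure_distr[OF diag]) (simp_all add: AB)
    also have "\<dots> = emeasure M A * emeasure M B"
      by (simp add: emeasure_eq_measure ind[OF A B] ennreal_mult)
    finally show "emeasure ?F A * emeasure ?G B = emeasure (distr M (F \<Otimes>\<^sub>M G) (\<lambda>\<omega>. (\<omega>, \<omega>))) (A \<times> B)"
      by (simp add: emeasure_restr_to_subalg[OF F A] emeasure_restr_to_subalg[OF G B])
  qed
  have f': "case_prod f \<in> borel_measurable (?F \<Otimes>\<^sub>M ?G)"
    using f by (simp add: measurable_cong_sets[OF sets_eq refl])
  have "(\<integral>\<^sup>+\<omega>. f \<omega> \<omega> \<partial>M) = (\<integral>\<^sup>+p. case_prod f p \<partial>distr M (F \<Otimes>\<^sub>M G) (\<lambda>\<omega>. (\<omega>, \<omega>)))"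
    using f by (subst nn_integral_distr[OF diag]) simp_all
  also have "\<dots> = (\<integral>\<^sup>+\<omega>. (\<integral>\<^sup>+\<omega>'. f \<omega> \<omega>' \<partial>?G) \<partial>?F)"
    unfolding eq[symmetric] using G.nn_integral_fst[OF f'] by simp
  also have "\<dots> = (\<integral>\<^sup>+\<omega>. (\<integral>\<^sup>+\<omega>'. f \<omega> \<omega>' \<partial>M) \<partial>?F)"
  proof (rule nn_integral_cong)
    fix \<omega> assume "\<omega> \<in> space ?F"
    then have "\<omega> \<in> space F" by (simp add: space_restr_to_subalg spF)
    from measurable_Pair2[OF f this] have "f \<omega> \<in> borel_measurable G" by simp
    then show "(\<integral>\<^sup>+\<omega>'. f \<omega> \<omega>' \<partial>?G) = (\<integral>\<^sup>+\<omega>'. f \<omega> \<omega>' \<partial>M)"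
      by (rule nn_integral_subalgebra2[OF G])
  qed
  also have "\<dots> = (\<integral>\<^sup>+\<omega>. (\<integral>\<^sup>+\<omega>'. f \<omega> \<omega>' \<partial>M) \<partial>M)"
  proof (rule nn_integral_subalgebra2[OF F])
    have "(\<lambda>\<omega>. \<integral>\<^sup>+\<omega>'. f \<omega> \<omega>' \<partial>?G) \<in> borel_measurable ?F"
      using G.borel_measurable_nn_integral_fst[OF f'] by simp
    then have "(\<lambda>\<omega>. \<integral>\<^sup>+\<omega>'. f \<omega> \<omega>' \<partial>?G) \<in> borel_measurable F"
      by (simp add: measurable_cong_sets[OF setsF refl])
    also have "?this \<longleftrightarrow> (\<lambda>\<omega>. \<integral>\<^sup>+\<omega>'. f \<omega> \<omega>' \<partial>M) \<in> borel_measurable F"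
    proof (rule measurable_cong)
      fix \<omega> assume "\<omega> \<in> space F"
      from measurable_Pair2[OF f this] have "f \<omega> \<in> borel_measurable G" by simp
      then show "(\<integral>\<^sup>+\<omega>'. f \<omega> \<omega>' \<partial>?G) = (\<integral>\<^sup>+\<omega>'. f \<omega> \<omega>' \<partial>M)"
        by (rule nn_integral_subalgebra2[OF G])
    qed
    finally show "(\<lambda>\<omega>. \<integral>\<^sup>+\<omega>'. f \<omega> \<omega>' \<partial>M) \<in> borel_measurable F" .
  qed
  finally show ?thesis .
qed

section \<open>Sigma-algebras generated by groups of sources\<close>

locale cache_net =
  fixes M :: "'w measure" and S :: params and V :: "'w network" and n :: nat
  assumes valid: "valid_params S" and net: "cache_network M S V" and n: "n \<in> second_group S"
begin

sublocale prob_space M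
  using net by (simp add: cache_network_def)

text \<open>The tier argument of \<open>source_events\<close> only selects a load; with
  \<open>Helper\<close>, the source \<open>Load\<close> is the load of the helper tier, the one
  entering the rate.\<close>

definition alg :: "source set \<Rightarrow> 'w measure" where
  "alg A = sigma (space M) (\<Union>s\<in>A. source_events M V n Helper s)"

lemma ppp: "homogeneous_ppp M (lam S i) (loc V i)"
  using net by (simp add: cache_network_def)

lemma fading_distr: "distributed M lborel (fading V i j) (exponential_density 1)"
  using net by (simp add: cache_network_def)

lemma stores_measurable: "stores V n j \<in> M \<rightarrow>\<^sub>M count_space UNIV"
  and prob_stores: "prob {\<omega> \<in> space M. stores V n j \<omega>} = p_Lp S"
  using net n by (simp_all add: cache_network_def)

lemma active_measurable: "active V j \<in> M \<rightarrow>\<^sub>M count_space UNIV"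
  and prob_active: "prob {\<omega> \<in> space M. active V j \<omega>} = p_act S"
  using net by (simp_all add: cache_network_def)

lemma load_measurable: "load V k \<in> M \<rightarrow>\<^sub>M count_space UNIV"
  and prob_load: "prob {\<omega> \<in> space M. load V k \<omega> = l + 1} = P_load S k l"
  using net by (simp_all add: cache_network_def)

lemma source_events_subset: "source_events M V n Helper s \<subseteq> sets M"
proof (cases s)
  case (Locations i)
  have "(\<lambda>\<omega> j. loc V i j \<omega>) \<in> M \<rightarrow>\<^sub>M PiM UNIV (\<lambda>_. borel)"
    using ppp_measurable[OF ppp] by (intro measurable_PiM_single') auto
  then show ?thesis using Locations by (simp add: measurable_iff_sets)
next
  case (Fading i j)
  then show ?thesis using distributed_measurable[OF fading_distr, of i j] by (simp add: measurable_iff_sets)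
qed (use stores_measurable active_measurable load_measurable in \<open>simp_all add: measurable_iff_sets\<close>)

lemma space_alg [simp]: "space (alg A) = space M"
  by (simp add: alg_def space_measure_of_conv)

lemma sets_alg: "sets (alg A) = sigma_sets (space M) (\<Union>s\<in>A. source_events M V n Helper s)"
  unfolding alg_def using source_events_subset sets.space_closed by (intro sets_measure_of) blast

lemma alg_subalgebra: "subalgebra M (alg A)"
  unfolding subalgebra_def sets_alg using source_events_subset
  by (auto intro!: sets.sigma_sets_subset)

lemma source_alg:
  assumes "s \<in> A" "source_events M V n Helper s = sets (vimage_algebra (space M) X N)"
    and X: "X \<in> space M \<rightarrow> space N"
  shows "X \<in> alg A \<rightarrow>\<^sub>M N"
proof (rule measurable_from_subalg)
  show "subalgebra (alg A) (vimage_algebra (space M) X N)"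
    using assms(1) unfolding subalgebra_def sets_alg assms(2)[symmetric] by auto
  show "X \<in> vimage_algebra (space M) X N \<rightarrow>\<^sub>M N"
    by (rule measurable_vimage_algebra1[OF X])
qed

lemma alg_loc: "Locations i \<in> A \<Longrightarrow> loc V i j \<in> borel_measurable (alg A)"
proof -
  assume "Locations i \<in> A"
  then have "(\<lambda>\<omega> j. loc V i j \<omega>) \<in> alg A \<rightarrow>\<^sub>M PiM UNIV (\<lambda>_. borel)"
    by (rule source_alg) (auto simp: space_PiM)
  from measurable_compose[OF this measurable_component_singleton[of j]] show ?thesis by simp
qed

lemma alg_fading: "Fading i j \<in> A \<Longrightarrow> fading V i j \<in> borel_measurable (alg A)"
  by (erule source_alg) auto

lemma alg_stores: "Storage j \<in> A \<Longrightarrow> stores V n j \<in> alg A \<rightarrow>\<^sub>M count_space UNIV"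
  by (erule source_alg) auto

lemma alg_active: "Activity j \<in> A \<Longrightarrow> active V j \<in> alg A \<rightarrow>\<^sub>M count_space UNIV"
  by (erule source_alg) auto

lemma alg_load: "Load \<in> A \<Longrightarrow> load V Helper \<in> alg A \<rightarrow>\<^sub>M count_space UNIV"
  by (erule source_alg) auto

text \<open>Each \<open>source_events\<close> family is a sigma-algebra and hence
  intersection-stable, so independence passes to the sigma-algebras of disjoint groups. The two
  groups are indexed by a Boolean.\<close>

lemma alg_indep:
  assumes AB: "A \<inter> B = {}" and a: "a \<in> sets (alg A)" and b: "b \<in> sets (alg B)"
  shows "prob (a \<inter> b) = prob a * prob b"
proof -
  define I where "I = (\<lambda>c. if c then A else B)"
  have "indep_sets (source_events M V n Helper) UNIV"
    using net n by (simp add: cache_network_def)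
  then have "indep_sets (source_events M V n Helper) (\<Union>j\<in>UNIV. I j)"
    by (rule indep_sets_mono_index[rotated]) simp
  then have "indep_sets (\<lambda>j. sigma_sets (space M) (\<Union>i\<in>I j. source_events M V n Helper i)) UNIV"
  proof (rule indep_sets_collect_sigma)
    show "Int_stable (source_events M V n Helper s)" for s
      by (cases s) (auto intro: sets.Int_stable)
    show "disjoint_family_on I UNIV"
      using AB by (auto simp: disjoint_family_on_def I_def)
  qed
  from indep_setsD[OF this, of UNIV "\<lambda>c. if c then a else b"] show ?thesis
    using a b by (simp add: sets_alg I_def UNIV_bool mult.commute Int_commute)
qed

lemma decouple:
  assumes "A \<inter> B = {}" "case_prod f \<in> borel_measurable (alg A \<Otimes>\<^sub>M alg B)"
  shows "(\<integral>\<^sup>+\<omega>. f \<omega> \<omega> \<partial>M) = (\<integral>\<^sup>+\<omega>. (\<integral>\<^sup>+\<omega>'. f \<omega> \<omega>' \<partial>M) \<partial>M)"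
  using assms by (intro nn_integral_decouple[OF alg_subalgebra alg_subalgebra] alg_indep) auto

lemma alg_measurable_M: "f \<in> alg A \<rightarrow>\<^sub>M N \<Longrightarrow> f \<in> M \<rightarrow>\<^sub>M N"
  by (rule measurable_from_subalg[OF alg_subalgebra])

lemma nn_integral_indep_mult:
  assumes "A \<inter> B = {}" and f: "f \<in> borel_measurable (alg A)" and g: "g \<in> borel_measurable (alg B)"
  shows "(\<integral>\<^sup>+\<omega>. f \<omega> * g \<omega> \<partial>M) = (\<integral>\<^sup>+\<omega>. f \<omega> \<partial>M) * (\<integral>\<^sup>+\<omega>. g \<omega> \<partial>M)"
proof -
  note [measurable] = f g
  have "(\<integral>\<^sup>+\<omega>. f \<omega> * g \<omega> \<partial>M) = (\<integral>\<^sup>+\<omega>. (\<integral>\<^sup>+\<omega>'. f \<omega> * g \<omega>' \<partial>M) \<partial>M)"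
    by (rule decouple[OF assms(1)]) measurable
  then show ?thesis
    using alg_measurable_M[OF f] alg_measurable_M[OF g] by (simp add: nn_integral_cmult nn_integral_multc)
qed

text \<open>Induction splitting off the last factor; the earlier ones are measurable for the union
  of their groups, which is disjoint from the last group.\<close>

lemma nn_integral_indep_prod:
  fixes A :: "nat \<Rightarrow> source set"
  assumes disj: "disjoint_family A" and f: "\<And>i. f i \<in> borel_measurable (alg (A i))"
  shows "(\<integral>\<^sup>+\<omega>. (\<Prod>i<m. f i \<omega>) \<partial>M) = (\<Prod>i<m. \<integral>\<^sup>+\<omega>. f i \<omega> \<partial>M)"
proof (induction m)
  case 0
  then show ?case by (simp add: emeasure_space_1)
next
  case (Suc m)
  have mono: "f i \<in> borel_measurable (alg (\<Union>i<m. A i))" if "i < m" for i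
  proof (rule measurable_from_subalg[OF _ f])
    show "subalgebra (alg (\<Union>i<m. A i)) (alg (A i))"
      unfolding subalgebra_def sets_alg by (intro conjI sigma_sets_subseteq) (use that in auto)
  qed
  have "(\<integral>\<^sup>+\<omega>. (\<Prod>i<m. f i \<omega>) * f m \<omega> \<partial>M) = (\<integral>\<^sup>+\<omega>. (\<Prod>i<m. f i \<omega>) \<partial>M) * (\<integral>\<^sup>+\<omega>. f m \<omega> \<partial>M)"
  proof (rule nn_integral_indep_mult)
    show "(\<Union>i<m. A i) \<inter> A m = {}"
    proof -
      have "A i \<inter> A m = {}" if "i < m" for i
        using disj that by (auto simp: disjoint_family_on_def)
      then show ?thesis by auto
    qed
    show "(\<lambda>\<omega>. \<Prod>i<m. f i \<omega>) \<in> borel_measurable (alg (\<Union>i<m. A i))"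
      using mono by (intro borel_measurable_prod_ennreal) auto
  qed (rule f)
  with Suc show ?case by simp
qed

text \<open>Partial products decrease and are at most 1, so monotone convergence from above applies.
  The bounds on f are demanded everywhere, which explains the absolute values around the fading in
  the applications: it is positive only almost surely.\<close>

lemma nn_integral_pprod:
  fixes A :: "nat \<Rightarrow> source set"
  assumes disj: "disjoint_family A" and f: "\<And>i. f i \<in> borel_measurable (alg (A i))"
    and f01: "\<And>i \<omega>. 0 \<le> f i \<omega>" "\<And>i \<omega>. f i \<omega> \<le> 1"
    and e: "\<And>i. (\<integral>\<^sup>+\<omega>. ennreal (f i \<omega>) \<partial>M) = ennreal (e i)" "\<And>i. 0 \<le> e i"
  shows "(\<integral>\<^sup>+\<omega>. pprod (\<lambda>i. f i \<omega>) \<partial>M) = pprod e"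
proof -
  note [measurable] = alg_measurable_M[OF f]
  have "(\<integral>\<^sup>+\<omega>. pprod (\<lambda>i. f i \<omega>) \<partial>M) = (INF m. \<integral>\<^sup>+\<omega>. ennreal (\<Prod>i<m. f i \<omega>) \<partial>M)"
    unfolding pprod_def
  proof (rule nn_integral_monotone_convergence_INF_decseq[where i = 0])
    show "decseq (\<lambda>m \<omega>. ennreal (\<Prod>i<m. f i \<omega>))"
    proof (rule decseq_SucI, rule le_funI)
      fix m \<omega>
      show "ennreal (\<Prod>i<Suc m. f i \<omega>) \<le> ennreal (\<Prod>i<m. f i \<omega>)"
        by (rule decseq_SucD[OF pprod_decseq]) (rule f01)+
    qed
  qed (auto simp: emeasure_space_1)
  moreover have "(\<integral>\<^sup>+\<omega>. ennreal (\<Prod>i<m. f i \<omega>) \<partial>M) = ennreal (\<Prod>i<m. e i)" for m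
  proof -
    have "(\<integral>\<^sup>+\<omega>. ennreal (\<Prod>i<m. f i \<omega>) \<partial>M) = (\<integral>\<^sup>+\<omega>. (\<Prod>i<m. ennreal (f i \<omega>)) \<partial>M)"
      using f01 by (simp add: prod_ennreal)
    also have "\<dots> = (\<Prod>i<m. ennreal (e i))"
      unfolding e(1)[symmetric] by (intro nn_integral_indep_prod[OF disj] measurable_compose[OF f measurable_ennreal])
    finally show ?thesis using e(2) by (simp add: prod_ennreal)
  qed
  ultimately show ?thesis by (simp add: pprod_def)
qed

end

subsection \<open>Averaging over the marks\<close>

context cache_net
begin

lemma alg_mono_subalgebra: "A \<subseteq> B \<Longrightarrow> subalgebra (alg B) (alg A)"
  unfolding subalgebra_def sets_alg by (intro conjI sigma_sets_subseteq) auto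

section \<open>Transforms and moments of the fading\<close>

lemma fading_measurable [measurable]: "fading V i j \<in> borel_measurable M"
  using distributed_measurable[OF fading_distr, of i j] by simp

lemma prob_fading_ge:
  assumes "0 \<le> s"
  shows "(\<integral>\<^sup>+\<omega>. of_bool (s \<le> fading V i j \<omega>) \<partial>M) = ennreal (exp (- s))"
proof -
  have "(\<integral>\<^sup>+\<omega>. of_bool (s \<le> fading V i j \<omega>) \<partial>M) = (\<integral>\<^sup>+x. ennreal (exponential_density 1 x) * of_bool (s \<le> x) \<partial>lborel)"
    by (rule distributed_nn_integral[OF fading_distr, symmetric]) measurable
  \<comment> \<open>The tail formula used below is for the strict inequality; with a density, single
    points do not count.\<close>
  also have "\<dots> = (\<integral>\<^sup>+x. ennreal (exponential_density 1 x) * of_bool (s < x) \<partial>lborel)"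
    by (rule nn_integral_cong_AE, use AE_lborel_singleton[of s] in eventually_elim) auto
  also have "\<dots> = (\<integral>\<^sup>+\<omega>. of_bool (s < fading V i j \<omega>) \<partial>M)"
    by (rule distributed_nn_integral[OF fading_distr]) measurable
  also have "\<dots> = (\<integral>\<^sup>+\<omega>. indicator {\<omega> \<in> space M. s < fading V i j \<omega>} \<omega> \<partial>M)"
    by (intro nn_integral_cong) (simp add: indicator_def)
  also have "\<dots> = ennreal (exp (- s))"
    using exponential_distributedD_gt[OF fading_distr[of i j] assms] by (simp add: emeasure_eq_measure)
  finally show ?thesis .
qed

lemma AE_fading_pos: "AE \<omega> in M. 0 < fading V i j \<omega>"
  using exponential_distributedD_gt[OF fading_distr[of i j] order.refl]
  by (subst prob_Collect_eq_1[symmetric]) auto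

text \<open>Exponential tilting: the density of rate 1 times exp (-t x) is 1 / (1 + t) times the
  density of rate 1 + t.\<close>

lemma nn_integral_fading_exp:
  assumes t: "0 \<le> t"
  shows "(\<integral>\<^sup>+\<omega>. ennreal (exp (- (t * \<bar>fading V i j \<omega>\<bar>))) \<partial>M) = ennreal (1 / (1 + t))"
proof -
  interpret E: prob_space "density lborel (exponential_density (1 + t))"
    using t by (intro prob_space_exponential_density) simp
  have one: "(\<integral>\<^sup>+x. ennreal (exponential_density (1 + t) x) \<partial>lborel) = 1"
    using E.emeasure_space_1 by (simp add: emeasure_density)
  have "(\<integral>\<^sup>+\<omega>. ennreal (exp (- (t * \<bar>fading V i j \<omega>\<bar>))) \<partial>M) =
      (\<integral>\<^sup>+x. ennreal (exponential_density 1 x) * ennreal (exp (- (t * \<bar>x\<bar>))) \<partial>lborel)"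
    by (rule distributed_nn_integral[OF fading_distr, symmetric]) measurable
  also have "\<dots> = (\<integral>\<^sup>+x. ennreal (1 / (1 + t)) * ennreal (exponential_density (1 + t) x) \<partial>lborel)"
  proof (intro nn_integral_cong)
    fix x
    have "exponential_density 1 x * exp (- (t * \<bar>x\<bar>)) = 1 / (1 + t) * exponential_density (1 + t) x"
    proof (cases "x < 0")
      case False
      then have "exponential_density 1 x * exp (- (t * \<bar>x\<bar>)) = exp (- x * (1 + t))"
        by (simp add: exponential_density_def exp_add[symmetric] algebra_simps)
      then show ?thesis using False t by (simp add: exponential_density_def)
    qed (simp add: exponential_density_def)
    then show "ennreal (exponential_density 1 x) * ennreal (exp (- (t * \<bar>x\<bar>))) =
        ennreal (1 / (1 + t)) * ennreal (exponential_density (1 + t) x)"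
      using t by (simp add: ennreal_mult[symmetric])
  qed
  also have "\<dots> = ennreal (1 / (1 + t))"
    by (subst nn_integral_cmult) (simp_all add: one)
  finally show ?thesis .
qed

text \<open>Any bound uniform in the index makes the weighted series converge. The 4 comes from x <=
  2 exp (x/2): thus x exp (-x) <= 2 exp (-x/2), which is 4 times the density of rate 1/2.\<close>

lemma nn_integral_fading_le: "(\<integral>\<^sup>+\<omega>. ennreal \<bar>fading V i j \<omega>\<bar> \<partial>M) \<le> 4"
proof -
  interpret E: prob_space "density lborel (exponential_density (1 / 2))"
    by (intro prob_space_exponential_density) simp
  have one: "(\<integral>\<^sup>+x. ennreal (exponential_density (1 / 2) x) \<partial>lborel) = 1"
    using E.emeasure_space_1 by (simp add: emeasure_density)
  have "(\<integral>\<^sup>+\<omega>. ennreal \<bar>fading V i j \<omega>\<bar> \<partial>M) = (\<integral>\<^sup>+x. ennreal (exponential_density 1 x) * ennreal \<bar>x\<bar> \<partial>lborel)"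
    by (rule distributed_nn_integral[OF fading_distr, symmetric]) measurable
  also have "\<dots> \<le> (\<integral>\<^sup>+x. ennreal 4 * ennreal (exponential_density (1 / 2) x) \<partial>lborel)"
  proof (intro nn_integral_mono)
    fix x :: real
    have "exp (- x) * x \<le> 2 * exp (- x / 2)"
    proof -
      have "x / 2 \<le> exp (x / 2)" using exp_ge_add_one_self[of "x / 2"] by linarith
      then have "exp (- x) * x \<le> exp (- x) * (2 * exp (x / 2))" by (intro mult_left_mono) auto
      also have "\<dots> = 2 * exp (- x / 2)" by (simp add: exp_add[symmetric])
      finally show ?thesis .
    qed
    then show "ennreal (exponential_density 1 x) * ennreal \<bar>x\<bar> \<le> ennreal 4 * ennreal (exponential_density (1 / 2) x)"
      by (subst (1 2) ennreal_mult[symmetric]) (auto simp: exponential_density_def intro!: ennreal_leI)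
  qed
  also have "\<dots> = 4"
    by (subst nn_integral_cmult) (simp_all add: one)
  finally show ?thesis .
qed

lemma AE_summable_fading:
  assumes t: "summable t" "\<And>i. 0 \<le> t i"
  shows "AE \<omega> in M. (\<Sum>i. ennreal (t i * \<bar>fading V k i \<omega>\<bar>)) \<noteq> \<top>"
proof -
  have "(\<integral>\<^sup>+\<omega>. (\<Sum>i. ennreal (t i * \<bar>fading V k i \<omega>\<bar>)) \<partial>M) = (\<Sum>i. ennreal (t i) * (\<integral>\<^sup>+\<omega>. ennreal \<bar>fading V k i \<omega>\<bar> \<partial>M))"
    using t by (simp add: nn_integral_suminf ennreal_mult nn_integral_cmult)
  also have "\<dots> \<le> (\<Sum>i. ennreal (t i) * 4)"
    by (intro suminf_le summableI mult_left_mono nn_integral_fading_le) auto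
  also have "\<dots> = ennreal (suminf t) * 4"
    using t by (simp add: suminf_ennreal2)
  also have "\<dots> < \<top>" by (simp add: ennreal_mult_less_top)
  finally have fin: "(\<integral>\<^sup>+\<omega>. (\<Sum>i. ennreal (t i * \<bar>fading V k i \<omega>\<bar>)) \<partial>M) \<noteq> \<infinity>" by simp
  have "(\<lambda>\<omega>. \<Sum>i. ennreal (t i * \<bar>fading V k i \<omega>\<bar>)) \<in> borel_measurable M" by measurable
  from nn_integral_noteq_infinite[OF this fin] show ?thesis by simp
qed

text \<open>Here z is an exclusion radius and r the distance of a competitor; the flag chooses how
  ties are treated.\<close>

definition admissible :: "bool \<Rightarrow> real \<Rightarrow> real \<Rightarrow> bool" where
  "admissible st z r \<longleftrightarrow> (if st then z < r else z \<le> r)"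

lemma admissible_measurable [measurable (raw)]:
  assumes [measurable]: "f \<in> borel_measurable N" "g \<in> borel_measurable N"
  shows "Measurable.pred N (\<lambda>x. admissible st (f x) (g x))"
  unfolding admissible_def by measurable

text \<open>Apart from positivity of \<open>p_Lp\<close>, the bounds hold because the model realises
  these numbers as probabilities.\<close>

lemma p_bounds: "0 < p_Lp S" "p_Lp S \<le> 1" "0 \<le> p_act S" "p_act S \<le> 1"
proof -
  show "0 < p_Lp S" using valid by (auto simp: valid_params_def p_Lp_def)
  show "p_Lp S \<le> 1" using prob_stores[of 0] prob_le_1 by metis
  show "0 \<le> p_act S" "p_act S \<le> 1" using prob_active[of 0] prob_le_1 measure_nonneg by metis+
qed

lemma nn_integral_stores: "(\<integral>\<^sup>+\<omega>. of_bool (stores V n i \<omega>) \<partial>M) = ennreal (p_Lp S)"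
proof -
  note [measurable] = stores_measurable[of i]
  have "(\<integral>\<^sup>+\<omega>. of_bool (stores V n i \<omega>) \<partial>M) = (\<integral>\<^sup>+\<omega>. indicator {\<omega> \<in> space M. stores V n i \<omega>} \<omega> \<partial>M)"
    by (intro nn_integral_cong) (simp add: indicator_def)
  then show ?thesis by (simp add: emeasure_eq_measure prob_stores)
qed

lemma nn_integral_stores_imp:
  "(\<integral>\<^sup>+\<omega>. ennreal (of_bool (stores V n i \<omega> \<longrightarrow> Q)) \<partial>M) = ennreal (p_Lp S * of_bool Q + (1 - p_Lp S))"
proof -
  note [measurable] = stores_measurable[of i]
  have "(\<integral>\<^sup>+\<omega>. ennreal (of_bool (stores V n i \<omega> \<longrightarrow> Q)) \<partial>M) =
      (\<integral>\<^sup>+\<omega>. indicator {\<omega> \<in> space M. stores V n i \<omega> \<longrightarrow> Q} \<omega> \<partial>M)"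
    by (intro nn_integral_cong) (simp add: indicator_def)
  also have "\<dots> = ennreal (prob {\<omega> \<in> space M. stores V n i \<omega> \<longrightarrow> Q})"
    by (simp add: emeasure_eq_measure)
  also have "prob {\<omega> \<in> space M. stores V n i \<omega> \<longrightarrow> Q} = p_Lp S * of_bool Q + (1 - p_Lp S)"
    using prob_stores[of i] prob_neg[of "stores V n i"] by (cases Q) (simp_all add: prob_space)
  finally show ?thesis .
qed

lemma nn_integral_not_active: "(\<integral>\<^sup>+\<omega>. of_bool (\<not> active V i \<omega>) \<partial>M) = ennreal (1 - p_act S)"
  "(\<integral>\<^sup>+\<omega>. of_bool (active V i \<omega>) \<partial>M) = ennreal (p_act S)"
proof -
  note [measurable] = active_measurable[of i]
  have "(\<integral>\<^sup>+\<omega>. of_bool (\<not> active V i \<omega>) \<partial>M) = (\<integral>\<^sup>+\<omega>. indicator {\<omega> \<in> space M. \<not> active V i \<omega>} \<omega> \<partial>M)"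
    "(\<integral>\<^sup>+\<omega>. of_bool (active V i \<omega>) \<partial>M) = (\<integral>\<^sup>+\<omega>. indicator {\<omega> \<in> space M. active V i \<omega>} \<omega> \<partial>M)"
    by (intro nn_integral_cong, simp add: indicator_def)+
  then show "(\<integral>\<^sup>+\<omega>. of_bool (\<not> active V i \<omega>) \<partial>M) = ennreal (1 - p_act S)"
    "(\<integral>\<^sup>+\<omega>. of_bool (active V i \<omega>) \<partial>M) = ennreal (p_act S)"
    using prob_neg[of "active V i"] by (simp_all add: emeasure_eq_measure prob_active)
qed

text \<open>Storage, activity and fading of one helper are independent. An active interferer loses t
  / (1 + t); averaging over activity multiplies this loss by \<open>p_act\<close>.\<close>

lemma nn_integral_helper_factor:
  assumes t: "0 \<le> t"
  shows "(\<integral>\<^sup>+\<omega>. ennreal (of_bool (stores V n i \<omega> \<longrightarrow> Q) *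
      (if active V i \<omega> then exp (- (t * \<bar>fading V k i \<omega>\<bar>)) else 1)) \<partial>M) =
    ennreal ((p_Lp S * of_bool Q + (1 - p_Lp S)) * (1 - p_act S * (t / (1 + t))))"
proof -
  let ?A = "{Storage i}" and ?B = "{Activity i, Fading k i}"
  note [measurable] = alg_stores[of i ?A] alg_active[of i ?B] alg_fading[of k i ?B]
  let ?f = "\<lambda>\<omega>. ennreal (of_bool (stores V n i \<omega> \<longrightarrow> Q))"
  let ?g = "\<lambda>\<omega>. ennreal (if active V i \<omega> then exp (- (t * \<bar>fading V k i \<omega>\<bar>)) else 1)"
  let ?h = "\<lambda>\<omega>. ennreal (exp (- (t * \<bar>fading V k i \<omega>\<bar>)))"
  have g: "(\<integral>\<^sup>+\<omega>. ?g \<omega> \<partial>M) = ennreal (1 - p_act S * (t / (1 + t)))"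
  proof -
    have [measurable]: "active V i \<in> M \<rightarrow>\<^sub>M count_space UNIV" by (rule active_measurable)
    have "(\<integral>\<^sup>+\<omega>. ?g \<omega> \<partial>M) = (\<integral>\<^sup>+\<omega>. of_bool (active V i \<omega>) * ?h \<omega> + of_bool (\<not> active V i \<omega>) \<partial>M)"
      by (intro nn_integral_cong) simp
    also have "\<dots> = (\<integral>\<^sup>+\<omega>. of_bool (active V i \<omega>) * ?h \<omega> \<partial>M) + (\<integral>\<^sup>+\<omega>. of_bool (\<not> active V i \<omega>) \<partial>M)"
      by (rule nn_integral_add) measurable
    also have "(\<integral>\<^sup>+\<omega>. of_bool (active V i \<omega>) * ?h \<omega> \<partial>M) = (\<integral>\<^sup>+\<omega>. of_bool (active V i \<omega>) \<partial>M) * (\<integral>\<^sup>+\<omega>. ?h \<omega> \<partial>M)"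
    proof (rule nn_integral_indep_mult[of "{Activity i}" "{Fading k i}"])
      note [measurable] = alg_active[of i "{Activity i}"] alg_fading[of k i "{Fading k i}"]
      show "(\<lambda>\<omega>. of_bool (active V i \<omega>)) \<in> borel_measurable (alg {Activity i})"
        "?h \<in> borel_measurable (alg {Fading k i})" by measurable
    qed simp
    also have "\<dots> + (\<integral>\<^sup>+\<omega>. of_bool (\<not> active V i \<omega>) \<partial>M) = ennreal (p_act S * (1 / (1 + t)) + (1 - p_act S))"
      using t p_bounds unfolding nn_integral_not_active nn_integral_fading_exp[OF t]
      by (simp add: ennreal_mult[symmetric] ennreal_plus[symmetric] del: ennreal_plus)
    also have "p_act S * (1 / (1 + t)) + (1 - p_act S) = 1 - p_act S * (t / (1 + t))"
      using t by (simp add: field_simps)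
    finally show ?thesis .
  qed
  have "t / (1 + t) \<le> 1" using t by (simp add: field_simps)
  then have "p_act S * (t / (1 + t)) \<le> 1" using p_bounds t by (intro mult_le_one) auto
  then have "(\<integral>\<^sup>+\<omega>. ?f \<omega> \<partial>M) * (\<integral>\<^sup>+\<omega>. ?g \<omega> \<partial>M) =
      ennreal ((p_Lp S * of_bool Q + (1 - p_Lp S)) * (1 - p_act S * (t / (1 + t))))"
    unfolding g nn_integral_stores_imp using p_bounds by (intro ennreal_mult[symmetric]) auto
  moreover have "(\<integral>\<^sup>+\<omega>. ?f \<omega> * ?g \<omega> \<partial>M) = (\<integral>\<^sup>+\<omega>. ?f \<omega> \<partial>M) * (\<integral>\<^sup>+\<omega>. ?g \<omega> \<partial>M)"
    by (rule nn_integral_indep_mult[of ?A ?B]) (simp, measurable)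
  ultimately show ?thesis by (simp add: ennreal_mult)
qed

text \<open>Given the locations, the mark conditions factorise: \<open>Fading Helper j\<close> is integrated out
  first and turns the interference into a product of Laplace factors.\<close>

lemma nn_integral_marks:
  fixes tM tH :: "nat \<Rightarrow> real" and Q :: "nat \<Rightarrow> bool"
  assumes tM: "summable tM" "\<And>i. 0 \<le> tM i" and tH: "summable tH" "\<And>i. 0 \<le> tH i" and K: "0 \<le> K"
  shows "(\<integral>\<^sup>+\<omega>. of_bool (stores V n j \<omega> \<and> (\<forall>i. i \<noteq> j \<longrightarrow> stores V n i \<omega> \<longrightarrow> Q i) \<and>
      K + (\<Sum>i. tM i * fading V Macro i \<omega>) + (\<Sum>i. if i \<noteq> j \<and> active V i \<omega> then tH i * fading V Helper i \<omega> else 0)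
        \<le> fading V Helper j \<omega>) \<partial>M)
    = ennreal (p_Lp S * exp (- K)) * pprod (\<lambda>i. 1 / (1 + tM i)) *
      pprod (\<lambda>i. if i = j then 1 else (p_Lp S * of_bool (Q i) + (1 - p_Lp S)) * (1 - p_act S * (tH i / (1 + tH i))))"
proof -
  let ?U = "\<lambda>\<omega>. \<Sum>i. tM i * fading V Macro i \<omega>"
  let ?T = "\<lambda>\<omega>. \<Sum>i. if i \<noteq> j \<and> active V i \<omega> then tH i * fading V Helper i \<omega> else 0"
  let ?s = "\<lambda>\<omega>. K + ?U \<omega> + ?T \<omega>"
  let ?v = "\<lambda>\<omega>. of_bool (stores V n j \<omega> \<and> (\<forall>i. i \<noteq> j \<longrightarrow> stores V n i \<omega> \<longrightarrow> Q i)) :: ennreal"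
  \<comment> \<open>All sources but the fading of helper j. The threshold \<open>?s\<close> is
    measurable for them because the helper series leaves out i = j.\<close>
  let ?B = "- {Fading Helper j}"
  let ?fM = "\<lambda>i \<omega>. exp (- (tM i * \<bar>fading V Macro i \<omega>\<bar>))"
  let ?fH = "\<lambda>i \<omega>. if i = j then 1 else of_bool (stores V n i \<omega> \<longrightarrow> Q i) *
      (if active V i \<omega> then exp (- (tH i * \<bar>fading V Helper i \<omega>\<bar>)) else 1)"
  have [measurable]: "stores V n i \<in> alg ?B \<rightarrow>\<^sub>M count_space UNIV"
    "active V i \<in> alg ?B \<rightarrow>\<^sub>M count_space UNIV" "fading V Macro i \<in> borel_measurable (alg ?B)" for i
    by (auto intro: alg_stores alg_active alg_fading)
  have [measurable]: "(\<lambda>\<omega>. if i \<noteq> j \<and> active V i \<omega> then tH i * fading V Helper i \<omega> else 0) \<in> borel_measurable (alg ?B)" for i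
  proof (cases "i = j")
    case False
    then have [measurable]: "fading V Helper i \<in> borel_measurable (alg ?B)" by (auto intro: alg_fading)
    show ?thesis by measurable
  qed simp
  have s_meas [measurable]: "?s \<in> borel_measurable (alg ?B)" by measurable
  have v_meas [measurable]: "?v \<in> borel_measurable (alg ?B)" by measurable
  have h_meas [measurable]: "fading V Helper j \<in> borel_measurable (alg {Fading Helper j})"
    by (auto intro: alg_fading)
  have "AE \<omega> in M. \<forall>i. 0 < fading V Macro i \<omega>" "AE \<omega> in M. \<forall>i. 0 < fading V Helper i \<omega>"
    by (intro AE_all_countable[THEN iffD2] allI AE_fading_pos)+
  with AE_summable_fading[OF tM, of Macro] AE_summable_fading[OF tH, of Helper]
  \<comment> \<open>Holds only almost surely: the product form of the exponential relies on positive
    fading and on convergence of both series.\<close>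
  have AE: "AE \<omega> in M. 0 \<le> ?s \<omega> \<and> ?v \<omega> * ennreal (exp (- ?s \<omega>)) =
      ennreal (exp (- K)) * (of_bool (stores V n j \<omega>) * (pprod (\<lambda>i. ?fM i \<omega>) * pprod (\<lambda>i. ?fH i \<omega>)))"
  proof eventually_elim
    fix \<omega>
    assume M: "(\<Sum>i. ennreal (tM i * \<bar>fading V Macro i \<omega>\<bar>)) \<noteq> \<top>" and H: "(\<Sum>i. ennreal (tH i * \<bar>fading V Helper i \<omega>\<bar>)) \<noteq> \<top>"
      and posM: "\<forall>i. 0 < fading V Macro i \<omega>" and posH: "\<forall>i. 0 < fading V Helper i \<omega>"
    let ?a = "\<lambda>i. tM i * fading V Macro i \<omega>"
    let ?b = "\<lambda>i. if i \<noteq> j \<and> active V i \<omega> then tH i * fading V Helper i \<omega> else 0"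
    have absM: "\<bar>fading V Macro i \<omega>\<bar> = fading V Macro i \<omega>" and absH: "\<bar>fading V Helper i \<omega>\<bar> = fading V Helper i \<omega>" for i
      using posM posH by (auto simp: less_imp_le)
    have a0: "0 \<le> ?a i" and b0: "0 \<le> ?b i" and h0: "0 \<le> tH i * fading V Helper i \<omega>" for i
      using tM(2)[of i] tH(2)[of i] posM[rule_format, of i] posH[rule_format, of i] by auto
    have sa: "summable ?a" using M a0 unfolding absM by (intro summable_suminf_not_top) auto
    have "summable (\<lambda>i. tH i * fading V Helper i \<omega>)" using H h0 unfolding absH by (intro summable_suminf_not_top) auto
    then have sb: "summable ?b"
      by (rule summable_comparison_test'[where N = 0]) (use h0 in auto)
    have "0 \<le> ?U \<omega>" "0 \<le> ?T \<omega>" using suminf_nonneg[OF sa a0] suminf_nonneg[OF sb b0] by auto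
    moreover have U: "ennreal (exp (- ?U \<omega>)) = pprod (\<lambda>i. ?fM i \<omega>)"
      unfolding absM using pprod_exp[OF sa a0] by simp
    have T: "?v \<omega> * ennreal (exp (- ?T \<omega>)) = of_bool (stores V n j \<omega>) * pprod (\<lambda>i. ?fH i \<omega>)"
    proof -
      \<comment> \<open>The storage condition of helper i is merged with its Laplace factor, so that
        the factor with index i depends on the sources of helper i alone.\<close>
      have "pprod (\<lambda>i. ?fH i \<omega>) = pprod (\<lambda>i. of_bool (i \<noteq> j \<longrightarrow> stores V n i \<omega> \<longrightarrow> Q i) * exp (- ?b i))"
        by (intro arg_cong[of _ _ pprod] ext) (auto simp: absH)
      also have "\<dots> = pprod (\<lambda>i. of_bool (i \<noteq> j \<longrightarrow> stores V n i \<omega> \<longrightarrow> Q i)) * pprod (\<lambda>i. exp (- ?b i))"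
        using b0 by (intro pprod_mult) (simp_all add: le_diff_eq)
      also have "\<dots> = of_bool (\<forall>i. i \<noteq> j \<longrightarrow> stores V n i \<omega> \<longrightarrow> Q i) * ennreal (exp (- ?T \<omega>))"
        unfolding pprod_of_bool pprod_exp[OF sb b0] ..
      finally show ?thesis by (simp add: of_bool_conj mult.assoc)
    qed
    have "ennreal (exp (- ?s \<omega>)) = ennreal (exp (- K)) * ennreal (exp (- ?U \<omega>)) * ennreal (exp (- ?T \<omega>))"
      by (simp add: ennreal_mult[symmetric] exp_add[symmetric])
    then have "?v \<omega> * ennreal (exp (- ?s \<omega>)) = ennreal (exp (- K)) * (ennreal (exp (- ?U \<omega>)) * (?v \<omega> * ennreal (exp (- ?T \<omega>))))"
      by (simp only: mult_ac)
    then have "?v \<omega> * ennreal (exp (- ?s \<omega>)) =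
        ennreal (exp (- K)) * (of_bool (stores V n j \<omega>) * (pprod (\<lambda>i. ?fM i \<omega>) * pprod (\<lambda>i. ?fH i \<omega>)))"
      unfolding U T by (simp only: mult_ac)
    ultimately show "0 \<le> ?s \<omega> \<and> ?v \<omega> * ennreal (exp (- ?s \<omega>)) =
      ennreal (exp (- K)) * (of_bool (stores V n j \<omega>) * (pprod (\<lambda>i. ?fM i \<omega>) * pprod (\<lambda>i. ?fH i \<omega>)))"
      using K by linarith
  qed
  let ?SM = "\<Union>i. {Fading Macro i}"
  \<comment> \<open>The empty group at i = j matches the constant factor 1 and keeps
    \<open>Storage j\<close> free for the separate storage factor.\<close>
  let ?AH = "\<lambda>i. if i = j then {} else {Storage i, Activity i, Fading Helper i}"
  let ?SH = "\<Union>i. ?AH i"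
  have fM_alg: "?fM i \<in> borel_measurable (alg {Fading Macro i})" for i
  proof -
    note [measurable] = alg_fading[of Macro i "{Fading Macro i}"]
    show ?thesis by measurable
  qed
  have fH_alg: "?fH i \<in> borel_measurable (alg (?AH i))" for i
  proof (cases "i = j")
    case False
    note [measurable] = alg_fading[of Helper i "{Storage i, Activity i, Fading Helper i}"]
      alg_stores[of i "{Storage i, Activity i, Fading Helper i}"] alg_active[of i "{Storage i, Activity i, Fading Helper i}"]
    from False show ?thesis by simp
  qed simp
  have pM_alg: "(\<lambda>\<omega>. pprod (\<lambda>i. ?fM i \<omega>)) \<in> borel_measurable (alg ?SM)"
    by (intro pprod_measurable measurable_from_subalg[OF alg_mono_subalgebra fM_alg]) auto
  have pH_alg: "(\<lambda>\<omega>. pprod (\<lambda>i. ?fH i \<omega>)) \<in> borel_measurable (alg ?SH)"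
    by (intro pprod_measurable measurable_from_subalg[OF alg_mono_subalgebra fH_alg]) blast
  have st_alg: "(\<lambda>\<omega>. of_bool (stores V n j \<omega>) :: ennreal) \<in> borel_measurable (alg {Storage j})"
  proof -
    note [measurable] = alg_stores[of j "{Storage j}"]
    show ?thesis by measurable
  qed
  have pMH_alg: "(\<lambda>\<omega>. pprod (\<lambda>i. ?fM i \<omega>) * pprod (\<lambda>i. ?fH i \<omega>)) \<in> borel_measurable (alg (?SM \<union> ?SH))"
    by (intro borel_measurable_times_ennreal
        measurable_from_subalg[OF alg_mono_subalgebra pM_alg] measurable_from_subalg[OF alg_mono_subalgebra pH_alg]) auto
  have "(\<integral>\<^sup>+\<omega>. of_bool (stores V n j \<omega> \<and> (\<forall>i. i \<noteq> j \<longrightarrow> stores V n i \<omega> \<longrightarrow> Q i) \<and> ?s \<omega> \<le> fading V Helper j \<omega>) \<partial>M) =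
      (\<integral>\<^sup>+\<omega>. ?v \<omega> * of_bool (?s \<omega> \<le> fading V Helper j \<omega>) \<partial>M)"
    by (intro nn_integral_cong) simp
  also have "\<dots> = (\<integral>\<^sup>+\<omega>. (\<integral>\<^sup>+\<omega>'. ?v \<omega> * of_bool (?s \<omega> \<le> fading V Helper j \<omega>') \<partial>M) \<partial>M)"
  proof (rule decouple)
    have pm: "(\<lambda>(\<omega>, \<omega>'). v \<omega> * of_bool (s \<omega> \<le> g \<omega>')) \<in> borel_measurable (F \<Otimes>\<^sub>M G)"
      if [measurable]: "v \<in> borel_measurable F" "s \<in> borel_measurable F" "g \<in> borel_measurable G"
      for v :: "'w \<Rightarrow> ennreal" and s g :: "'w \<Rightarrow> real" and F G
      by measurable
    show "(\<lambda>(\<omega>, \<omega>'). ?v \<omega> * of_bool (?s \<omega> \<le> fading V Helper j \<omega>')) \<in> borel_measurable (alg ?B \<Otimes>\<^sub>M alg {Fading Helper j})"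
      by (rule pm[OF v_meas s_meas h_meas])
  qed auto
  also have "\<dots> = (\<integral>\<^sup>+\<omega>. ennreal (exp (- K)) * (of_bool (stores V n j \<omega>) * (pprod (\<lambda>i. ?fM i \<omega>) * pprod (\<lambda>i. ?fH i \<omega>))) \<partial>M)"
  proof (rule nn_integral_cong_AE, use AE in eventually_elim)
    fix \<omega> assume *: "0 \<le> ?s \<omega> \<and> ?v \<omega> * ennreal (exp (- ?s \<omega>)) =
      ennreal (exp (- K)) * (of_bool (stores V n j \<omega>) * (pprod (\<lambda>i. ?fM i \<omega>) * pprod (\<lambda>i. ?fH i \<omega>)))"
    have "(\<integral>\<^sup>+\<omega>'. ?v \<omega> * of_bool (?s \<omega> \<le> fading V Helper j \<omega>') \<partial>M) = ?v \<omega> * ennreal (exp (- ?s \<omega>))"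
      by (subst nn_integral_cmult) (simp, simp only: prob_fading_ge[OF conjunct1[OF *]])
    with * show "(\<integral>\<^sup>+\<omega>'. ?v \<omega> * of_bool (?s \<omega> \<le> fading V Helper j \<omega>') \<partial>M) =
      ennreal (exp (- K)) * (of_bool (stores V n j \<omega>) * (pprod (\<lambda>i. ?fM i \<omega>) * pprod (\<lambda>i. ?fH i \<omega>)))" by simp
  qed
  also have "\<dots> = ennreal (exp (- K)) * (\<integral>\<^sup>+\<omega>. of_bool (stores V n j \<omega>) * (pprod (\<lambda>i. ?fM i \<omega>) * pprod (\<lambda>i. ?fH i \<omega>)) \<partial>M)"
    by (intro nn_integral_cmult borel_measurable_times_ennreal alg_measurable_M[OF st_alg] alg_measurable_M[OF pMH_alg])
  also have "(\<integral>\<^sup>+\<omega>. of_bool (stores V n j \<omega>) * (pprod (\<lambda>i. ?fM i \<omega>) * pprod (\<lambda>i. ?fH i \<omega>)) \<partial>M) =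
      (\<integral>\<^sup>+\<omega>. of_bool (stores V n j \<omega>) \<partial>M) * (\<integral>\<^sup>+\<omega>. pprod (\<lambda>i. ?fM i \<omega>) * pprod (\<lambda>i. ?fH i \<omega>) \<partial>M)"
    by (rule nn_integral_indep_mult[OF _ st_alg pMH_alg]) auto
  also have "(\<integral>\<^sup>+\<omega>. pprod (\<lambda>i. ?fM i \<omega>) * pprod (\<lambda>i. ?fH i \<omega>) \<partial>M) =
      (\<integral>\<^sup>+\<omega>. pprod (\<lambda>i. ?fM i \<omega>) \<partial>M) * (\<integral>\<^sup>+\<omega>. pprod (\<lambda>i. ?fH i \<omega>) \<partial>M)"
    by (rule nn_integral_indep_mult[OF _ pM_alg pH_alg]) (auto split: if_splits)
  also have "(\<integral>\<^sup>+\<omega>. pprod (\<lambda>i. ?fM i \<omega>) \<partial>M) = pprod (\<lambda>i. 1 / (1 + tM i))"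
    by (rule nn_integral_pprod[where A = "\<lambda>i. {Fading Macro i}"])
      (use tM(2) nn_integral_fading_exp fM_alg in \<open>auto simp: disjoint_family_on_def\<close>)
  also have "(\<integral>\<^sup>+\<omega>. pprod (\<lambda>i. ?fH i \<omega>) \<partial>M) =
      pprod (\<lambda>i. if i = j then 1 else (p_Lp S * of_bool (Q i) + (1 - p_Lp S)) * (1 - p_act S * (tH i / (1 + tH i))))"
  proof (rule nn_integral_pprod[where A = ?AH, OF _ fH_alg])
    show "disjoint_family ?AH" by (auto simp: disjoint_family_on_def)
    show "0 \<le> ?fH i \<omega>" "?fH i \<omega> \<le> 1" for i \<omega> using tH(2)[of i] by auto
    show "(\<integral>\<^sup>+\<omega>. ennreal (?fH i \<omega>) \<partial>M) =
        ennreal (if i = j then 1 else (p_Lp S * of_bool (Q i) + (1 - p_Lp S)) * (1 - p_act S * (tH i / (1 + tH i))))" for i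
      using nn_integral_helper_factor[where t = "tH i" and i = i and Q = "Q i" and k = Helper, OF tH(2)] by (cases "i = j") (simp_all add: emeasure_space_1)
    show "0 \<le> (if i = j then 1 else (p_Lp S * of_bool (Q i) + (1 - p_Lp S)) * (1 - p_act S * (tH i / (1 + tH i))))" for i
    proof -
      have "tH i / (1 + tH i) \<le> 1" using tH(2)[of i] by (simp add: field_simps)
      then have "p_act S * (tH i / (1 + tH i)) \<le> 1" using p_bounds tH(2)[of i] by (intro mult_le_one) auto
      then show ?thesis using p_bounds by auto
    qed
  qed
  finally show ?thesis
    unfolding nn_integral_stores using p_bounds by (simp add: ennreal_mult mult_ac)
qed

end

subsection \<open>Averaging over the locations\<close>

lemma damping_mono:
  assumes "0 \<le> x" "0 \<le> k" "k \<le> k'" "0 \<le> t" "0 \<le> a"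
  shows "damping a x k t \<le> damping a x k' t"
proof -
  define u u' where "u = x * (k / t) powr a" and "u' = x * (k' / t) powr a"
  have "0 \<le> u" "u \<le> u'"
    using assms by (auto simp: u_def u'_def intro!: mult_left_mono powr_mono2 divide_right_mono)
  then have "u / (1 + u) \<le> u' / (1 + u')"
    by (simp add: divide_simps) (simp add: algebra_simps)
  then show ?thesis by (simp add: damping_def u_def u'_def)
qed

lemma damping_eq: "0 \<le> x \<Longrightarrow> 1 - damping a x k t = 1 / (1 + x * (k / t) powr a)"
  by (simp add: damping_def divide_simps) (smt (verit) mult_nonneg_nonneg powr_ge_zero)

text \<open>A circle is a null set. This absorbs ties on the boundary of the exclusion disc as well
  as default values at the origin.\<close>

lemma nn_integral_radial_cong:
  assumes [measurable]: "g \<in> borel_measurable borel" "g' \<in> borel_measurable borel"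
    and eq: "\<And>t. 0 \<le> t \<Longrightarrow> t \<noteq> k \<Longrightarrow> g t = g' t"
  shows "(\<integral>\<^sup>+x. g (norm (x::real^2)) \<partial>lborel) = (\<integral>\<^sup>+x. g' (norm (x::real^2)) \<partial>lborel)"
  unfolding nn_integral_radial[OF assms(1)] nn_integral_radial[OF assms(2)]
  by (rule nn_integral_cong_AE, use AE_lborel_singleton[of k] in eventually_elim)
     (auto simp: eq split: split_indicator)

section \<open>Almost sure regularity of the point process\<close>

lemma (in prob_space) ppp_AE_nonzero:
  assumes X: "homogeneous_ppp M r X"
  shows "AE \<omega> in M. \<forall>j. X j \<omega> \<noteq> 0"
proof -
  have A: "{0::real^2} \<in> sets borel" "bounded {0::real^2}" by auto
  note [measurable] = ppp_count_measurable[OF X A]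
  have "prob {\<omega> \<in> space M. point_count X {0} \<omega> = 0} = 1"
    unfolding ppp_measure_count[OF X A] by simp
  then have "AE \<omega> in M. point_count X {0} \<omega> = 0"
    by (subst (asm) prob_Collect_eq_1) auto
  \<comment> \<open>Finiteness enters because \<open>point_count\<close> is also 0 when infinitely
    many indices hit the set.\<close>
  then show ?thesis
    using ppp_AE_finite[OF X A] by eventually_elim (auto simp: point_count_def)
qed

text \<open>Campbell's formula, that is, the Mecke formula with trivial product, for h(z) = 1 / (1 +
  z^a). This is a bounded decreasing substitute for z^(-a), whose plane integral diverges at the
  origin. The integral of h is that of \<open>damping a 1 1\<close>, which is finite.\<close>

lemma (in prob_space) ppp_AE_summable:
  assumes X: "homogeneous_ppp M r X" and r: "0 < r" and a: "2 < a"
  shows "AE \<omega> in M. summable (\<lambda>i. norm (X i \<omega>) powr (- a))"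
proof -
  note [measurable] = ppp_measurable[OF X]
  define h where "h z = (if z \<le> 0 then 1 else 1 / (1 + z powr a))" for z :: real
  have h_meas [measurable]: "h \<in> borel_measurable borel"
    unfolding h_def[abs_def] by measurable
  have h01: "0 \<le> h z" "h z \<le> 1" for z
    by (auto simp: h_def divide_le_eq_1 add_pos_nonneg)
  have h_anti: "h z' \<le> h z" if "0 \<le> z" "z \<le> z'" for z z'
    using that a powr_mono2[of a z z'] by (auto simp: h_def divide_le_eq_1 add_pos_nonneg intro!: divide_left_mono)
  have "(\<integral>\<^sup>+\<omega>. (\<Sum>j. ennreal (h (norm (X j \<omega>)))) \<partial>M) = ennreal r * (\<integral>\<^sup>+x. ennreal (h (norm x)) \<partial>plane)"
  proof -
    have "(\<integral>\<^sup>+\<omega>. (\<Sum>j. ennreal (h (norm (X j \<omega>))) * pprod (\<lambda>i. if i = j then 1 else 1)) \<partial>M) =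
        ennreal r * (\<integral>\<^sup>+x. ennreal (h (norm x) * exp (- (r * 0))) \<partial>plane)"
      by (rule ppp_mecke_radial[OF X r, where b = "\<lambda>_ _. 1" and \<beta> = "\<lambda>_. 0"])
         (use h01 h_anti in auto)
    moreover have "pprod (\<lambda>i. if i = j then 1 else 1) = 1" for j
      by (simp add: pprod_def)
    ultimately show ?thesis
      by (simp only: mult_1_right mult_zero_right minus_zero exp_zero)
  qed
  also have "(\<integral>\<^sup>+x. ennreal (h (norm x)) \<partial>plane) =
      (\<integral>\<^sup>+x. ennreal (damping a 1 1 (norm x)) \<partial>plane)"
    by (rule nn_integral_radial_cong[where k = 0]) (auto simp: h_def damping_def powr_divide field_simps)
  also have "\<dots> = ennreal (pi * H_fun 1 a)"
    using nn_integral_damping[of a 1 1] a by simp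
  finally have "(\<integral>\<^sup>+\<omega>. (\<Sum>j. ennreal (h (norm (X j \<omega>)))) \<partial>M) \<noteq> \<infinity>"
    by (simp add: ennreal_mult_eq_top_iff)
  moreover have "(\<lambda>\<omega>. \<Sum>j. ennreal (h (norm (X j \<omega>)))) \<in> borel_measurable M" by measurable
  ultimately have "AE \<omega> in M. (\<Sum>j. ennreal (h (norm (X j \<omega>)))) \<noteq> \<infinity>"
    using nn_integral_noteq_infinite by blast
  then show ?thesis
  proof eventually_elim
    fix \<omega> assume "(\<Sum>j. ennreal (h (norm (X j \<omega>)))) \<noteq> \<infinity>"
    then have sum: "summable (\<lambda>j. h (norm (X j \<omega>)))"
      using h01 by (intro summable_suminf_not_top) auto
    from summable_LIMSEQ_zero[OF this]
    have "\<forall>\<^sub>F j in sequentially. h (norm (X j \<omega>)) < 1 / 2"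
      by (rule order_tendstoD) simp
    \<comment> \<open>A value of h below 1/2 means z^a > 1, and then z^(-a) <= 2 h(z).\<close>
    then have "\<forall>\<^sub>F j in sequentially. norm (norm (X j \<omega>) powr (- a)) \<le> 2 * h (norm (X j \<omega>))"
    proof eventually_elim
      fix j assume *: "h (norm (X j \<omega>)) < 1 / 2"
      let ?t = "norm (X j \<omega>)"
      have t: "0 < ?t" using * by (auto simp: h_def split: if_splits)
      then have "1 / (1 + ?t powr a) < 1 / 2" using * by (simp add: h_def)
      then have "1 < ?t powr a" by (simp add: field_simps add_pos_nonneg)
      then show "norm (?t powr (- a)) \<le> 2 * h ?t"
        using t by (simp add: h_def powr_minus field_simps add_pos_nonneg)
    qed
    then show "summable (\<lambda>i. norm (X i \<omega>) powr (- a))"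
      by (rule summable_comparison_test_ev) (intro summable_mult sum)
  qed
qed

context cache_net
begin

section \<open>Events and mean factors for a fixed SINR threshold\<close>

abbreviation rad :: "tier \<Rightarrow> nat \<Rightarrow> 'w \<Rightarrow> real" where
  "rad k i \<omega> \<equiv> norm (loc V k i \<omega>)"

lemma params_pos: "2 < alpha S" "0 < lam S k" "0 < pow S k" "0 < bandw S" "0 < rate0 S" "0 \<le> noise S"
  using valid by (auto simp: valid_params_def)

text \<open>A macro station at distance \<open>rad_ratio * z\<close> has the mean received power of
  a helper at distance z.\<close>

definition rad_ratio :: real where "rad_ratio = (pow S Macro / pow S Helper) powr (1 / alpha S)"

text \<open>When SINR >= d is solved for the fading of the serving helper at distance z, this is the
  coefficient of the fading of an interferer at distance t, with k = z for helpers and k =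
  \<open>rad_ratio * z\<close> for macro stations. In the same inequality, \<open>noise_term\<close>
  is the contribution of the noise.\<close>

definition rel_gain :: "real \<Rightarrow> real \<Rightarrow> real \<Rightarrow> real" where
  "rel_gain d k t = d * (k / t) powr alpha S"

definition noise_term :: "real \<Rightarrow> real \<Rightarrow> real" where
  "noise_term d z = d * z powr alpha S * noise S / pow S Helper"

text \<open>\<open>served st d j \<omega> \<omega>'\<close>: with locations read off at \<open>\<omega>\<close> and marks at \<open>\<omega>'\<close>, helper \<open>j\<close> serves the user
  (strictly ahead of its competitors if \<open>st\<close>) and its SINR is at least \<open>d\<close>. The events for
  \<open>st = True\<close> are disjoint in \<open>j\<close> and those for \<open>st = False\<close> cover the event of the theorem; both
  families have the same total probability, so no separate argument excluding ties is needed.\<close>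

definition served :: "bool \<Rightarrow> real \<Rightarrow> nat \<Rightarrow> 'w \<Rightarrow> 'w \<Rightarrow> bool" where
  "served st d j \<omega> \<omega>' \<longleftrightarrow>
     (\<forall>i. admissible st (rad_ratio * rad Helper j \<omega>) (rad Macro i \<omega>)) \<and>
     (stores V n j \<omega>' \<and> (\<forall>i. i \<noteq> j \<longrightarrow> stores V n i \<omega>' \<longrightarrow> admissible st (rad Helper j \<omega>) (rad Helper i \<omega>)) \<and>
      noise_term d (rad Helper j \<omega>) +
      (\<Sum>i. rel_gain d (rad_ratio * rad Helper j \<omega>) (rad Macro i \<omega>) * fading V Macro i \<omega>') +
      (\<Sum>i. if i \<noteq> j \<and> active V i \<omega>' then rel_gain d (rad Helper j \<omega>) (rad Helper i \<omega>) * fading V Helper i \<omega>' else 0)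
      \<le> fading V Helper j \<omega>')"

text \<open>The mean contribution of one macro station at distance r, with the serving helper at
  distance z; \<open>helper_factor\<close> is its analogue, averaged over storage and activity as
  well.\<close>

definition macro_factor :: "bool \<Rightarrow> real \<Rightarrow> real \<Rightarrow> real \<Rightarrow> real" where
  "macro_factor st d r z = of_bool (admissible st (rad_ratio * z) r) * (1 - damping (alpha S) d (rad_ratio * z) r)"

definition helper_factor :: "bool \<Rightarrow> real \<Rightarrow> real \<Rightarrow> real \<Rightarrow> real" where
  "helper_factor st d r z = (p_Lp S * of_bool (admissible st z r) + (1 - p_Lp S)) * (1 - p_act S * damping (alpha S) d z r)"

lemma rad_ratio_pos: "0 < rad_ratio"
  using params_pos(3)[of Macro] params_pos(3)[of Helper] by (simp add: rad_ratio_def)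

text \<open>Locations and marks are read through separate maps f and g: the projections of a product
  space for decoupling, the identity for the diagonal.\<close>

lemma served_measurable:
  fixes N :: "'x measure"
  assumes [measurable]: "\<And>k i. (\<lambda>x. loc V k i (f x)) \<in> borel_measurable N"
    "\<And>k i. (\<lambda>x. fading V k i (g x)) \<in> borel_measurable N"
    "\<And>i. Measurable.pred N (\<lambda>x. stores V n i (g x))" "\<And>i. Measurable.pred N (\<lambda>x. active V i (g x))"
  shows "Measurable.pred N (\<lambda>x. served st d j (f x) (g x))"
proof -
  have gen: "Measurable.pred N (\<lambda>x. P x \<and> (Q x \<and> R x \<and> k x + s x + t x \<le> h x))"
    if [measurable]: "Measurable.pred N P" "Measurable.pred N Q" "Measurable.pred N R"
      "k \<in> borel_measurable N" "s \<in> borel_measurable N" "t \<in> borel_measurable N" "h \<in> borel_measurable N"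
    for P Q R :: "'x \<Rightarrow> bool" and k s t h :: "'x \<Rightarrow> real"
    by measurable
  have rel_gain_meas: "(\<lambda>x. rel_gain d (u x) (v x)) \<in> borel_measurable N"
    if [measurable]: "u \<in> borel_measurable N" "v \<in> borel_measurable N" for u v
    unfolding rel_gain_def by measurable
  have r: "(\<lambda>x. norm (loc V k i (f x))) \<in> borel_measurable N" for k i
    by (rule measurable_compose[OF assms(1) borel_measurable_norm])
  have imp: "Measurable.pred N (\<lambda>x. i \<noteq> j \<longrightarrow> P x \<longrightarrow> Q x)"
    if [measurable]: "Measurable.pred N P" "Measurable.pred N Q" for P Q :: "'x \<Rightarrow> bool" and i
    by measurable
  have ite: "(\<lambda>x. if i \<noteq> j \<and> P x then s x else 0) \<in> borel_measurable N"
    if [measurable]: "Measurable.pred N P" "s \<in> borel_measurable N" for P and s :: "'x \<Rightarrow> real" and i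
    by measurable
  have noise_term: "(\<lambda>x. noise_term d (u x)) \<in> borel_measurable N" if [measurable]: "u \<in> borel_measurable N" for u
    unfolding noise_term_def by measurable
  have c: "(\<lambda>x. rad_ratio * norm (loc V k i (f x))) \<in> borel_measurable N" for k i
    by (intro borel_measurable_times borel_measurable_const r)
  show ?thesis
    unfolding served_def
    by (intro gen pred_intros_countable admissible_measurable imp borel_measurable_suminf ite
        borel_measurable_times rel_gain_meas noise_term r c assms)
qed

lemma factor_bounds:
  assumes d: "0 \<le> d"
  shows "0 \<le> macro_factor st d r z" "macro_factor st d r z \<le> 1" "0 \<le> helper_factor st d r z" "helper_factor st d r z \<le> 1"
proof -
  note D = damping_bounds[OF d]
  show "0 \<le> macro_factor st d r z" "macro_factor st d r z \<le> 1"
    using D by (auto simp: macro_factor_def)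
  have "0 \<le> p_act S * damping (alpha S) d z r" "p_act S * damping (alpha S) d z r \<le> 1"
    using D p_bounds by (auto intro: mult_le_one)
  then show "0 \<le> helper_factor st d r z" "helper_factor st d r z \<le> 1"
    unfolding helper_factor_def using p_bounds by (auto intro!: mult_nonneg_nonneg mult_le_one)
qed

text \<open>A larger z enlarges the exclusion disc and strengthens each interferer relative to the
  useful signal.\<close>

lemma factor_anti:
  assumes d: "0 \<le> d" and z: "0 \<le> z" "z \<le> z'" and r: "0 \<le> r"
  shows "macro_factor st d r z' \<le> macro_factor st d r z" "helper_factor st d r z' \<le> helper_factor st d r z"
proof -
  have c: "0 \<le> rad_ratio * z" "rad_ratio * z \<le> rad_ratio * z'" using z rad_ratio_pos by (auto intro: mult_left_mono)
  have a0: "0 \<le> alpha S" using params_pos by simp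
  have ob: "of_bool (admissible st (rad_ratio * z') r) \<le> (of_bool (admissible st (rad_ratio * z) r) :: real)"
    "of_bool (admissible st z' r) \<le> (of_bool (admissible st z r) :: real)"
    using c z by (auto simp: admissible_def)
  note D = damping_mono[OF d c r a0] damping_mono[OF d z r a0] and D01 = damping_bounds[OF d, of "alpha S"]
  show "macro_factor st d r z' \<le> macro_factor st d r z"
    unfolding macro_factor_def using ob(1) D(1) D01 by (intro mult_mono) auto
  have "p_act S * damping (alpha S) d z' r \<le> 1"
    using p_bounds D01 by (intro mult_le_one) auto
  then show "helper_factor st d r z' \<le> helper_factor st d r z"
    unfolding helper_factor_def using ob(2) D(2) D01 p_bounds
    by (intro mult_mono add_right_mono mult_left_mono diff_left_mono add_nonneg_nonneg mult_nonneg_nonneg) auto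
qed

text \<open>Inside the disc of radius \<open>rad_ratio * z\<close> the factor is 0, so the loss is
  1; outside, the loss is \<open>damping\<close>. Strict and weak admissibility differ only on the
  boundary circle.\<close>

lemma nn_integral_macro_loss:
  assumes d: "0 \<le> d" and z: "0 \<le> z"
  shows "(\<integral>\<^sup>+y. ennreal (1 - macro_factor st d (norm y) z) \<partial>plane) =
    ennreal (pi * (rad_ratio * z)\<^sup>2 * (1 + G_fun d (alpha S)))"
proof -
  define k where "k = rad_ratio * z"
  have k: "0 \<le> k" using z rad_ratio_pos by (simp add: k_def)
  let ?D = "damping (alpha S) d k"
  note a = params_pos(1) and G = G_fun_nonneg[OF params_pos(1) d]
  have "(\<integral>\<^sup>+y. ennreal (1 - macro_factor st d (norm y) z) \<partial>plane) =
      (\<integral>\<^sup>+y. indicator {..<k} (norm y) + ennreal (of_bool (k \<le> norm y) * ?D (norm y)) \<partial>plane)"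
    by (rule nn_integral_radial_cong[where k = k])
       (auto simp: macro_factor_def[abs_def] admissible_def k_def[symmetric] indicator_def)
  also have "\<dots> = (\<integral>\<^sup>+y. indicator {..<k} (norm y) \<partial>plane) +
      (\<integral>\<^sup>+y. ennreal (of_bool (k \<le> norm y) * ?D (norm y)) \<partial>plane)"
    by (rule nn_integral_add) measurable
  also have "(\<integral>\<^sup>+y. indicator {..<k} (norm y) \<partial>plane) = (\<integral>\<^sup>+y. indicator (ball 0 k) y \<partial>plane)"
    by (intro nn_integral_cong) (auto simp: indicator_def)
  also have "\<dots> = ennreal (pi * k\<^sup>2)" using k by (simp add: emeasure_ball_plane)
  also have "(\<integral>\<^sup>+y. ennreal (of_bool (k \<le> norm y) * ?D (norm y)) \<partial>plane) = ennreal (pi * k\<^sup>2 * G_fun d (alpha S))"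
    by (rule nn_integral_damping_outside[OF a d k])
  also have "ennreal (pi * k\<^sup>2) + ennreal (pi * k\<^sup>2 * G_fun d (alpha S)) = ennreal (pi * k\<^sup>2 * (1 + G_fun d (alpha S)))"
    using G by (subst ennreal_plus[symmetric]) (auto simp: algebra_simps)
  finally show ?thesis by (simp add: k_def)
qed

text \<open>With D for \<open>damping\<close>, the factor inside the disc is (1 - p)(1 - p_a D),
  whose loss is p + (1 - p) p_a D. Outside it is 1 - p_a D, whose loss is divided according to
  storage. The parts with 1 - p combine to an integral over the whole plane, hence H.\<close>

lemma nn_integral_helper_loss:
  assumes d: "0 < d" and z: "0 \<le> z"
  shows "(\<integral>\<^sup>+y. ennreal (1 - helper_factor st d (norm y) z) \<partial>plane) =
    ennreal (pi * z\<^sup>2 * (p_Lp S + p_Lp S * p_act S * G_fun d (alpha S) + (1 - p_Lp S) * p_act S * H_fun d (alpha S)))"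
proof -
  let ?D = "damping (alpha S) d z"
  let ?p = "p_Lp S" and ?q = "p_act S"
  have d': "0 \<le> d" using d by simp
  note a = params_pos(1) and G = G_fun_nonneg[OF params_pos(1) d'] and H = H_fun_nonneg[OF params_pos(1) d']
  note D = damping_bounds[OF d', of "alpha S" z]
  have "(\<integral>\<^sup>+y. ennreal (1 - helper_factor st d (norm y) z) \<partial>plane) =
      (\<integral>\<^sup>+y. (ennreal ?p * indicator {..<z} (norm y) + ennreal (?p * ?q) * ennreal (of_bool (z \<le> norm y) * ?D (norm y)))
        + ennreal ((1 - ?p) * ?q) * ennreal (?D (norm y)) \<partial>plane)"
  proof (rule nn_integral_radial_cong[where k = z])
    fix t assume "0 \<le> t" "t \<noteq> z"
    show "ennreal (1 - helper_factor st d t z) = (ennreal ?p * indicator {..<z} t + ennreal (?p * ?q) * ennreal (of_bool (z \<le> t) * ?D t))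
        + ennreal ((1 - ?p) * ?q) * ennreal (?D t)"
    proof (cases "z \<le> t")
      case True
      then have "1 - helper_factor st d t z = (?p * ?q) * ?D t + ((1 - ?p) * ?q) * ?D t"
        using \<open>t \<noteq> z\<close> by (simp add: helper_factor_def admissible_def algebra_simps)
      then show ?thesis
        using True p_bounds D(1)[of t] by (simp add: ennreal_mult[symmetric] ennreal_plus[symmetric] del: ennreal_plus)
    next
      case False
      then have "1 - helper_factor st d t z = ?p + ((1 - ?p) * ?q) * ?D t"
        by (simp add: helper_factor_def admissible_def algebra_simps)
      then show ?thesis
        using False p_bounds D(1)[of t] by (simp add: ennreal_mult[symmetric] ennreal_plus[symmetric] del: ennreal_plus)
    qed
  qed (simp_all add: helper_factor_def[abs_def])
  also have "\<dots> = (ennreal ?p * (\<integral>\<^sup>+y. indicator {..<z} (norm y) \<partial>plane) +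
       ennreal (?p * ?q) * (\<integral>\<^sup>+y. ennreal (of_bool (z \<le> norm y) * ?D (norm y)) \<partial>plane)) +
       ennreal ((1 - ?p) * ?q) * (\<integral>\<^sup>+y. ennreal (?D (norm y)) \<partial>plane)"
    by (simp add: nn_integral_add nn_integral_cmult)
  also have "(\<integral>\<^sup>+y. indicator {..<z} (norm y) \<partial>plane) = (\<integral>\<^sup>+y. indicator (ball 0 z) y \<partial>plane)"
    by (intro nn_integral_cong) (auto simp: indicator_def)
  also have "\<dots> = ennreal (pi * z\<^sup>2)" using z by (simp add: emeasure_ball_plane)
  also have "(\<integral>\<^sup>+y. ennreal (of_bool (z \<le> norm y) * ?D (norm y)) \<partial>plane) = ennreal (pi * z\<^sup>2 * G_fun d (alpha S))"
    by (rule nn_integral_damping_outside[OF a d' z])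
  also have "(\<integral>\<^sup>+y. ennreal (?D (norm y)) \<partial>plane) = ennreal (pi * z\<^sup>2 * H_fun d (alpha S))"
    by (rule nn_integral_damping[OF a d z])
  also have "ennreal ?p * ennreal (pi * z\<^sup>2) + ennreal (?p * ?q) * ennreal (pi * z\<^sup>2 * G_fun d (alpha S)) +
      ennreal ((1 - ?p) * ?q) * ennreal (pi * z\<^sup>2 * H_fun d (alpha S)) =
      ennreal (?p * (pi * z\<^sup>2) + (?p * ?q) * (pi * z\<^sup>2 * G_fun d (alpha S)) + ((1 - ?p) * ?q) * (pi * z\<^sup>2 * H_fun d (alpha S)))"
    using p_bounds G H by (simp add: ennreal_mult[symmetric] ennreal_plus[symmetric] del: ennreal_plus)
  finally show ?thesis by (simp add: algebra_simps)
qed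

lemma summable_rel_gain: "summable (\<lambda>i. norm (f i) powr (- alpha S)) \<Longrightarrow> summable (\<lambda>i. rel_gain d k (norm (f i)))"
proof -
  assume s: "summable (\<lambda>i. norm (f i) powr (- alpha S))"
  have "(\<lambda>i. rel_gain d k (norm (f i))) = (\<lambda>i. (d * k powr alpha S) * norm (f i) powr (- alpha S))"
    by (simp add: rel_gain_def powr_divide powr_minus field_simps fun_eq_iff)
  then show ?thesis using s by (simp add: summable_mult)
qed

text \<open>The macro half of the association condition involves locations only; it leaves the
  integral as an indicator and is absorbed into \<open>macro_factor\<close>.\<close>

lemma nn_integral_served_marks:
  assumes d: "0 \<le> d"
    and sM: "summable (\<lambda>i. rad Macro i \<omega> powr (- alpha S))"
    and sH: "summable (\<lambda>i. rad Helper i \<omega> powr (- alpha S))"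
  shows "(\<integral>\<^sup>+\<omega>'. of_bool (served st d j \<omega> \<omega>') \<partial>M) =
    ennreal (p_Lp S * exp (- noise_term d (rad Helper j \<omega>))) *
    pprod (\<lambda>i. macro_factor st d (rad Macro i \<omega>) (rad Helper j \<omega>)) *
    pprod (\<lambda>i. if i = j then 1 else helper_factor st d (rad Helper i \<omega>) (rad Helper j \<omega>))"
proof -
  let ?z = "rad Helper j \<omega>"
  let ?admissible = "\<lambda>i. admissible st (rad_ratio * ?z) (rad Macro i \<omega>)"
  let ?tM = "\<lambda>i. rel_gain d (rad_ratio * ?z) (rad Macro i \<omega>)" and ?tH = "\<lambda>i. rel_gain d ?z (rad Helper i \<omega>)"
  let ?E = "\<lambda>\<omega>'. stores V n j \<omega>' \<and> (\<forall>i. i \<noteq> j \<longrightarrow> stores V n i \<omega>' \<longrightarrow> admissible st ?z (rad Helper i \<omega>)) \<and>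
      noise_term d ?z + (\<Sum>i. ?tM i * fading V Macro i \<omega>') +
      (\<Sum>i. if i \<noteq> j \<and> active V i \<omega>' then ?tH i * fading V Helper i \<omega>' else 0) \<le> fading V Helper j \<omega>'"
  have t0: "0 \<le> ?tM i" "0 \<le> ?tH i" for i using d by (auto simp: rel_gain_def)
  have K0: "0 \<le> noise_term d ?z" using d params_pos(6) params_pos(3)[of Helper] by (simp add: noise_term_def)
  have fM: "1 - damping (alpha S) d (rad_ratio * ?z) (rad Macro i \<omega>) = 1 / (1 + ?tM i)" for i
    using damping_eq[OF d] by (simp add: rel_gain_def)
  have "pprod (\<lambda>i. macro_factor st d (rad Macro i \<omega>) ?z) = pprod (\<lambda>i. of_bool (?admissible i)) * pprod (\<lambda>i. 1 / (1 + ?tM i))"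
    unfolding macro_factor_def fM
  proof (intro pprod_mult)
    show "0 \<le> 1 / (1 + ?tM i)" "1 / (1 + ?tM i) \<le> 1" for i
      unfolding fM[symmetric] using damping_bounds[OF d] by auto
  qed auto
  then have A: "pprod (\<lambda>i. macro_factor st d (rad Macro i \<omega>) ?z) = of_bool (\<forall>i. ?admissible i) * pprod (\<lambda>i. 1 / (1 + ?tM i))"
    unfolding pprod_of_bool .
  have fH: "?tH i / (1 + ?tH i) = damping (alpha S) d ?z (rad Helper i \<omega>)" for i
    by (simp add: damping_def rel_gain_def)
  have "(\<integral>\<^sup>+\<omega>'. of_bool (served st d j \<omega> \<omega>') \<partial>M) = of_bool (\<forall>i. ?admissible i) * (\<integral>\<^sup>+\<omega>'. of_bool (?E \<omega>') \<partial>M)"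
  proof (cases "\<forall>i. ?admissible i")
    case True
    then have *: "(\<forall>i. ?admissible i) = True" by blast
    show ?thesis unfolding served_def * by simp
  next
    case False
    then have *: "(\<forall>i. ?admissible i) = False" by blast
    show ?thesis unfolding served_def * by simp
  qed
  also have "(\<integral>\<^sup>+\<omega>'. of_bool (?E \<omega>') \<partial>M) = ennreal (p_Lp S * exp (- noise_term d ?z)) * pprod (\<lambda>i. 1 / (1 + ?tM i)) *
      pprod (\<lambda>i. if i = j then 1 else (p_Lp S * of_bool (admissible st ?z (rad Helper i \<omega>)) + (1 - p_Lp S)) * (1 - p_act S * (?tH i / (1 + ?tH i))))"
    by (rule nn_integral_marks[OF summable_rel_gain[OF sM] t0(1) summable_rel_gain[OF sH] t0(2) K0])
  finally show ?thesis
    unfolding A fH helper_factor_def by (simp only: mult_ac)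
qed

lemma AE_summable_loc: "AE \<omega> in M. summable (\<lambda>i. rad k i \<omega> powr (- alpha S))"
  by (rule ppp_AE_summable[OF ppp]) (use params_pos in auto)

definition LOC :: "source set" where "LOC = {Locations Macro, Locations Helper}"

lemma pair_loc_measurable: "(\<lambda>x. loc V k i (fst x)) \<in> borel_measurable (alg LOC \<Otimes>\<^sub>M alg (- LOC))"
  by (rule measurable_compose[OF measurable_fst alg_loc]) (cases k; simp add: LOC_def)

lemma pair_fading_measurable: "(\<lambda>x. fading V k i (snd x)) \<in> borel_measurable (alg LOC \<Otimes>\<^sub>M alg (- LOC))"
  by (rule measurable_compose[OF measurable_snd alg_fading]) (simp add: LOC_def)

lemma served_pair_measurable: "case_prod (\<lambda>\<omega> \<omega>'. of_bool (served st d j \<omega> \<omega>') :: ennreal) \<in> borel_measurable (alg LOC \<Otimes>\<^sub>M alg (- LOC))"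
proof -
  have [measurable]: "Measurable.pred (alg LOC \<Otimes>\<^sub>M alg (- LOC)) (\<lambda>x. served st d j (fst x) (snd x))"
    by (rule served_measurable pair_loc_measurable pair_fading_measurable
        measurable_compose[OF measurable_snd alg_stores] measurable_compose[OF measurable_snd alg_active] | simp add: LOC_def)+
  show ?thesis unfolding case_prod_beta by measurable
qed

lemma served_diag_measurable:
  assumes "\<And>k. Locations k \<in> A" "\<And>k i. Fading k i \<in> A" "\<And>i. Storage i \<in> A" "\<And>i. Activity i \<in> A"
  shows "Measurable.pred (alg A) (\<lambda>\<omega>. served st d j \<omega> \<omega>)"
  using assms by (intro served_measurable alg_loc alg_fading alg_stores alg_active) auto

lemma factor_measurable [measurable (raw)]:
  assumes [measurable]: "f \<in> borel_measurable N" "g \<in> borel_measurable N"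
  shows "(\<lambda>x. macro_factor st d (f x) (g x)) \<in> borel_measurable N" "(\<lambda>x. helper_factor st d (f x) (g x)) \<in> borel_measurable N"
  unfolding macro_factor_def helper_factor_def damping_def by measurable

definition beta_M :: "real \<Rightarrow> real \<Rightarrow> real" where
  "beta_M d z = pi * (rad_ratio * z)\<^sup>2 * (1 + G_fun d (alpha S))"

definition beta_H :: "real \<Rightarrow> real \<Rightarrow> real" where
  "beta_H d z = pi * z\<^sup>2 * (p_Lp S + p_Lp S * p_act S * G_fun d (alpha S) + (1 - p_Lp S) * p_act S * H_fun d (alpha S))"

lemma beta_nonneg:
  assumes "0 \<le> d"
  shows "0 \<le> beta_M d z" "0 \<le> beta_H d z"
  using G_fun_nonneg[OF params_pos(1) assms] H_fun_nonneg[OF params_pos(1) assms] p_bounds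
  by (auto simp: beta_M_def beta_H_def intro!: mult_nonneg_nonneg add_nonneg_nonneg)

text \<open>The Mecke integral in polar coordinates: intensity of helpers at distance t times the
  probability that such a helper stores the content, has no better competitor and reaches the
  threshold d.\<close>

definition delivery_prob :: "real \<Rightarrow> ennreal" where
  "delivery_prob d = (\<integral>\<^sup>+t\<in>{0..}. ennreal (2 * pi * t) * (ennreal (lam S Helper) *
     ennreal (p_Lp S * exp (- noise_term d t) * exp (- (lam S Macro * beta_M d t)) * exp (- (lam S Helper * beta_H d t)))) \<partial>lborel)"

text \<open>Two decouplings: marks against locations, and macro locations against helper locations
  with the distance of helper j frozen. The latter turns the macro product into a Laplace
  functional.\<close>

lemma nn_integral_served:
  assumes d: "0 < d"
  shows "(\<integral>\<^sup>+\<omega>. of_bool (served st d j \<omega> \<omega>) \<partial>M) =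
    (\<integral>\<^sup>+\<omega>. ennreal (p_Lp S * exp (- noise_term d (rad Helper j \<omega>)) * exp (- (lam S Macro * beta_M d (rad Helper j \<omega>)))) *
       pprod (\<lambda>i. if i = j then 1 else helper_factor st d (rad Helper i \<omega>) (rad Helper j \<omega>)) \<partial>M)"
proof -
  have d': "0 \<le> d" using d by simp
  let ?z = "\<lambda>\<omega>. rad Helper j \<omega>"
  let ?k = "\<lambda>\<omega>. ennreal (p_Lp S * exp (- noise_term d (?z \<omega>)))"
  let ?b = "\<lambda>\<omega>. pprod (\<lambda>i. if i = j then 1 else helper_factor st d (rad Helper i \<omega>) (?z \<omega>))"
  let ?a = "\<lambda>\<omega> \<omega>'. pprod (\<lambda>i. macro_factor st d (norm (loc V Macro i \<omega>')) (?z \<omega>))"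
  have "(\<integral>\<^sup>+\<omega>. of_bool (served st d j \<omega> \<omega>) \<partial>M) = (\<integral>\<^sup>+\<omega>. (\<integral>\<^sup>+\<omega>'. of_bool (served st d j \<omega> \<omega>') \<partial>M) \<partial>M)"
    by (rule decouple[OF _ served_pair_measurable]) simp
  also have "\<dots> = (\<integral>\<^sup>+\<omega>. ?k \<omega> * ?a \<omega> \<omega> * ?b \<omega> \<partial>M)"
    by (rule nn_integral_cong_AE, use AE_summable_loc[of Macro] AE_summable_loc[of Helper] in eventually_elim)
       (rule nn_integral_served_marks[OF d'])
  also have "\<dots> = (\<integral>\<^sup>+\<omega>. (\<integral>\<^sup>+\<omega>'. ?k \<omega> * ?a \<omega> \<omega>' * ?b \<omega> \<partial>M) \<partial>M)"
  proof (rule decouple)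
    let ?P = "alg {Locations Helper} \<Otimes>\<^sub>M alg {Locations Macro}"
    have [measurable]: "(\<lambda>x. loc V Helper i (fst x)) \<in> borel_measurable ?P" "(\<lambda>x. loc V Macro i (snd x)) \<in> borel_measurable ?P" for i
      by (rule measurable_compose[OF measurable_fst alg_loc], simp, rule measurable_compose[OF measurable_snd alg_loc], simp)
    have [measurable]: "(\<lambda>x. norm (loc V Helper i (fst x))) \<in> borel_measurable ?P" "(\<lambda>x. norm (loc V Macro i (snd x))) \<in> borel_measurable ?P" for i
      by measurable
    have "(\<lambda>x. ?k (fst x)) \<in> borel_measurable ?P" "(\<lambda>x. ?a (fst x) (snd x)) \<in> borel_measurable ?P" "(\<lambda>x. ?b (fst x)) \<in> borel_measurable ?P"
      unfolding noise_term_def by measurable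
    then show "(\<lambda>(\<omega>, \<omega>'). ?k \<omega> * ?a \<omega> \<omega>' * ?b \<omega>) \<in> borel_measurable ?P"
      unfolding case_prod_beta by (intro borel_measurable_times_ennreal)
  qed simp
  also have "\<dots> = (\<integral>\<^sup>+\<omega>. ennreal (p_Lp S * exp (- noise_term d (?z \<omega>)) * exp (- (lam S Macro * beta_M d (?z \<omega>)))) * ?b \<omega> \<partial>M)"
  proof (rule nn_integral_cong)
    fix \<omega>
    note [measurable] = ppp_measurable[OF ppp]
    have meas: "(\<lambda>\<omega>'. ?a \<omega> \<omega>') \<in> borel_measurable M" by measurable
    \<comment> \<open>The Laplace functional without a distinguished cell: \<open>C\<close> is empty
      and its weight is 1.\<close>
    have "(\<integral>\<^sup>+\<omega>'. ?a \<omega> \<omega>' \<partial>M) = (\<integral>\<^sup>+\<omega>'. (\<lambda>_. 1) (point_count (loc V Macro) {} \<omega>') * ?a \<omega> \<omega>' \<partial>M)"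
      by simp
    also have "\<dots> = (\<integral>\<^sup>+\<omega>'. (\<lambda>_. 1) (point_count (loc V Macro) {} \<omega>') \<partial>M) * ennreal (exp (- (lam S Macro * beta_M d (?z \<omega>))))"
    proof (rule ppp_laplace[OF ppp, where C = "{}" and \<phi> = "\<lambda>_. 1"])
      show "(\<integral>\<^sup>+x. ennreal (1 - macro_factor st d (norm x) (?z \<omega>)) \<partial>plane) = ennreal (beta_M d (?z \<omega>))"
        unfolding beta_M_def by (rule nn_integral_macro_loss[OF d']) simp
    qed (use params_pos(2)[of Macro] factor_bounds[OF d'] beta_nonneg[OF d'] in \<open>auto simp: emeasure_space_1\<close>)
    finally have a: "(\<integral>\<^sup>+\<omega>'. ?a \<omega> \<omega>' \<partial>M) = ennreal (exp (- (lam S Macro * beta_M d (?z \<omega>))))"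
      by (simp add: emeasure_space_1)
    have "(\<integral>\<^sup>+\<omega>'. ?k \<omega> * ?a \<omega> \<omega>' * ?b \<omega> \<partial>M) = ?k \<omega> * ennreal (exp (- (lam S Macro * beta_M d (?z \<omega>)))) * ?b \<omega>"
      using meas by (subst nn_integral_multc, simp, subst nn_integral_cmult, simp) (simp only: a)
    then show "(\<integral>\<^sup>+\<omega>'. ?k \<omega> * ?a \<omega> \<omega>' * ?b \<omega> \<partial>M) =
        ennreal (p_Lp S * exp (- noise_term d (?z \<omega>)) * exp (- (lam S Macro * beta_M d (?z \<omega>)))) * ?b \<omega>"
      using p_bounds by (simp add: ennreal_mult[symmetric])
  qed
  finally show ?thesis .
qed

lemma served_M_measurable: "Measurable.pred M (\<lambda>\<omega>. served st d j \<omega> \<omega>)"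
  by (rule alg_measurable_M[where A = UNIV], rule served_diag_measurable) auto

text \<open>Whatever depends only on the distance of the serving helper forms the \<open>h\<close>
  of the Mecke formula, the other helpers its \<open>b\<close>. The right side is free of
  \<open>st\<close>, which is what settles ties.\<close>

lemma sum_served:
  assumes d: "0 < d"
  shows "(\<integral>\<^sup>+\<omega>. (\<Sum>j. of_bool (served st d j \<omega> \<omega>)) \<partial>M) = delivery_prob d"
proof -
  have d': "0 \<le> d" using d by simp
  note [measurable] = ppp_measurable[OF ppp] served_M_measurable
  let ?h = "\<lambda>z. p_Lp S * exp (- noise_term d z) * exp (- (lam S Macro * beta_M d z))"
  have noise_term_meas [measurable]: "noise_term d \<in> borel_measurable borel" unfolding noise_term_def[abs_def] by measurable
  have betaM_meas [measurable]: "beta_M d \<in> borel_measurable borel" unfolding beta_M_def[abs_def] by measurable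
  have betaH_meas [measurable]: "beta_H d \<in> borel_measurable borel" unfolding beta_H_def[abs_def] by measurable
  have noise_term_nonneg: "0 \<le> noise_term d z" for z using d params_pos(6) params_pos(3)[of Helper] by (simp add: noise_term_def)
  have "(\<integral>\<^sup>+\<omega>. (\<Sum>j. of_bool (served st d j \<omega> \<omega>)) \<partial>M) = (\<Sum>j. \<integral>\<^sup>+\<omega>. of_bool (served st d j \<omega> \<omega>) \<partial>M)"
    by (rule nn_integral_suminf) measurable
  also have "\<dots> = (\<Sum>j. \<integral>\<^sup>+\<omega>. ennreal (?h (rad Helper j \<omega>)) *
       pprod (\<lambda>i. if i = j then 1 else helper_factor st d (rad Helper i \<omega>) (rad Helper j \<omega>)) \<partial>M)"
    unfolding nn_integral_served[OF d] ..
  also have "\<dots> = (\<integral>\<^sup>+\<omega>. (\<Sum>j. ennreal (?h (rad Helper j \<omega>)) *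
       pprod (\<lambda>i. if i = j then 1 else helper_factor st d (rad Helper i \<omega>) (rad Helper j \<omega>))) \<partial>M)"
    by (rule nn_integral_suminf[symmetric]) measurable
  also have "\<dots> = ennreal (lam S Helper) *
      (\<integral>\<^sup>+x. ennreal (?h (norm x) * exp (- (lam S Helper * beta_H d (norm x)))) \<partial>plane)"
  proof (rule ppp_mecke_radial[OF ppp params_pos(2), where b = "\<lambda>y z. helper_factor st d (norm y) z"])
    show "(\<lambda>(y, z). helper_factor st d (norm y) z) \<in> borel_measurable (borel \<Otimes>\<^sub>M borel)"
      unfolding case_prod_beta by measurable
    show "0 \<le> helper_factor st d (norm y) z" "helper_factor st d (norm y) z \<le> 1" for y :: "real^2" and z
      by (rule factor_bounds[OF d'])+
    show "helper_factor st d (norm y) z' \<le> helper_factor st d (norm y) z" if "0 \<le> z" "z \<le> z'" for y :: "real^2" and z z'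
      by (rule factor_anti[OF d' that norm_ge_zero])
    show "?h \<in> borel_measurable borel" by measurable
    show "0 \<le> ?h z" "?h z \<le> 1" for z
      using p_bounds noise_term_nonneg[of z] beta_nonneg[OF d', of z] params_pos(2)[of Macro] by (auto intro!: mult_le_one)
    show "?h z' \<le> ?h z" if "0 \<le> z" "z \<le> z'" for z z'
    proof -
      have "noise_term d z \<le> noise_term d z'"
        unfolding noise_term_def using that d params_pos by (intro divide_right_mono mult_right_mono mult_left_mono powr_mono2) (auto simp: less_imp_le)
      moreover have "lam S Macro * beta_M d z \<le> lam S Macro * beta_M d z'"
        unfolding beta_M_def using that rad_ratio_pos params_pos(2)[of Macro] G_fun_nonneg[OF params_pos(1) d']
        by (intro mult_left_mono mult_right_mono power_mono) auto
      ultimately show ?thesis using p_bounds by (intro mult_mono) auto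
    qed
    show "(\<integral>\<^sup>+y. ennreal (1 - helper_factor st d (norm y) z) \<partial>plane) = ennreal (beta_H d z)" if "0 \<le> z" for z
      unfolding beta_H_def by (rule nn_integral_helper_loss[OF d that])
    show "0 \<le> beta_H d z" for z by (rule beta_nonneg[OF d'])
  qed measurable
  also have "\<dots> = (\<integral>\<^sup>+x. ennreal (lam S Helper) * ennreal (?h (norm x) * exp (- (lam S Helper * beta_H d (norm x)))) \<partial>plane)"
    by (rule nn_integral_cmult[symmetric]) measurable
  also have "\<dots> = delivery_prob d"
    unfolding delivery_prob_def by (rule nn_integral_radial) measurable
  finally show ?thesis .
qed

lemma prob_served:
  assumes d: "0 < d"
  shows "(\<integral>\<^sup>+\<omega>. of_bool (\<exists>j. served False d j \<omega> \<omega>) \<partial>M) = delivery_prob d"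
proof (rule antisym)
  have "(\<integral>\<^sup>+\<omega>. of_bool (\<exists>j. served False d j \<omega> \<omega>) \<partial>M) \<le> (\<integral>\<^sup>+\<omega>. (\<Sum>j. of_bool (served False d j \<omega> \<omega>)) \<partial>M)"
  proof (intro nn_integral_mono)
    fix \<omega>
    show "of_bool (\<exists>j. served False d j \<omega> \<omega>) \<le> (\<Sum>j. of_bool (served False d j \<omega> \<omega>) :: ennreal)"
    proof (cases "\<exists>j. served False d j \<omega> \<omega>")
      case True
      then obtain j where "served False d j \<omega> \<omega>" by blast
      then show ?thesis
        using sum_le_suminf[of "\<lambda>j. of_bool (served False d j \<omega> \<omega>) :: ennreal" "{j}"] by auto
    qed simp
  qed
  then show "(\<integral>\<^sup>+\<omega>. of_bool (\<exists>j. served False d j \<omega> \<omega>) \<partial>M) \<le> delivery_prob d"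
    by (simp add: sum_served[OF d])
  have "(\<integral>\<^sup>+\<omega>. (\<Sum>j. of_bool (served True d j \<omega> \<omega>)) \<partial>M) \<le> (\<integral>\<^sup>+\<omega>. of_bool (\<exists>j. served False d j \<omega> \<omega>) \<partial>M)"
  proof (intro nn_integral_mono)
    fix \<omega>
    have weak: "served False d j \<omega> \<omega>" if "served True d j \<omega> \<omega>" for j
      using that unfolding served_def admissible_def by (auto simp: less_imp_le)
    \<comment> \<open>Both helpers store the content, so each competes with the other and would have
      to be strictly closer.\<close>
    have uniq: "i = j" if "served True d i \<omega> \<omega>" "served True d j \<omega> \<omega>" for i j
    proof (rule ccontr)
      assume "i \<noteq> j"
      then have "rad Helper i \<omega> < rad Helper j \<omega>" "rad Helper j \<omega> < rad Helper i \<omega>"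
        using that unfolding served_def admissible_def by auto
      then show False by simp
    qed
    show "(\<Sum>j. of_bool (served True d j \<omega> \<omega>) :: ennreal) \<le> of_bool (\<exists>j. served False d j \<omega> \<omega>)"
    proof (cases "\<exists>j. served True d j \<omega> \<omega>")
      case True
      then obtain j where j: "served True d j \<omega> \<omega>" by blast
      have "(\<Sum>j. of_bool (served True d j \<omega> \<omega>) :: ennreal) = (\<Sum>j\<in>{j}. of_bool (served True d j \<omega> \<omega>))"
        using uniq[OF _ j] by (intro suminf_finite) auto
      then show ?thesis using j weak[OF j] by auto
    qed simp
  qed
  then show "delivery_prob d \<le> (\<integral>\<^sup>+\<omega>. of_bool (\<exists>j. served False d j \<omega> \<omega>) \<partial>M)"
    by (simp add: sum_served[OF d])
qed

end

subsection \<open>The delivery probability\<close>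

lemma powr_minus_less_iff:
  fixes P P' r z a :: real
  assumes "0 < P" "0 < P'" "0 < r" "0 < z" "0 < a"
  shows "P' * z powr (- a) < P * r powr (- a) \<longleftrightarrow> r < (P / P') powr (1 / a) * z"
proof -
  have e: "((P / P') powr (1 / a) * z) powr a = (P / P') * z powr a"
    using assms by (simp add: powr_mult powr_powr)
  have "r < (P / P') powr (1 / a) * z \<longleftrightarrow> r powr a < ((P / P') powr (1 / a) * z) powr a"
    using assms by (intro iffI powr_less_mono2) (auto intro: powr_less_cancel2[of a])
  also have "\<dots> \<longleftrightarrow> P' * z powr (- a) < P * r powr (- a)"
    unfolding e using assms by (simp add: powr_minus field_simps)
  finally show ?thesis by simp
qed

context cache_net
begin

section \<open>Reducing delivery to the events of fixed threshold\<close>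

lemma delta_pos: "0 < delta S l"
  using params_pos by (simp add: delta_def)

lemma access_rate_ge_iff:
  assumes l: "load V (fst b) \<omega> = l + 1" and s: "0 \<le> sinr S V \<omega> b"
  shows "rate0 S \<le> access_rate S V \<omega> b \<longleftrightarrow> delta S l \<le> sinr S V \<omega> b"
proof -
  have "rate0 S \<le> access_rate S V \<omega> b \<longleftrightarrow> (real l + 1) * rate0 S / bandw S \<le> log 2 (1 + sinr S V \<omega> b)"
    using params_pos(4) by (simp add: access_rate_def l field_simps)
  also have "\<dots> \<longleftrightarrow> 2 powr ((real l + 1) * rate0 S / bandw S) \<le> 1 + sinr S V \<omega> b"
    using s by (intro le_log_iff) auto
  finally show ?thesis by (simp add: delta_def algebra_simps)
qed

text \<open>Excludes the null events on which default values intervene: a station at the origin,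
  where the power law reads 0, nonpositive fading, or a divergent interference series.\<close>

definition good :: "'w \<Rightarrow> bool" where
  "good \<omega> \<longleftrightarrow> (\<forall>k i. loc V k i \<omega> \<noteq> 0 \<and> 0 < fading V k i \<omega>) \<and>
     (\<forall>k. summable (\<lambda>i. rad k i \<omega> powr (- alpha S) * fading V k i \<omega>))"

text \<open>\<open>AE_summable_fading\<close> is for deterministic coefficients. Decoupling carries
  it over to random path losses: for almost all locations, the indicator of divergence averages to 0
  over the marks.\<close>

lemma AE_good: "AE \<omega> in M. good \<omega>"
proof -
  have tier: "(\<forall>k. P k) \<longleftrightarrow> P Macro \<and> P Helper" for P :: "tier \<Rightarrow> bool"
    by (metis tier.exhaust)
  have sum: "AE \<omega> in M. (\<Sum>i. ennreal (rad k i \<omega> powr (- alpha S) * \<bar>fading V k i \<omega>\<bar>)) \<noteq> \<top>" for k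
  proof -
    let ?P = "alg LOC \<Otimes>\<^sub>M alg (- LOC)"
    let ?f = "\<lambda>\<omega> \<omega>'. \<Sum>i. ennreal (rad k i \<omega> powr (- alpha S) * \<bar>fading V k i \<omega>'\<bar>)"
    note [measurable] = pair_loc_measurable pair_fading_measurable ppp_measurable[OF ppp]
    have m: "(\<lambda>p. ?f (fst p) (snd p)) \<in> borel_measurable ?P" by measurable
    have ob: "(\<lambda>p. of_bool (g p = \<top>) :: ennreal) \<in> borel_measurable N" if [measurable]: "g \<in> borel_measurable N"
      for g :: "'c \<Rightarrow> ennreal" and N by measurable
    have mM: "(\<lambda>\<omega>. ?f \<omega> \<omega>) \<in> borel_measurable M" by measurable
    have "(\<integral>\<^sup>+\<omega>. of_bool (?f \<omega> \<omega> = \<top>) \<partial>M) = (\<integral>\<^sup>+\<omega>. (\<integral>\<^sup>+\<omega>'. of_bool (?f \<omega> \<omega>' = \<top>) \<partial>M) \<partial>M)"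
    proof (rule decouple[of LOC "- LOC" "\<lambda>\<omega> \<omega>'. of_bool (?f \<omega> \<omega>' = \<top>)"])
      show "case_prod (\<lambda>\<omega> \<omega>'. of_bool (?f \<omega> \<omega>' = \<top>) :: ennreal) \<in> borel_measurable ?P"
        unfolding case_prod_beta by (rule ob[OF m])
    qed (rule Compl_disjoint)
    also have "\<dots> = (\<integral>\<^sup>+\<omega>. 0 \<partial>M)"
    proof (rule nn_integral_cong_AE, use AE_summable_loc[of k] in eventually_elim)
      fix \<omega> assume "summable (\<lambda>i. rad k i \<omega> powr (- alpha S))"
      from AE_summable_fading[OF this powr_ge_zero, of k]
      have "AE \<omega>' in M. of_bool (?f \<omega> \<omega>' = \<top>) = (0 :: ennreal)"
        by eventually_elim (simp only: of_bool_eq simp_thms)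
      then have "(\<integral>\<^sup>+\<omega>'. of_bool (?f \<omega> \<omega>' = \<top>) \<partial>M) = (\<integral>\<^sup>+\<omega>'. 0 \<partial>M)"
        by (rule nn_integral_cong_AE)
      then show "(\<integral>\<^sup>+\<omega>'. of_bool (?f \<omega> \<omega>' = \<top>) \<partial>M) = 0" by simp
    qed
    finally have "(\<integral>\<^sup>+\<omega>. of_bool (?f \<omega> \<omega> = \<top>) \<partial>M) = 0" by simp
    then have "AE \<omega> in M. of_bool (?f \<omega> \<omega> = \<top>) = (0 :: ennreal)"
      by (rule nn_integral_0_iff_AE[THEN iffD1, OF ob[OF mM]])
    then show ?thesis by eventually_elim (simp only: of_bool_eq_0_iff not_False_eq_True)
  qed
  have pos: "AE \<omega> in M. \<forall>i. 0 < fading V k i \<omega>" for k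
    by (intro AE_all_countable[THEN iffD2] allI AE_fading_pos)
  show ?thesis
    using ppp_AE_nonzero[OF ppp, of Macro] ppp_AE_nonzero[OF ppp, of Helper] pos[of Macro] pos[of Helper] sum[of Macro] sum[of Helper]
  proof eventually_elim
    case (elim \<omega>)
    have "summable (\<lambda>i. rad k i \<omega> powr (- alpha S) * fading V k i \<omega>)"
      if "(\<Sum>i. ennreal (rad k i \<omega> powr (- alpha S) * \<bar>fading V k i \<omega>\<bar>)) \<noteq> \<top>" "\<forall>i. 0 < fading V k i \<omega>" for k
    proof (rule summable_suminf_not_top)
      have "\<bar>fading V k i \<omega>\<bar> = fading V k i \<omega>" for i
        using that(2) by (simp add: less_imp_le)
      with that(1) show "(\<Sum>i. ennreal (rad k i \<omega> powr (- alpha S) * fading V k i \<omega>)) \<noteq> \<top>" by (simp only: not_False_eq_True)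
      show "0 \<le> rad k i \<omega> powr (- alpha S) * fading V k i \<omega>" for i
        using that(2) by (simp add: less_imp_le)
    qed
    from this[OF elim(5,3)] this[OF elim(6,4)] elim(1-4) show ?case
      unfolding good_def tier by simp
  qed
qed

lemma serving_iff:
  assumes "good \<omega>"
  shows "serving S V n \<omega> (Helper, j) \<longleftrightarrow> stores V n j \<omega> \<and>
    (\<forall>i. admissible False (rad_ratio * rad Helper j \<omega>) (rad Macro i \<omega>)) \<and>
    (\<forall>i. i \<noteq> j \<longrightarrow> stores V n i \<omega> \<longrightarrow> admissible False (rad Helper j \<omega>) (rad Helper i \<omega>))"
proof -
  have pos: "0 < rad k i \<omega>" for k i using assms by (simp add: good_def)
  have a: "0 < alpha S" using params_pos by simp
  have M: "mean_power S V \<omega> (Helper, j) < mean_power S V \<omega> (Macro, i) \<longleftrightarrow>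
      \<not> admissible False (rad_ratio * rad Helper j \<omega>) (rad Macro i \<omega>)" for i
    using powr_minus_less_iff[OF params_pos(3)[of Macro] params_pos(3)[of Helper] pos pos a]
    by (simp add: mean_power_def admissible_def rad_ratio_def not_le)
  have H: "mean_power S V \<omega> (Helper, j) < mean_power S V \<omega> (Helper, i) \<longleftrightarrow>
      \<not> admissible False (rad Helper j \<omega>) (rad Helper i \<omega>)" for i
    using powr_minus_less_iff[OF params_pos(3)[of Helper] params_pos(3)[of Helper] pos pos a] params_pos(3)[of Helper]
    by (simp add: mean_power_def admissible_def not_le)
  have "serving S V n \<omega> (Helper, j) \<longleftrightarrow> stores V n j \<omega> \<and>
    (\<forall>i. \<not> mean_power S V \<omega> (Helper, j) < mean_power S V \<omega> (Macro, i)) \<and>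
    (\<forall>i. stores V n i \<omega> \<longrightarrow> \<not> mean_power S V \<omega> (Helper, j) < mean_power S V \<omega> (Helper, i))"
    unfolding serving_def is_arg_max_def candidates_def by auto
  \<comment> \<open>For i = j the competitor is the helper itself, and the weak comparison holds
    trivially.\<close>
  also have "\<dots> \<longleftrightarrow> stores V n j \<omega> \<and>
    (\<forall>i. admissible False (rad_ratio * rad Helper j \<omega>) (rad Macro i \<omega>)) \<and>
    (\<forall>i. i \<noteq> j \<longrightarrow> stores V n i \<omega> \<longrightarrow> admissible False (rad Helper j \<omega>) (rad Helper i \<omega>))"
    unfolding M H not_not by (auto simp: admissible_def)
  finally show ?thesis .
qed

text \<open>Clearing the denominator and multiplying by z^\<alpha> over the helper power isolates
  the fading of the serving helper at distance z.\<close>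

lemma sinr_iff:
  assumes g: "good \<omega>" and d: "0 < d"
  shows "0 \<le> sinr S V \<omega> (Helper, j)"
    "d \<le> sinr S V \<omega> (Helper, j) \<longleftrightarrow>
      noise_term d (rad Helper j \<omega>) +
      (\<Sum>i. rel_gain d (rad_ratio * rad Helper j \<omega>) (rad Macro i \<omega>) * fading V Macro i \<omega>) +
      (\<Sum>i. if i \<noteq> j \<and> active V i \<omega> then rel_gain d (rad Helper j \<omega>) (rad Helper i \<omega>) * fading V Helper i \<omega> else 0)
      \<le> fading V Helper j \<omega>"
proof -
  let ?z = "rad Helper j \<omega>"
  let ?c = "d * ?z powr alpha S / pow S Helper"
  let ?rp = "\<lambda>k i. received_power S V \<omega> (k, i)"
  let ?h = "\<lambda>i. if i \<noteq> j \<and> active V i \<omega> then ?rp Helper i else 0"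
  have locpos: "0 < rad k i \<omega>" and fpos: "0 < fading V k i \<omega>" for k i
    using g by (auto simp: good_def)
  have a: "0 < alpha S" using params_pos by simp
  have rp_eq: "?rp k i = pow S k * (rad k i \<omega> powr (- alpha S) * fading V k i \<omega>)" for k i
    by (simp add: received_power_def)
  have rp_pos: "0 < ?rp k i" for k i
    unfolding rp_eq using params_pos(3)[of k] locpos[of k i] fpos[of k i] by simp
  have rp_sum: "summable (?rp k)" for k
    unfolding rp_eq using g by (intro summable_mult) (simp add: good_def)
  have h_sum: "summable ?h"
    by (rule summable_comparison_test'[where N = 0, OF rp_sum[of Helper]]) (use rp_pos[of Helper] in \<open>auto simp: less_imp_le\<close>)
  have I: "interference S V \<omega> (Helper, j) = (\<Sum>i. ?rp Macro i) + (\<Sum>i. ?h i)"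
    by (simp add: interference_def)
  \<comment> \<open>The denominator is positive thanks to the macro stations, even when the noise is
    0.\<close>
  have Ipos: "0 < interference S V \<omega> (Helper, j) + noise S"
  proof -
    have "0 < (\<Sum>i. ?rp Macro i)" by (rule suminf_pos[OF rp_sum rp_pos])
    moreover have "0 \<le> (\<Sum>i. ?h i)"
      by (rule suminf_nonneg[OF h_sum]) (use rp_pos[of Helper] in \<open>auto simp: less_imp_le\<close>)
    ultimately show ?thesis using params_pos(6) unfolding I by linarith
  qed
  show "0 \<le> sinr S V \<omega> (Helper, j)"
    unfolding sinr_def using Ipos rp_pos[of Helper j] by (simp add: less_imp_le)
  have rad_ratio_powr: "rad_ratio powr alpha S = pow S Macro / pow S Helper"
    using a params_pos(3)[of Macro] params_pos(3)[of Helper] by (simp add: rad_ratio_def powr_powr)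
  have wM: "rel_gain d (rad_ratio * ?z) (rad Macro i \<omega>) * fading V Macro i \<omega> = ?c * ?rp Macro i" for i
    using rad_ratio_pos params_pos(3)[of Helper] locpos[of Macro i]
    by (simp add: rel_gain_def rp_eq powr_divide powr_mult rad_ratio_powr powr_minus field_simps)
  have wH: "rel_gain d ?z (rad Helper i \<omega>) * fading V Helper i \<omega> = ?c * ?rp Helper i" for i
    using params_pos(3)[of Helper] locpos[of Helper i]
    by (simp add: rel_gain_def rp_eq powr_divide powr_minus field_simps)
  have sM: "(\<Sum>i. rel_gain d (rad_ratio * ?z) (rad Macro i \<omega>) * fading V Macro i \<omega>) = ?c * (\<Sum>i. ?rp Macro i)"
    unfolding wM by (rule suminf_mult[OF rp_sum])
  have "(\<Sum>i. if i \<noteq> j \<and> active V i \<omega> then rel_gain d ?z (rad Helper i \<omega>) * fading V Helper i \<omega> else 0) = (\<Sum>i. ?c * ?h i)"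
    unfolding wH by (intro suminf_cong) simp
  then have sH: "(\<Sum>i. if i \<noteq> j \<and> active V i \<omega> then rel_gain d ?z (rad Helper i \<omega>) * fading V Helper i \<omega> else 0) = ?c * (\<Sum>i. ?h i)"
    by (simp only: suminf_mult[OF h_sum])
  have "noise_term d ?z + ?c * (\<Sum>i. ?rp Macro i) + ?c * (\<Sum>i. ?h i) = ?c * (interference S V \<omega> (Helper, j) + noise S)"
    unfolding I by (simp add: noise_term_def algebra_simps)
  moreover have "?c * (interference S V \<omega> (Helper, j) + noise S) \<le> fading V Helper j \<omega> \<longleftrightarrow>
      d * (interference S V \<omega> (Helper, j) + noise S) \<le> ?rp Helper j"
    using params_pos(3)[of Helper] locpos[of Helper j]
    by (simp add: rp_eq powr_minus field_simps)
  moreover have "d \<le> sinr S V \<omega> (Helper, j) \<longleftrightarrow> d * (interference S V \<omega> (Helper, j) + noise S) \<le> ?rp Helper j"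
    unfolding sinr_def using Ipos by (rule pos_le_divide_eq)
  ultimately show "d \<le> sinr S V \<omega> (Helper, j) \<longleftrightarrow>
      noise_term d ?z + (\<Sum>i. rel_gain d (rad_ratio * ?z) (rad Macro i \<omega>) * fading V Macro i \<omega>) +
      (\<Sum>i. if i \<noteq> j \<and> active V i \<omega> then rel_gain d ?z (rad Helper i \<omega>) * fading V Helper i \<omega> else 0)
      \<le> fading V Helper j \<omega>"
    unfolding sM sH by simp
qed

definition delivered :: "'w \<Rightarrow> bool" where
  "delivered \<omega> \<longleftrightarrow> (\<exists>j. serving S V n \<omega> (Helper, j) \<and> access_rate S V \<omega> (Helper, j) \<ge> rate0 S)"

lemma delivered_iff:
  assumes g: "good \<omega>"
  shows "load V Helper \<omega> = l + 1 \<Longrightarrow> delivered \<omega> \<longleftrightarrow> (\<exists>j. served False (delta S l) j \<omega> \<omega>)"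
    and "load V Helper \<omega> = 0 \<Longrightarrow> \<not> delivered \<omega>"
proof -
  assume l: "load V Helper \<omega> = l + 1"
  have "serving S V n \<omega> (Helper, j) \<and> rate0 S \<le> access_rate S V \<omega> (Helper, j) \<longleftrightarrow> served False (delta S l) j \<omega> \<omega>" for j
    using access_rate_ge_iff[of "(Helper, j)" \<omega> l] l serving_iff[OF g] sinr_iff[OF g delta_pos[of l], of j]
    unfolding served_def by auto
  then show "delivered \<omega> \<longleftrightarrow> (\<exists>j. served False (delta S l) j \<omega> \<omega>)"
    by (simp add: delivered_def)
next
  assume "load V Helper \<omega> = 0"
  \<comment> \<open>Division by a zero load gives rate 0, which is below the positive
    \<open>rate0\<close>.\<close>
  then have "access_rate S V \<omega> (Helper, j) = 0" for j by (simp add: access_rate_def)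
  then show "\<not> delivered \<omega>"
    using params_pos(5) by (simp add: delivered_def not_le)
qed

lemma delivered_measurable: "Measurable.pred M delivered"
proof -
  note [measurable] = ppp_measurable[OF ppp] stores_measurable active_measurable load_measurable
  have rp [measurable]: "(\<lambda>\<omega>. received_power S V \<omega> (k, i)) \<in> borel_measurable M" for k i
    unfolding received_power_def prod.case by measurable
  have mp [measurable]: "(\<lambda>\<omega>. mean_power S V \<omega> (k, i)) \<in> borel_measurable M" for k i
    unfolding mean_power_def prod.case by measurable
  have [measurable]: "(\<lambda>\<omega>. interference S V \<omega> (Helper, j)) \<in> borel_measurable M" for j
  proof -
    have "(\<lambda>\<omega>. if (Helper, i) \<noteq> (Helper, j) \<and> active V i \<omega> then received_power S V \<omega> (Helper, i) else 0) \<in> borel_measurable M" for i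
      by measurable
    moreover have "(\<lambda>\<omega>. if (Macro, i) \<noteq> (Helper, j) then received_power S V \<omega> (Macro, i) else 0) \<in> borel_measurable M" for i
      by measurable
    ultimately show ?thesis
      unfolding interference_def by (intro borel_measurable_add borel_measurable_suminf)
  qed
  have [measurable]: "(\<lambda>\<omega>. access_rate S V \<omega> (Helper, j)) \<in> borel_measurable M" for j
  proof -
    have [measurable]: "(\<lambda>\<omega>. sinr S V \<omega> (Helper, j)) \<in> borel_measurable M" unfolding sinr_def by measurable
    show ?thesis unfolding access_rate_def fst_conv by measurable
  qed
  have "serving S V n \<omega> (Helper, j) \<longleftrightarrow> stores V n j \<omega> \<and>
    (\<forall>i. \<not> mean_power S V \<omega> (Helper, j) < mean_power S V \<omega> (Macro, i)) \<and>
    (\<forall>i. stores V n i \<omega> \<longrightarrow> \<not> mean_power S V \<omega> (Helper, j) < mean_power S V \<omega> (Helper, i))" for \<omega> j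
    unfolding serving_def is_arg_max_def candidates_def by auto
  then show ?thesis
    unfolding delivered_def[abs_def] by simp
qed

section \<open>Mixing over the load\<close>

lemma P_load_nonneg: "0 \<le> P_load S k l"
  using prob_load[of k l] measure_nonneg by metis

text \<open>The terms are probabilities of disjoint events, so countable additivity bounds their
  sum.\<close>

lemma summable_P_load: "summable (P_load S k)"
proof -
  note [measurable] = load_measurable[of k]
  have "(\<Sum>l. ennreal (P_load S k l)) = (\<Sum>l. emeasure M {\<omega> \<in> space M. load V k \<omega> = l + 1})"
    by (simp only: emeasure_eq_measure prob_load)
  also have "\<dots> = emeasure M (\<Union>l. {\<omega> \<in> space M. load V k \<omega> = l + 1})"
    by (rule suminf_emeasure) (auto simp: disjoint_family_on_def)
  finally show ?thesis
    using P_load_nonneg by (intro summable_suminf_not_top) auto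
qed

text \<open>Splitting by the load replaces the random threshold by the constants
  \<open>delta S l\<close>; the load and the event at a fixed threshold belong to disjoint groups of
  sources.\<close>

lemma emeasure_delivered:
  "emeasure M {\<omega> \<in> space M. delivered \<omega>} = (\<Sum>l. ennreal (P_load S Helper l) * delivery_prob (delta S l))"
proof -
  note [measurable] = delivered_measurable load_measurable[of Helper] served_M_measurable
  have "emeasure M {\<omega> \<in> space M. delivered \<omega>} = (\<integral>\<^sup>+\<omega>. indicator {\<omega> \<in> space M. delivered \<omega>} \<omega> \<partial>M)"
    by simp
  also have "\<dots> = (\<integral>\<^sup>+\<omega>. (\<Sum>l. of_bool (load V Helper \<omega> = l + 1) * of_bool (\<exists>j. served False (delta S l) j \<omega> \<omega>)) \<partial>M)"
  proof (rule nn_integral_cong_AE, use AE_good AE_space in eventually_elim)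
    fix \<omega> assume g: "good \<omega>" and sp: "\<omega> \<in> space M"
    let ?f = "\<lambda>l. of_bool (load V Helper \<omega> = l + 1) * of_bool (\<exists>j. served False (delta S l) j \<omega> \<omega>) :: ennreal"
    show "indicator {\<omega> \<in> space M. delivered \<omega>} \<omega> = (\<Sum>l. ?f l)"
    proof (cases "load V Helper \<omega>")
      case 0
      then show ?thesis using delivered_iff(2)[OF g 0] by simp
    next
      case (Suc m)
      then have "(\<Sum>l. ?f l) = (\<Sum>l\<in>{m}. ?f l)"
        by (intro suminf_finite) auto
      then show ?thesis using Suc sp delivered_iff(1)[OF g, of m] by (simp add: indicator_def)
    qed
  qed
  also have "\<dots> = (\<Sum>l. \<integral>\<^sup>+\<omega>. of_bool (load V Helper \<omega> = l + 1) * of_bool (\<exists>j. served False (delta S l) j \<omega> \<omega>) \<partial>M)"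
    by (rule nn_integral_suminf) measurable
  also have "\<dots> = (\<Sum>l. ennreal (P_load S Helper l) * delivery_prob (delta S l))"
  proof (intro suminf_cong)
    fix l
    have ml: "(\<lambda>\<omega>. of_bool (load V Helper \<omega> = l + 1) :: ennreal) \<in> borel_measurable (alg {Load})"
    proof -
      note [measurable] = alg_load[of "{Load}"]
      show ?thesis by measurable
    qed
    have me: "(\<lambda>\<omega>. of_bool (\<exists>j. served False (delta S l) j \<omega> \<omega>) :: ennreal) \<in> borel_measurable (alg (- {Load}))"
    proof -
      have [measurable]: "Measurable.pred (alg (- {Load})) (\<lambda>\<omega>. served False (delta S l) j \<omega> \<omega>)" for j
        by (rule served_diag_measurable) auto
      show ?thesis by measurable
    qed
    have "(\<integral>\<^sup>+\<omega>. of_bool (load V Helper \<omega> = l + 1) \<partial>M) = (\<integral>\<^sup>+\<omega>. indicator {\<omega> \<in> space M. load V Helper \<omega> = l + 1} \<omega> \<partial>M)"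
      by (intro nn_integral_cong) (simp add: indicator_def)
    also have "\<dots> = emeasure M {\<omega> \<in> space M. load V Helper \<omega> = l + 1}"
      by (rule nn_integral_indicator) measurable
    finally have pl: "(\<integral>\<^sup>+\<omega>. of_bool (load V Helper \<omega> = l + 1) \<partial>M) = ennreal (P_load S Helper l)"
      by (simp only: emeasure_eq_measure prob_load)
    show "(\<integral>\<^sup>+\<omega>. of_bool (load V Helper \<omega> = l + 1) * of_bool (\<exists>j. served False (delta S l) j \<omega> \<omega>) \<partial>M) =
        ennreal (P_load S Helper l) * delivery_prob (delta S l)"
      unfolding pl[symmetric] prob_served[OF delta_pos, symmetric]
      by (rule nn_integral_indep_mult[OF _ ml me]) simp
  qed
  finally show ?thesis .
qed

text \<open>The prefactor p_Lp times the helper intensity clears the denominators of the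
  coefficients. Then \<open>xi\<close> and \<open>varsigma\<close> carry the interference parts of
  the two Poisson exponents and \<open>zeta\<close> the empty discs; the power ratio enters as
  \<open>rad_ratio\<^sup>2\<close>.\<close>

lemma C_integrand_eq:
  "C_integrand S z l = 2 * pi * z * (lam S Helper * (p_Lp S * exp (- noise_term (delta S l) z) *
     exp (- (lam S Macro * beta_M (delta S l) z)) * exp (- (lam S Helper * beta_H (delta S l) z)))) * P_load S Helper l"
proof -
  define G H where "G = G_fun (delta S l) (alpha S)" and "H = H_fun (delta S l) (alpha S)"
  define m1 m2 where "m1 = pow S Macro powr (2 / alpha S)" and "m2 = pow S Helper powr (2 / alpha S)"
  have m2: "0 < m2" using params_pos(3)[of Helper] by (simp add: m2_def)
  have rad_ratio2: "rad_ratio\<^sup>2 = m1 / m2"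
    using params_pos(3)[of Macro] params_pos(3)[of Helper]
    by (simp add: rad_ratio_def m1_def m2_def power2_eq_square powr_add[symmetric] powr_divide)
  have p: "0 < p_Lp S" "0 < lam S Helper" using p_bounds params_pos(2) by auto
  have xi: "xi S Helper = (lam S Macro * m1 / m2 + p_act S * p_Lp S * lam S Helper) / (p_Lp S * lam S Helper)"
    using m2 p by (simp add: xi_def m1_def[symmetric] m2_def[symmetric] field_simps)
  have vs: "varsigma S Helper = p_act S * (1 - p_Lp S) / p_Lp S"
    using m2 p by (simp add: varsigma_def m1_def[symmetric] m2_def[symmetric] field_simps)
  have ze: "zeta S Helper = (lam S Macro * m1 / m2 + p_Lp S * lam S Helper) / (p_Lp S * lam S Helper)"
    using m2 p by (simp add: zeta_def m1_def[symmetric] m2_def[symmetric] field_simps)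
  have "pi * p_Lp S * lam S Helper * z\<^sup>2 * (xi S Helper * G + varsigma S Helper * H + zeta S Helper) =
      pi * z\<^sup>2 * ((p_Lp S * lam S Helper * xi S Helper) * G + (p_Lp S * lam S Helper * varsigma S Helper) * H + p_Lp S * lam S Helper * zeta S Helper)"
    by (simp add: algebra_simps)
  also have "p_Lp S * lam S Helper * xi S Helper = lam S Macro * m1 / m2 + p_act S * p_Lp S * lam S Helper"
    unfolding xi using p by simp
  also have "p_Lp S * lam S Helper * varsigma S Helper = lam S Helper * (p_act S * (1 - p_Lp S))"
    unfolding vs using p by simp
  also have "p_Lp S * lam S Helper * zeta S Helper = lam S Macro * m1 / m2 + p_Lp S * lam S Helper"
    unfolding ze using p by simp
  also have "pi * z\<^sup>2 * ((lam S Macro * m1 / m2 + p_act S * p_Lp S * lam S Helper) * G + lam S Helper * (p_act S * (1 - p_Lp S)) * H +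
      (lam S Macro * m1 / m2 + p_Lp S * lam S Helper)) =
      lam S Macro * beta_M (delta S l) z + lam S Helper * beta_H (delta S l) z"
    by (simp add: beta_M_def beta_H_def G_def[symmetric] H_def[symmetric] power_mult_distrib rad_ratio2 algebra_simps add_divide_distrib)
  finally have e: "pi * p_Lp S * lam S Helper * z\<^sup>2 * (xi S Helper * G + varsigma S Helper * H + zeta S Helper) =
      lam S Macro * beta_M (delta S l) z + lam S Helper * beta_H (delta S l) z" .
  have k: "z powr alpha S * inverse (pow S Helper) * delta S l * noise S = noise_term (delta S l) z"
    by (simp add: noise_term_def divide_inverse mult_ac)
  show ?thesis
    unfolding C_integrand_def G_def[symmetric] H_def[symmetric] e k minus_add_distrib exp_add
    by (simp only: mult_ac)
qed

lemma C_integrand_nonneg: "0 \<le> z \<Longrightarrow> 0 \<le> C_integrand S z l"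
  unfolding C_integrand_eq using p_bounds params_pos(2)[of Helper] P_load_nonneg[of Helper l]
  by (intro mult_nonneg_nonneg) (auto simp: less_imp_le)

text \<open>All exponentials are at most 1, which leaves the load probabilities as majorant.\<close>

lemma C_integrand_summable:
  assumes z: "0 < z"
  shows "summable (C_integrand S z)"
proof (rule summable_comparison_test'[where N = 0])
  show "summable (\<lambda>l. 2 * pi * z * lam S Helper * p_Lp S * P_load S Helper l)"
    by (intro summable_mult summable_P_load)
  fix l
  let ?d = "delta S l"
  let ?e = "exp (- noise_term ?d z) * exp (- (lam S Macro * beta_M ?d z)) * exp (- (lam S Helper * beta_H ?d z))"
  have "0 \<le> noise_term ?d z"
    using delta_pos[of l] params_pos(6) params_pos(3)[of Helper] by (simp add: noise_term_def)
  then have "?e \<le> 1"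
    using beta_nonneg[OF less_imp_le[OF delta_pos[of l]], of z] params_pos(2)[of Macro] params_pos(2)[of Helper]
    by (intro mult_le_one) auto
  then have "2 * pi * z * lam S Helper * p_Lp S * P_load S Helper l * ?e \<le> 2 * pi * z * lam S Helper * p_Lp S * P_load S Helper l * 1"
    using z p_bounds params_pos(2)[of Helper] P_load_nonneg[of Helper l]
    by (intro mult_left_mono) auto
  moreover have "C_integrand S z l = 2 * pi * z * lam S Helper * p_Lp S * P_load S Helper l * ?e"
    unfolding C_integrand_eq by (simp only: mult_ac)
  ultimately show "norm (C_integrand S z l) \<le> 2 * pi * z * lam S Helper * p_Lp S * P_load S Helper l"
    using C_integrand_nonneg[of z l] z by simp
qed

lemma C_integrand_measurable [measurable]: "(\<lambda>z. C_integrand S z l) \<in> borel_measurable borel"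
  unfolding C_integrand_def by measurable

lemma delivery_prob_C_integrand:
  "ennreal (P_load S Helper l) * delivery_prob (delta S l) = (\<integral>\<^sup>+z. ennreal (indicator {0<..} z * C_integrand S z l) \<partial>lborel)"
proof -
  have [measurable]: "noise_term (delta S l) \<in> borel_measurable borel" "beta_M (delta S l) \<in> borel_measurable borel"
    "beta_H (delta S l) \<in> borel_measurable borel"
    unfolding noise_term_def[abs_def] beta_M_def[abs_def] beta_H_def[abs_def] by measurable
  show ?thesis
    unfolding delivery_prob_def
  proof (subst nn_integral_cmult[symmetric])
    show "(\<integral>\<^sup>+t. ennreal (P_load S Helper l) * (ennreal (2 * pi * t) * (ennreal (lam S Helper) *
       ennreal (p_Lp S * exp (- noise_term (delta S l) t) * exp (- (lam S Macro * beta_M (delta S l) t)) * exp (- (lam S Helper * beta_H (delta S l) t)))) * indicator {0..} t) \<partial>lborel) =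
       (\<integral>\<^sup>+z. ennreal (indicator {0<..} z * C_integrand S z l) \<partial>lborel)"
    proof (rule nn_integral_cong)
      fix t :: real
      show "ennreal (P_load S Helper l) * (ennreal (2 * pi * t) * (ennreal (lam S Helper) *
       ennreal (p_Lp S * exp (- noise_term (delta S l) t) * exp (- (lam S Macro * beta_M (delta S l) t)) * exp (- (lam S Helper * beta_H (delta S l) t)))) * indicator {0..} t) =
       ennreal (indicator {0<..} t * C_integrand S t l)"
      proof (cases "0 < t")
        case True
        then show ?thesis
          using p_bounds params_pos(2)[of Helper] P_load_nonneg[of Helper l]
          by (simp add: C_integrand_eq ennreal_mult[symmetric] mult_ac)
      next
        \<comment> \<open>The factor 2 pi t vanishes at t = 0, which bridges \<open>{0..}\<close>
          and \<open>{0<..}\<close>.\<close>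
        case False
        then show ?thesis by (cases "t = 0") auto
      qed
    qed
  qed measurable
qed

text \<open>Tonelli exchanges the sum over loads with the integral, and integrability follows
  because the total is a probability. Summability and integrability belong to the claim since
  \<open>suminf\<close> and the Lebesgue integral would otherwise return default values.\<close>

theorem delivery_probability:
  "(\<forall>z>0. summable (C_integrand S z)) \<and>
   set_integrable lborel {0<..} (\<lambda>z. \<Sum>l. C_integrand S z l) \<and>
   C_Lp2 M S V n = (LINT z:{0<..}|lborel. (\<Sum>l. C_integrand S z l))"
proof -
  let ?F = "\<lambda>z. indicator {0<..} z * (\<Sum>l. C_integrand S z l)"
  have F0: "0 \<le> ?F z" for z
    using suminf_nonneg[OF C_integrand_summable C_integrand_nonneg] by (auto simp: indicator_def)
  have F_meas: "?F \<in> borel_measurable lborel" by measurable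
  have "emeasure M {\<omega> \<in> space M. delivered \<omega>} = (\<Sum>l. \<integral>\<^sup>+z. ennreal (indicator {0<..} z * C_integrand S z l) \<partial>lborel)"
    unfolding emeasure_delivered delivery_prob_C_integrand ..
  also have "\<dots> = (\<integral>\<^sup>+z. (\<Sum>l. ennreal (indicator {0<..} z * C_integrand S z l)) \<partial>lborel)"
    by (rule nn_integral_suminf[symmetric]) measurable
  also have "\<dots> = (\<integral>\<^sup>+z. ennreal (?F z) \<partial>lborel)"
  proof (rule nn_integral_cong)
    fix z :: real
    show "(\<Sum>l. ennreal (indicator {0<..} z * C_integrand S z l)) = ennreal (?F z)"
      using C_integrand_summable[of z] C_integrand_nonneg[of z] by (auto simp: indicator_def intro!: suminf_ennreal2)
  qed
  finally have eq: "emeasure M {\<omega> \<in> space M. delivered \<omega>} = (\<integral>\<^sup>+z. ennreal (?F z) \<partial>lborel)" .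
  have int: "integrable lborel ?F"
    using F_meas F0 by (intro integrableI_nonneg) (auto simp: eq[symmetric] emeasure_eq_measure)
  have "C_Lp2 M S V n = measure M {\<omega> \<in> space M. delivered \<omega>}"
    by (simp add: C_Lp2_def delivered_def)
  also have "\<dots> = integral\<^sup>L lborel ?F"
    using F_meas F0 by (subst integral_eq_nn_integral) (auto simp: eq[symmetric] measure_def)
  finally show ?thesis
    using C_integrand_summable int by (simp add: set_integrable_def set_lebesgue_integral_def)
qed

end

theorem lemma3:
  fixes M :: "'w measure" and S :: params and V :: "'w network" and n :: nat
  assumes "valid_params S"
    and "cache_network M S V"
    and "n \<in> second_group S"
  shows "(\<forall>z>0. summable (C_integrand S z)) \<and>
         set_integrable lborel {0<..} (\<lambda>z. \<Sum>l. C_integrand S z l) \<and>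
         C_Lp2 M S V n = (LINT z:{0<..}|lborel. (\<Sum>l. C_integrand S z l))"
proof -
  interpret cache_net M S V n
    using assms by unfold_locales
  show ?thesis by (rule delivery_probability)
qed

end
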